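(* Let $(A,\mathcal D,\mathcal L)$ be a Hadamard triple in $\mathbb R^d$ such that $\mathcal D$ is a complete set of representatives for $\mathbb Z^d/A^T\mathbb Z^d$, and let $X=X(A^T,\mathcal D)$ be the corresponding attractor. Suppose $A$ has no proper invariant subspaces. Let $\Lambda$ be the smallest lattice in $\mathbb R^d$ containing all the sets $-C$, where $C$ runs over the $m_{\mathcal D}$-extreme cycles, and which is invariant under the affine mappings $x\mapsto Ax+l$ for $l\in\mathcal L$. Then the dual lattice $\Gamma=\Lambda^\circ$ makes $X$ tile $\mathbb R^d$ with $\Gamma$-translations (up to Lebesgue measure zero).
   Context: A Hadamard triple in $\mathbb R^d$ is a system $(A,\mathcal D,\mathcal L)$ where $A$ is a $d\times d$ integer matrix that is expansive (all eigenvalues $\lambda$ satisfy $|\lambda|>1$), $\mathcal D,\mathcal L\subset\mathbb Z^d$ with $\#\mathcal D=\#\mathcal L=|\det A|$, and the matrix $\frac1{\sqrt{|\det A|}}\bigl(e^{2\pi i (A^T)^{-1}d\cdot l}\bigr)_{d\in\mathcal D,\,l\in\mathcal L}$ is unitary. $X(A^T,\mathcal D)=\{\sum_{j\ge1}(A^T)^{-j}d_j: d_j\in\mathcal D\}$. Put $m_{\mathcal D}(\xi)=\frac1{|\det A|}\sum_{d\in\mathcal D}e^{2\pi i d\cdot\xi}$ and $\sigma_l(x)=A^{-1}(x+l)$, $l\in\mathcal L$. A cycle for $(\sigma_l)_{l\in\mathcal L}$ is a finite set $C=\{x_0,\dots,x_{p-1}\}\subset\mathbb R^d$ such that for some $l_0,\dots,l_{p-1}\in\mathcal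 L$, $\sigma_{l_i}(x_i)=x_{i+1}$ for $0\le i\le p-2$ and $\sigma_{l_{p-1}}(x_{p-1})=x_0$. It is $m_{\mathcal D}$-extreme (an $m_{\mathcal D}$-cycle) if $|m_{\mathcal D}(x_i)|=1$ for all $i$. A lattice is a rank-$d$ (discrete) subgroup of $\mathbb R^d$, i.e. $M\mathbb Z^d$ with $M$ an invertible real matrix; the dual lattice is $\Lambda^\circ=\{\lambda\in\mathbb R^d:\lambda\cdot\xi\in\mathbb Z\text{ for all }\xi\in\Lambda\}$. "No proper invariant subspaces" means that no linear subspace of $\mathbb R^d$ other than $\{0\}$ and $\mathbb R^d$ is mapped into itself by $A$. $X$ tiles $\mathbb R^d$ by $\Gamma$ up to measure zero if $\bigcup_{\gamma\in\Gamma}(X+\gamma)=\mathbb R^d$ up to a Lebesgue null set and $(X+\gamma)\cap(X+\gamma')$ is Lebesgue null for $\gamma\ne\gamma'$ in $\Gamma$. *)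

theory Defs
  imports "HOL-Analysis.Analysis"
begin

definition int_vecs :: "(real^'n) set" where
  "int_vecs = {x. \<forall>i. x $ i \<in> \<int>}"

definition int_matrix :: "real^'n^'n \<Rightarrow> bool" where
  "int_matrix A \<longleftrightarrow> (\<forall>i j. A $ i $ j \<in> \<int>)"

text \<open>Eigenvalues are taken over the complex numbers, hence the complexification of \<open>A\<close>.\<close>

definition expansive :: "real^'n^'n \<Rightarrow> bool" where
  "expansive A \<longleftrightarrow>
     (\<forall>ev::complex. (\<exists>v. v \<noteq> 0 \<and> map_matrix complex_of_real A *v v = ev *s v) \<longrightarrow> 1 < cmod ev)"

text \<open>A matrix whose rows are indexed by \<open>I\<close> and whose columns are indexed by \<open>J\<close> is a function
  of two arguments; it is unitary if \<open>U U\<^sup>* = 1\<close> and \<open>U\<^sup>* U = 1\<close>.\<close>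

definition unitary_on :: "'i set \<Rightarrow> 'j set \<Rightarrow> ('i \<Rightarrow> 'j \<Rightarrow> complex) \<Rightarrow> bool" where
  "unitary_on I J U \<longleftrightarrow>
     (\<forall>i\<in>I. \<forall>i'\<in>I. (\<Sum>j\<in>J. U i j * cnj (U i' j)) = (if i = i' then 1 else 0)) \<and>
     (\<forall>j\<in>J. \<forall>j'\<in>J. (\<Sum>i\<in>I. cnj (U i j) * U i j') = (if j = j' then 1 else 0))"

definition hadamard_triple :: "real^'n^'n \<Rightarrow> (real^'n) set \<Rightarrow> (real^'n) set \<Rightarrow> bool" where
  "hadamard_triple A D L \<longleftrightarrow>
     int_matrix A \<and> expansive A \<and>
     D \<subseteq> int_vecs \<and> L \<subseteq> int_vecs \<and> finite D \<and> finite L \<and>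
     real (card D) = \<bar>det A\<bar> \<and> real (card L) = \<bar>det A\<bar> \<and>
     unitary_on D L
       (\<lambda>d l. complex_of_real (1 / sqrt \<bar>det A\<bar>) *
          exp (2 * complex_of_real pi * \<i> *
               complex_of_real ((matrix_inv (transpose A) *v d) \<bullet> l)))"

definition complete_representatives :: "real^'n^'n \<Rightarrow> (real^'n) set \<Rightarrow> bool" where
  "complete_representatives B D \<longleftrightarrow>
     D \<subseteq> int_vecs \<and>
     (\<forall>z\<in>int_vecs. \<exists>!d. d \<in> D \<and> z - d \<in> (\<lambda>y. B *v y) ` int_vecs)"

text \<open>The set of all sums of \<open>B\<^sup>-\<^sup>j d\<^sub>j\<close> over \<open>j \<ge> 1\<close> with digits \<open>d\<^sub>j \<in> D\<close>. The sequence \<open>\<delta>\<close> starts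
  at index 0, so \<open>\<delta> j\<close> is the digit with number \<open>Suc j\<close>.\<close>

definition attractor :: "real^'n^'n \<Rightarrow> (real^'n) set \<Rightarrow> (real^'n) set" where
  "attractor B D =
     {x. \<exists>\<delta>. (\<forall>j. \<delta> j \<in> D) \<and> (\<lambda>j. ((\<lambda>y. matrix_inv B *v y) ^^ Suc j) (\<delta> j)) sums x}"

definition no_proper_invariant_subspaces :: "real^'n^'n \<Rightarrow> bool" where
  "no_proper_invariant_subspaces A \<longleftrightarrow>
     (\<forall>W. subspace W \<and> (\<forall>x\<in>W. A *v x \<in> W) \<longrightarrow> W = {0} \<or> W = UNIV)"

definition mask :: "real^'n^'n \<Rightarrow> (real^'n) set \<Rightarrow> real^'n \<Rightarrow> complex" where
  "mask A D \<xi> =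
     complex_of_real (1 / \<bar>det A\<bar>) *
       (\<Sum>d\<in>D. exp (2 * complex_of_real pi * \<i> * complex_of_real (d \<bullet> \<xi>)))"

definition sigma_map :: "real^'n^'n \<Rightarrow> real^'n \<Rightarrow> real^'n \<Rightarrow> real^'n" where
  "sigma_map A l x = matrix_inv A *v (x + l)"

definition is_cycle :: "real^'n^'n \<Rightarrow> (real^'n) set \<Rightarrow> (real^'n) set \<Rightarrow> bool" where
  "is_cycle A L C \<longleftrightarrow>
     (\<exists>(p::nat) x l. 0 < p \<and> C = x ` {..<p} \<and> (\<forall>i<p. l i \<in> L) \<and>
        (\<forall>i. Suc i < p \<longrightarrow> sigma_map A (l i) (x i) = x (Suc i)) \<and>
        sigma_map A (l (p - 1)) (x (p - 1)) = x 0)"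

definition extreme_cycle ::
  "real^'n^'n \<Rightarrow> (real^'n) set \<Rightarrow> (real^'n) set \<Rightarrow> (real^'n) set \<Rightarrow> bool" where
  "extreme_cycle A D L C \<longleftrightarrow> is_cycle A L C \<and> (\<forall>x\<in>C. cmod (mask A D x) = 1)"

definition is_lattice :: "(real^'n) set \<Rightarrow> bool" where
  "is_lattice \<Lambda> \<longleftrightarrow> (\<exists>M::real^'n^'n. invertible M \<and> \<Lambda> = (\<lambda>z. M *v z) ` int_vecs)"

definition dual_lattice :: "(real^'n) set \<Rightarrow> (real^'n) set" where
  "dual_lattice \<Lambda> = {\<gamma>. \<forall>\<xi>\<in>\<Lambda>. \<gamma> \<bullet> \<xi> \<in> \<int>}"

definition admissible_lattice ::
  "real^'n^'n \<Rightarrow> (real^'n) set \<Rightarrow> (real^'n) set \<Rightarrow> (real^'n) set \<Rightarrow> bool" where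
  "admissible_lattice A D L \<Lambda> \<longleftrightarrow>
     is_lattice \<Lambda> \<and>
     (\<forall>C. extreme_cycle A D L C \<longrightarrow> uminus ` C \<subseteq> \<Lambda>) \<and>
     (\<forall>l\<in>L. (\<lambda>x. A *v x + l) ` \<Lambda> \<subseteq> \<Lambda>)"

definition smallest_admissible_lattice ::
  "real^'n^'n \<Rightarrow> (real^'n) set \<Rightarrow> (real^'n) set \<Rightarrow> (real^'n) set \<Rightarrow> bool" where
  "smallest_admissible_lattice A D L \<Lambda> \<longleftrightarrow>
     admissible_lattice A D L \<Lambda> \<and> (\<forall>\<Lambda>'. admissible_lattice A D L \<Lambda>' \<longrightarrow> \<Lambda> \<subseteq> \<Lambda>')"

definition tiles_by :: "(real^'n) set \<Rightarrow> (real^'n) set \<Rightarrow> bool" where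
  "tiles_by X \<Gamma> \<longleftrightarrow>
     negligible (UNIV - (\<Union>\<gamma>\<in>\<Gamma>. (\<lambda>x. x + \<gamma>) ` X)) \<and>
     (\<forall>\<gamma>\<in>\<Gamma>. \<forall>\<gamma>'\<in>\<Gamma>. \<gamma> \<noteq> \<gamma>' \<longrightarrow>
        negligible ((\<lambda>x. x + \<gamma>) ` X \<inter> (\<lambda>x. x + \<gamma>') ` X))"

end

theory Submission
  imports Defs "HOL-Complex_Analysis.Complex_Analysis"
begin

text \<open>
  Write \<open>B\<close> for the transpose of \<open>A\<close>, \<open>q\<close> for the number of digits, \<open>X\<close> for the attractor and \<open>m\<close>
  for the mask.

  Both lattices of the theorem have a direct description. Let \<open>P\<close> be the set of all points \<open>x\<close> with
  \<open>(d - d') \<bullet> A\<^sup>k x\<close> integral for all digits \<open>d, d'\<close> and all \<open>k\<close>. Since \<open>D\<close> is a complete set of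
  representatives, \<open>A\<close> acts bijectively on the finite group \<open>P / \<int>\<^sup>n\<close>. Extreme cycles lie in \<open>P\<close>;
  conversely the inverse branches carry every point of \<open>P\<close> along a bounded orbit inside the discrete set
  \<open>P\<close>, hence into an extreme cycle. So \<open>P\<close> is the smallest admissible lattice
  (\<open>smallest_admissible_iff\<close>). Its dual \<open>G\<close> is a \<open>B\<close>-invariant sublattice of \<open>\<int>\<^sup>n\<close> that contains all
  differences of digits.

  The translates of \<open>X\<close> by \<open>G\<close> cover because their union is closed, relatively dense and mapped into
  itself by the contraction \<open>y \<mapsto> B\<^sup>-\<^sup>1 (y + d)\<close> for a fixed digit \<open>d\<close> (\<open>translates_cover\<close>).

  For the disjointness let \<open>v n\<close> be the measure of the intersection of \<open>X\<close> and \<open>X + n\<close>. The identity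
  \<open>B X = X + D\<close>, a union that is disjoint up to null sets, turns into a linear recursion for \<open>v\<close>. On the
  Fourier side it says that the exponential sum \<open>g x = (\<Sum>n\<in>G. v n * e (n \<bullet> x))\<close>, with
  \<open>e t = exp (2 \<pi> \<i> t)\<close>, satisfies
  \<open>g x = (\<Sum>l\<in>L. |m y\<^sub>l|\<^sup>2 * g y\<^sub>l)\<close> where \<open>y\<^sub>l = A\<^sup>-\<^sup>1 (x + l)\<close>; the weights add up to 1. Hence the set where
  \<open>g\<close> attains its minimum is closed under those inverse branches at which \<open>m\<close> does not vanish. If this set
  meets \<open>P\<close>, then the minimum is the value of \<open>g\<close> on \<open>P\<close>, which is the maximum, so \<open>g\<close> is constant
  and \<open>v\<close> vanishes off 0 (\<open>overlap_zero\<close>).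

  It remains to see that a nonempty invariant zero set \<open>M\<close> of an exponential sum \<open>h\<close> meets \<open>P\<close>
  (\<open>vanishing_sum_vanishes_on_P\<close>). If an invariant set is finite modulo \<open>\<int>\<^sup>n\<close>, counting with the
  weights \<open>|m|\<^sup>2\<close> shows that \<open>|m| = 1\<close> on it and that \<open>A\<close> preserves it, so it is contained in \<open>P\<close>. The
  hypothesis on invariant subspaces enters in the other case. A complex eigenvector of \<open>A\<close> gives an
  injective linear map \<open>\<phi>\<close> from \<open>\<real>\<^sup>n\<close> to the complex numbers that turns \<open>A\<close> into a multiplication; so
  \<open>n \<le> 2\<close> and \<open>A\<close> is a similarity for the norm \<open>|\<phi>|\<close>. Among the closed invariant subsets of \<open>M\<close>
  choose \<open>N\<close> and a nonzero exponential sum \<open>f\<close> that vanishes on \<open>N\<close> so that \<open>f\<close> has as few frequencies as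
  possible. A suitable directional derivative of \<open>f\<close> agrees on \<open>N\<close> with a sum that has fewer frequencies,
  so it vanishes on no closed invariant subset of \<open>N\<close>. Hence each point of \<open>N\<close> has arbitrarily long chains
  of preimages modulo \<open>\<int>\<^sup>n\<close> that end where the derivative is bounded below. Under such a chain \<open>N\<close>
  near the given point shrinks by a similarity onto a tiny piece of the zero set of \<open>f\<close>, which is flat up to a
  quadratic error. Consequently \<open>N\<close> lies locally in a
  line, and by analyticity \<open>h\<close> vanishes on that whole line. A preimage of the point yields a second line of
  zeros, in another direction since \<open>A\<close> has no real eigenvector unless \<open>n = 1\<close>. The points of \<open>M\<close> at which
  two lines of zeros cross therefore form a nonempty invariant set. It is finite modulo \<open>\<int>\<^sup>n\<close>, and
  so it meets \<open>P\<close> after all.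
\<close>

section \<open>Eigenvectors of real matrices without invariant subspaces\<close>

lemma nontrivial_relation:
  fixes w :: "nat \<Rightarrow> 'a::euclidean_space"
  shows "\<exists>c. (\<exists>k\<le>DIM('a). c k \<noteq> 0) \<and> (\<Sum>k\<le>DIM('a). c k *\<^sub>R w k) = 0"
proof (cases "inj_on w {..DIM('a)}")
  case True
  then have "card (w ` {..DIM('a)}) = Suc DIM('a)" by (simp add: card_image)
  then have "dependent (w ` {..DIM('a)})"
    by (intro dependent_biggerset) auto
  then obtain u where u: "\<exists>v\<in>w ` {..DIM('a)}. u v \<noteq> 0" "(\<Sum>v\<in>w ` {..DIM('a)}. u v *\<^sub>R v) = 0"
    by (subst (asm) dependent_finite) auto
  then show ?thesis
    by (intro exI[of _ "u \<circ> w"]) (auto simp: sum.reindex[OF True])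
next
  case False
  then obtain i j where ij: "i \<le> DIM('a)" "j \<le> DIM('a)" "i \<noteq> j" "w i = w j"
    by (auto simp: inj_on_def)
  define c :: "nat \<Rightarrow> real" where "c k = (if k = i then 1 else 0) - (if k = j then 1 else 0)" for k
  have "(\<Sum>k\<le>DIM('a). c k *\<^sub>R w k)
      = (\<Sum>k\<le>DIM('a). (if k = i then w k else 0) - (if k = j then w k else 0))"
    by (intro sum.cong) (auto simp: c_def)
  also have "\<dots> = w i - w j"
    using ij(1,2) by (simp add: sum_subtractf)
  finally have "(\<Sum>k\<le>DIM('a). c k *\<^sub>R w k) = w i - w j" .
  with ij show ?thesis by (intro exI[of _ c]) (auto simp: c_def intro!: exI[of _ i])
qed

text \<open>Split off a root of the polynomial. Either the remaining factor maps \<open>v\<close> to an eigenvector, or it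
  annihilates \<open>v\<close> and has smaller degree.\<close>

lemma annihilator_gives_eigenvector:
  fixes M :: "complex^'n^'n"
  assumes "p \<noteq> 0" "v \<noteq> 0" "(\<Sum>k\<le>degree p. coeff p k *s (((*v) M) ^^ k) v) = 0"
  shows "\<exists>ev v. v \<noteq> 0 \<and> M *v v = ev *s v"
  using assms
proof (induction "degree p" arbitrary: p)
  case 0
  then have "coeff p 0 *s v = 0" by simp
  with 0 show ?case by (auto dest: leading_coeff_neq_0)
next
  case (Suc n)
  have "coeff p (degree p) \<noteq> 0" using Suc.prems(1) by simp
  then have "\<exists>i\<in>{1..degree p}. coeff p i \<noteq> 0"
    using Suc.hyps(2) by (intro bexI[of _ "degree p"]) auto
  then obtain z where "(\<Sum>i\<le>degree p. coeff p i * z ^ i) = 0"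
    using fundamental_theorem_of_algebra[of "coeff p" "degree p"] by blast
  then have "poly p z = 0" by (simp add: poly_altdef)
  then obtain q where q: "p = [:-z, 1:] * q" by (auto simp: poly_eq_0_iff_dvd dvd_def)
  then have "q \<noteq> 0" using Suc.prems(1) by auto
  then have "degree p = degree [:-z, 1:] + degree q" unfolding q by (intro degree_mult_eq) auto
  then have dq: "degree q = n" using Suc.hyps(2) by simp
  define a where "a = (\<Sum>k\<le>n. coeff q k *s (((*v) M) ^^ k) v)"
  have cp0: "coeff p 0 = - z * coeff q 0" by (simp add: q)
  have cpS: "coeff p (Suc k) = coeff q k - z * coeff q (Suc k)" for k by (simp add: q)
  have lin: "M *v (\<Sum>k\<le>n. coeff q k *s (((*v) M) ^^ k) v) = (\<Sum>k\<le>n. coeff q k *s (((*v) M) ^^ Suc k) v)"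
    by (simp add: vec.linear_sum[OF matrix_vector_mul_linear_gen] vector_scalar_commute)
  have top: "coeff q (Suc n) = 0" using dq by (simp add: coeff_eq_0)
  have "(\<Sum>k\<le>Suc n. coeff q k *s (((*v) M) ^^ k) v) = a" by (simp add: a_def top)
  moreover have "(\<Sum>k\<le>Suc n. coeff q k *s (((*v) M) ^^ k) v)
     = coeff q 0 *s v + (\<Sum>k\<le>n. coeff q (Suc k) *s (((*v) M) ^^ Suc k) v)"
    by (subst sum.atMost_Suc_shift) simp
  ultimately have a2: "coeff q 0 *s v + (\<Sum>k\<le>n. coeff q (Suc k) *s (((*v) M) ^^ Suc k) v) = a" by simp
  have "(\<Sum>k\<le>Suc n. coeff p k *s (((*v) M) ^^ k) v)
      = (- z * coeff q 0) *s v + (\<Sum>k\<le>n. (coeff q k - z * coeff q (Suc k)) *s (((*v) M) ^^ Suc k) v)"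
    by (subst sum.atMost_Suc_shift) (simp add: cp0 cpS)
  also have "\<dots> = M *v a - z *s (coeff q 0 *s v + (\<Sum>k\<le>n. coeff q (Suc k) *s (((*v) M) ^^ Suc k) v))"
    unfolding a_def lin
    by (simp only: vec_eq_iff vector_minus_component vector_add_component vector_smult_component sum_component)
       (simp add: algebra_simps sum_subtractf sum_distrib_left del: funpow.simps)
  finally have "M *v a - z *s a = 0" using Suc.prems(3) Suc.hyps(2)[symmetric] by (simp only: a2)
  then have *: "M *v a = z *s a" by simp
  show ?case
  proof (cases "a = 0")
    case True
    then show ?thesis
      using Suc.hyps(1)[OF dq[symmetric] \<open>q \<noteq> 0\<close> \<open>v \<noteq> 0\<close>] unfolding a_def dq by blast
  next
    case False
    with * show ?thesis by blast
  qed
qed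

lemma complex_matrix_has_eigenvector:
  fixes M :: "complex^'n^'n"
  shows "\<exists>ev v. v \<noteq> 0 \<and> M *v v = ev *s v"
proof -
  let ?N = "DIM(complex^'n)"
  define v :: "complex^'n" where "v = 1"
  have v: "v \<noteq> 0" by (simp add: v_def)
  obtain c where c: "\<exists>k\<le>?N. c k \<noteq> 0" "(\<Sum>k\<le>?N. c k *\<^sub>R (((*v) M) ^^ k) v) = 0"
    using nontrivial_relation[of "\<lambda>k. (((*v) M) ^^ k) v"] by blast
  define p where "p = (\<Sum>k\<le>?N. monom (complex_of_real (c k)) k)"
  have cp: "coeff p k = (if k \<le> ?N then complex_of_real (c k) else 0)" for k
    by (auto simp: p_def coeff_sum)
  have "p \<noteq> 0" using c(1) cp by (auto simp: poly_eq_iff)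
  have "degree p \<le> ?N" using cp by (intro degree_le) auto
  then have "(\<Sum>k\<le>degree p. coeff p k *s (((*v) M) ^^ k) v) = (\<Sum>k\<le>?N. coeff p k *s (((*v) M) ^^ k) v)"
    by (intro sum.mono_neutral_left) (auto simp: coeff_eq_0)
  also have "\<dots> = (\<Sum>k\<le>?N. c k *\<^sub>R (((*v) M) ^^ k) v)"
    by (intro sum.cong) (auto simp: cp vec_eq_iff scaleR_conv_of_real[where 'a=complex])
  also have "\<dots> = 0" by (rule c(2))
  finally show ?thesis by (rule annihilator_gives_eigenvector[OF \<open>p \<noteq> 0\<close> v])
qed

lemma left_eigenvector_same_eigenvalue:
  fixes M :: "complex^'n^'n"
  assumes "v \<noteq> 0" "M *v v = ev *s v"
  shows "\<exists>w. w \<noteq> 0 \<and> transpose M *v w = ev *s w"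
proof -
  let ?K = "M - mat ev"
  have mat: "mat ev *v x = ev *s x" for x :: "complex^'n"
  proof -
    have "(\<Sum>j\<in>UNIV. mat ev $ i $ j * x $ j) = (\<Sum>j\<in>UNIV. if j = i then ev * x $ j else 0)" for i
      by (intro sum.cong) (auto simp: mat_def)
    then show ?thesis by (simp add: vec_eq_iff matrix_vector_mult_def)
  qed
  have tmat: "transpose ?K = transpose M - mat ev"
    by (simp add: transpose_def vec_eq_iff mat_def)
  have "?K *v v = 0" by (simp add: matrix_vector_mult_diff_rdistrib mat assms(2))
  then have "\<not> (\<exists>B. B ** ?K = mat 1)" using assms(1) by (auto simp: matrix_left_invertible_ker)
  then have "\<not> (\<exists>B. ?K ** B = mat 1)" by (metis matrix_left_right_inverse)
  then have "\<not> (\<exists>B. B ** transpose ?K = mat 1)" by (simp only: left_invertible_transpose not_False_eq_True)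
  then obtain w where "w \<noteq> 0" "transpose ?K *v w = 0" by (auto simp: matrix_left_invertible_ker)
  then show ?thesis
    by (intro exI[of _ w]) (simp add: tmat matrix_vector_mult_diff_rdistrib mat)
qed

text \<open>The kernel of the functional given by a left eigenvector is an invariant real subspace, so it is
  trivial: the eigenvector identifies the space with a real subspace of the complex numbers.\<close>

lemma eigen_functional:
  fixes A :: "real^'n^'n" and w :: "complex^'n"
  assumes irr: "no_proper_invariant_subspaces A"
    and w: "w \<noteq> 0" "map_matrix complex_of_real (transpose A) *v w = ev *s w"
  defines "\<phi> \<equiv> \<lambda>x::real^'n. \<Sum>i\<in>UNIV. w $ i * complex_of_real (x $ i)"
  shows "linear \<phi>" "inj \<phi>" "\<phi> (A *v x) = ev * \<phi> x"
proof -
  show lin: "linear \<phi>"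
    by (rule linearI) (simp_all add: \<phi>_def algebra_simps sum.distrib sum_distrib_left scaleR_conv_of_real[where 'a=complex])
  have eq: "\<phi> (A *v x) = ev * \<phi> x" for x
  proof -
    have "\<phi> (A *v x) = (\<Sum>i\<in>UNIV. \<Sum>j\<in>UNIV. w $ i * complex_of_real (A $ i $ j * x $ j))"
      by (simp add: \<phi>_def matrix_vector_mult_def sum_distrib_left)
    also have "\<dots> = (\<Sum>j\<in>UNIV. \<Sum>i\<in>UNIV. w $ i * complex_of_real (A $ i $ j * x $ j))"
      by (rule sum.swap)
    also have "\<dots> = (\<Sum>j\<in>UNIV. (map_matrix complex_of_real (transpose A) *v w) $ j * complex_of_real (x $ j))"
      by (simp add: matrix_vector_mult_def map_matrix_def transpose_def sum_distrib_left sum_distrib_right mult_ac)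
    also have "\<dots> = ev * \<phi> x" by (simp add: w(2) \<phi>_def sum_distrib_left algebra_simps)
    finally show ?thesis .
  qed
  then show "\<phi> (A *v x) = ev * \<phi> x" .
  have "subspace {x. \<phi> x = 0}" using lin by (rule linear_subspace_kernel)
  moreover have "\<forall>x\<in>{x. \<phi> x = 0}. A *v x \<in> {x. \<phi> x = 0}" by (simp add: eq)
  ultimately have "{x. \<phi> x = 0} = {0} \<or> {x. \<phi> x = 0} = UNIV"
    using irr unfolding no_proper_invariant_subspaces_def by blast
  moreover have "{x. \<phi> x = 0} \<noteq> UNIV"
  proof
    assume "{x. \<phi> x = 0} = UNIV"
    then have z: "\<phi> x = 0" for x by auto
    have "w $ i = 0" for i
    proof -
      have "\<phi> (axis i 1) = (\<Sum>j\<in>UNIV. if j = i then w $ j else 0)"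
        unfolding \<phi>_def by (intro sum.cong) (auto simp: axis_def)
      then have "\<phi> (axis i 1) = w $ i" by simp
      with z show ?thesis by simp
    qed
    with w(1) show False by (simp add: vec_eq_iff)
  qed
  ultimately show "inj \<phi>" using lin by (auto simp: linear_injective_0)
qed

lemma inner_transpose: "x \<bullet> (A *v y) = (transpose A *v x) \<bullet> (y::real^'n)" for A :: "real^'n^'n"
  by (simp only: transpose_matrix_vector dot_lmul_matrix)

text \<open>The orthogonal complement of an invariant subspace is invariant under the transpose.\<close>

lemma irreducible_transpose:
  fixes A :: "real^'n^'n"
  assumes "no_proper_invariant_subspaces A"
  shows "no_proper_invariant_subspaces (transpose A)"
  unfolding no_proper_invariant_subspaces_def
proof (intro allI impI)
  fix W :: "(real^'n) set" assume W: "subspace W \<and> (\<forall>x\<in>W. transpose A *v x \<in> W)"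
  define V where "V = {y. \<forall>x\<in>W. orthogonal x y}"
  have "subspace V" unfolding V_def using subspace_orthogonal_to_vectors[of W] by (simp add: orthogonal_commute)
  moreover have "\<forall>y\<in>V. A *v y \<in> V"
    using W by (auto simp: V_def orthogonal_def inner_transpose)
  ultimately consider "V = {0}" | "V = UNIV"
    using assms unfolding no_proper_invariant_subspaces_def by blast
  then show "W = {0} \<or> W = UNIV"
  proof cases
    case 1
    have "W = UNIV"
    proof (rule ccontr)
      assume "W \<noteq> UNIV"
      then have "dim W < DIM(real^'n)"
        using W dim_eq_full[of W] dim_subset_UNIV[of W] by (simp add: order_less_le span_eq_iff[THEN iffD2])
      then obtain y where "y \<noteq> 0" "\<And>x. x \<in> span W \<Longrightarrow> orthogonal y x"
        using orthogonal_to_subspace_exists by blast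
      then have "y \<in> V" by (auto simp: V_def orthogonal_commute span_base)
      with 1 \<open>y \<noteq> 0\<close> show False by auto
    qed
    then show ?thesis ..
  next
    case 2
    then have "\<forall>x\<in>W. orthogonal x x" by (auto simp: V_def)
    then have "W \<subseteq> {0}" by (auto simp: orthogonal_def)
    then show ?thesis using W subspace_0 by blast
  qed
qed

lemma expansive_transpose:
  fixes A :: "real^'n^'n"
  assumes "expansive A"
  shows "expansive (transpose A)"
proof -
  have tr: "map_matrix complex_of_real (transpose A) = transpose (map_matrix complex_of_real A)"
    by (simp add: map_matrix_def transpose_def vec_eq_iff)
  show ?thesis unfolding expansive_def tr
  proof (intro allI impI)
    fix ev assume "\<exists>v. v \<noteq> 0 \<and> transpose (map_matrix complex_of_real A) *v v = ev *s v"
    then have "\<exists>w. w \<noteq> 0 \<and> map_matrix complex_of_real A *v w = ev *s w"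
      using left_eigenvector_same_eigenvalue by (metis transpose_transpose)
    then show "1 < cmod ev" using assms unfolding expansive_def by blast
  qed
qed

text \<open>In particular the dimension is at most 2 and the map \<open>A\<close> is a similarity for the norm \<open>cmod \<circ> \<phi>\<close>,
  with ratio \<open>cmod ev\<close>.\<close>

lemma irreducible_expansive_similarity:
  fixes A :: "real^'n^'n"
  assumes "no_proper_invariant_subspaces A" "expansive A"
  shows "\<exists>\<phi> ev. linear \<phi> \<and> inj \<phi> \<and> (\<forall>x. \<phi> (A *v x) = ev * \<phi> x) \<and> 1 < cmod ev"
proof -
  obtain ev w where w: "w \<noteq> 0" "map_matrix complex_of_real (transpose A) *v w = ev *s w"
    using complex_matrix_has_eigenvector by blast
  have "1 < cmod ev" using expansive_transpose[OF assms(2)] w unfolding expansive_def by blast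
  then show ?thesis using eigen_functional[OF assms(1) w] by blast
qed

section \<open>Finite exponential sums\<close>

definition echar :: "real \<Rightarrow> complex" where
  "echar t = cis (2 * pi * t)"

lemma echar_add: "echar (s + t) = echar s * echar t"
  by (simp add: echar_def distrib_left cis_mult)

lemma echar_0 [simp]: "echar 0 = 1" by (simp add: echar_def)

lemma norm_echar [simp]: "cmod (echar t) = 1" by (simp add: echar_def)

lemma echar_nonzero [simp]: "echar t \<noteq> 0" by (simp add: echar_def)

lemma echar_minus: "echar (- t) = cnj (echar t)"
  by (simp add: echar_def cis_cnj)

lemma echar_diff: "echar (s - t) = echar s * cnj (echar t)"
  using echar_add[of s "- t"] by (simp add: echar_minus)

lemma echar_eq_1_iff: "echar t = 1 \<longleftrightarrow> t \<in> \<int>"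
proof
  assume "echar t = 1"
  then have "cos (2 * pi * t) = 1" by (simp add: echar_def complex_eq_iff)
  then obtain n::int where "2 * pi * t = of_int n * 2 * pi" by (auto simp: cos_one_2pi_int)
  then have "t = of_int n" by simp
  then show "t \<in> \<int>" by simp
next
  assume "t \<in> \<int>" then show "echar t = 1" by (simp add: echar_def cis_multiple_2pi)
qed

lemma echar_add_Ints: "n \<in> \<int> \<Longrightarrow> echar (t + n) = echar t"
  by (simp add: echar_add echar_eq_1_iff)

lemma exp_eq_echar: "exp (2 * complex_of_real pi * \<i> * complex_of_real t) = echar t"
  by (simp add: echar_def cis_conv_exp mult_ac)

lemma continuous_on_echar [continuous_intros]:
  "continuous_on S f \<Longrightarrow> continuous_on S (\<lambda>x. echar (f x))"
  unfolding echar_def cis_conv_exp by (intro continuous_intros)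

lemma echar_taylor: "cmod (echar (s + t) - echar s - 2 * complex_of_real pi * \<i> * complex_of_real t * echar s) \<le> (2 * pi * t)\<^sup>2"
proof -
  let ?z = "\<i> * complex_of_real (2 * pi * t)"
  have "cmod (exp ?z - (\<Sum>k\<le>1. ?z ^ k / fact k)) \<le> exp \<bar>Re ?z\<bar> * cmod ?z ^ Suc 1 / fact 1"
    by (rule Taylor_exp)
  then have *: "cmod (echar t - 1 - ?z) \<le> (2 * pi * t)\<^sup>2"
    by (simp add: echar_def cis_conv_exp norm_mult diff_diff_eq power2_eq_square)
  have "echar (s + t) - echar s - 2 * complex_of_real pi * \<i> * complex_of_real t * echar s = echar s * (echar t - 1 - ?z)"
    by (simp add: echar_add algebra_simps)
  then show ?thesis using * by (simp add: norm_mult)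
qed

definition expsum :: "'i set \<Rightarrow> ('i \<Rightarrow> complex) \<Rightarrow> ('i \<Rightarrow> 'a::real_inner) \<Rightarrow> 'a \<Rightarrow> complex" where
  "expsum I c \<omega> x = (\<Sum>i\<in>I. c i * echar (\<omega> i \<bullet> x))"

lemma continuous_on_expsum [continuous_intros]:
  "continuous_on S f \<Longrightarrow> continuous_on S (\<lambda>x. expsum I c \<omega> (f x))"
  unfolding expsum_def by (intro continuous_intros)

lemma expsum_taylor:
  fixes \<omega> :: "'i \<Rightarrow> 'a::real_inner" and c :: "'i \<Rightarrow> complex"
  obtains K where "K > 0" "\<And>x \<delta>. cmod (expsum I c \<omega> (x + \<delta>) - expsum I c \<omega> x
      - 2 * complex_of_real pi * \<i> * expsum I (\<lambda>i. c i * (\<omega> i \<bullet> \<delta>)) \<omega> x) \<le> K * (norm \<delta>)\<^sup>2"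
proof
  define K where "K = (\<Sum>i\<in>I. cmod (c i) * (2 * pi * norm (\<omega> i))\<^sup>2)"
  have "K \<ge> 0" unfolding K_def by (intro sum_nonneg) auto
  then show "K + 1 > 0" by simp
  fix x \<delta>
  have "expsum I c \<omega> (x + \<delta>) - expsum I c \<omega> x - 2 * complex_of_real pi * \<i> * expsum I (\<lambda>i. c i * (\<omega> i \<bullet> \<delta>)) \<omega> x
    = (\<Sum>i\<in>I. c i * (echar (\<omega> i \<bullet> x + \<omega> i \<bullet> \<delta>) - echar (\<omega> i \<bullet> x)
          - 2 * complex_of_real pi * \<i> * complex_of_real (\<omega> i \<bullet> \<delta>) * echar (\<omega> i \<bullet> x)))"
    by (simp add: expsum_def inner_add_right sum_distrib_left right_diff_distrib sum_subtractf mult_ac)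
  also have "cmod \<dots> \<le> (\<Sum>i\<in>I. cmod (c i) * (2 * pi * (\<omega> i \<bullet> \<delta>))\<^sup>2)"
    by (intro sum_norm_le) (simp add: norm_mult echar_taylor mult_left_mono)
  also have "\<dots> \<le> (\<Sum>i\<in>I. (cmod (c i) * (2 * pi * norm (\<omega> i))\<^sup>2) * (norm \<delta>)\<^sup>2)"
  proof (rule sum_mono)
    fix i
    have "(\<omega> i \<bullet> \<delta>)\<^sup>2 \<le> (norm (\<omega> i) * norm \<delta>)\<^sup>2"
      by (metis Cauchy_Schwarz_ineq power2_norm_eq_inner power_mult_distrib)
    then show "cmod (c i) * (2 * pi * (\<omega> i \<bullet> \<delta>))\<^sup>2 \<le> (cmod (c i) * (2 * pi * norm (\<omega> i))\<^sup>2) * (norm \<delta>)\<^sup>2"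
      by (simp add: power_mult_distrib mult.assoc mult_left_mono)
  qed
  also have "\<dots> = K * (norm \<delta>)\<^sup>2" by (simp add: K_def sum_distrib_right)
  also have "\<dots> \<le> (K + 1) * (norm \<delta>)\<^sup>2" by (simp add: mult_right_mono)
  finally show "cmod (expsum I c \<omega> (x + \<delta>) - expsum I c \<omega> x
      - 2 * complex_of_real pi * \<i> * expsum I (\<lambda>i. c i * (\<omega> i \<bullet> \<delta>)) \<omega> x) \<le> (K + 1) * (norm \<delta>)\<^sup>2" .
qed

lemma le_square_imp_zero:
  fixes D K :: real
  assumes "D \<ge> 0" "\<And>t. t > 0 \<Longrightarrow> t * D \<le> K * t\<^sup>2"
  shows "D = 0"
proof (rule ccontr)
  assume "D \<noteq> 0"
  with assms(1) have "D > 0" by simp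
  define k where "k = \<bar>K\<bar> + 1"
  have k: "k > 0" by (simp add: k_def)
  define t where "t = D / (2 * k)"
  have t: "t > 0" using \<open>D > 0\<close> k by (simp add: t_def)
  have "D \<le> K * t" using assms(2)[OF t] t by (simp add: power2_eq_square mult.assoc[symmetric])
  also have "\<dots> \<le> k * t" using t by (intro mult_right_mono) (auto simp: k_def)
  also have "\<dots> = D / 2" using k by (simp add: t_def)
  finally show False using \<open>D > 0\<close> by simp
qed

lemma expsum_zero_imp_derivative_zero:
  fixes \<omega> :: "'i \<Rightarrow> 'a::real_inner" and c :: "'i \<Rightarrow> complex"
  assumes "\<And>x. expsum I c \<omega> x = 0"
  shows "expsum I (\<lambda>i. c i * (\<omega> i \<bullet> u)) \<omega> x = 0"
proof -
  obtain K where "K > 0" and K: "\<And>x \<delta>. cmod (expsum I c \<omega> (x + \<delta>) - expsum I c \<omega> x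
      - 2 * complex_of_real pi * \<i> * expsum I (\<lambda>i. c i * (\<omega> i \<bullet> \<delta>)) \<omega> x) \<le> K * (norm \<delta>)\<^sup>2"
    by (rule expsum_taylor[where I=I and c=c and \<omega>=\<omega>]) (rule that)
  let ?E = "expsum I (\<lambda>i. c i * (\<omega> i \<bullet> u)) \<omega> x"
  have "t * (2 * pi * cmod ?E) \<le> (K * (norm u)\<^sup>2) * t\<^sup>2" if "t > 0" for t
  proof -
    have "expsum I (\<lambda>i. c i * (\<omega> i \<bullet> (t *\<^sub>R u))) \<omega> x = t * ?E"
      by (simp add: expsum_def sum_distrib_left mult_ac)
    then show ?thesis using K[of x "t *\<^sub>R u"] that
      by (simp add: assms norm_mult power_mult_distrib mult_ac)
  qed
  then have "2 * pi * cmod ?E = 0" by (intro le_square_imp_zero[of _ "K * (norm u)\<^sup>2"]) auto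
  then show ?thesis by simp
qed

text \<open>Divide by one of the exponentials and differentiate in the direction of another frequency. This
  removes one term and keeps the other coefficient up to a nonzero factor.\<close>

lemma expsum_independent:
  fixes \<omega> :: "'i \<Rightarrow> 'a::real_inner" and c :: "'i \<Rightarrow> complex"
  assumes "finite I" "inj_on \<omega> I" "\<And>x. expsum I c \<omega> x = 0" "i \<in> I"
  shows "c i = 0"
  using assms
proof (induction I arbitrary: c i rule: finite_induct)
  case empty
  then show ?case by simp
next
  case (insert k I)
  have rest: "c j = 0" if "j \<in> I" for j
  proof -
    have zero: "expsum (insert k I) c (\<lambda>j. \<omega> j - \<omega> k) x = 0" for x
    proof -
      have "expsum (insert k I) c (\<lambda>j. \<omega> j - \<omega> k) x = expsum (insert k I) c \<omega> x * echar (- (\<omega> k \<bullet> x))"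
        by (simp only: expsum_def sum_distrib_right inner_diff_left echar_diff echar_minus mult.assoc)
      then show ?thesis using insert.prems(2) by simp
    qed
    let ?d = "\<lambda>i. c i * ((\<omega> i - \<omega> k) \<bullet> (\<omega> j - \<omega> k))"
    have "expsum I ?d \<omega> x = 0" for x
    proof -
      have "expsum (insert k I) ?d (\<lambda>j. \<omega> j - \<omega> k) x = 0"
        using expsum_zero_imp_derivative_zero[OF zero] by simp
      then have "expsum I ?d (\<lambda>j. \<omega> j - \<omega> k) x = 0"
        using insert.hyps by (simp add: expsum_def)
      moreover have "expsum I ?d \<omega> x = expsum I ?d (\<lambda>j. \<omega> j - \<omega> k) x * echar (\<omega> k \<bullet> x)"
        by (simp add: expsum_def sum_distrib_right inner_diff_left mult.assoc flip: echar_add)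
      ultimately show ?thesis by simp
    qed
    then have "?d j = 0" using insert.IH[of ?d j] insert.prems(1) that by auto
    moreover have "\<omega> j \<noteq> \<omega> k" using insert.prems(1) insert.hyps(2) that by (auto simp: inj_on_def)
    ultimately show ?thesis by simp
  qed
  have "expsum (insert k I) c \<omega> 0 = c k"
    using insert.hyps rest by (simp add: expsum_def)
  then have "c k = 0" using insert.prems(2) by simp
  then show ?case using rest insert.prems(3) by auto
qed

text \<open>On a line the sum is the restriction of an entire function of one variable.\<close>

lemma expsum_line_zeros:
  fixes \<omega> :: "'i \<Rightarrow> 'a::real_inner" and c :: "'i \<Rightarrow> complex"
  assumes "infinite Z" "bounded Z" "\<And>t. t \<in> Z \<Longrightarrow> expsum I c \<omega> (x + t *\<^sub>R u) = 0"
  shows "expsum I c \<omega> (x + t *\<^sub>R u) = 0"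
proof -
  define G where "G = (\<lambda>z. \<Sum>i\<in>I. c i * echar (\<omega> i \<bullet> x) * exp (2 * pi * \<i> * (\<omega> i \<bullet> u) * z))"
  have G: "G (complex_of_real s) = expsum I c \<omega> (x + s *\<^sub>R u)" for s
    unfolding G_def expsum_def
  proof (rule sum.cong)
    fix i
    show "c i * echar (\<omega> i \<bullet> x) * exp (2 * pi * \<i> * (\<omega> i \<bullet> u) * complex_of_real s) =
         c i * echar (\<omega> i \<bullet> (x + s *\<^sub>R u))"
      using exp_eq_echar[of "s * (\<omega> i \<bullet> u)"] by (simp add: inner_add_right echar_add mult_ac)
  qed simp
  have "infinite (complex_of_real ` Z)" using assms(1) by (simp add: finite_image_iff inj_on_def)
  moreover have "bounded (complex_of_real ` Z)"
    using assms(2) by (intro bounded_linear_image) (auto intro: bounded_linear_of_real)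
  ultimately obtain \<xi> where \<xi>: "\<xi> islimpt (complex_of_real ` Z)"
    using bounded_infinite_imp_islimpt by (metis subset_UNIV subset_refl)
  have "G holomorphic_on UNIV" unfolding G_def by (intro holomorphic_intros)
  then have "G (complex_of_real t) = 0"
    by (rule analytic_continuation[OF _ open_UNIV connected_UNIV subset_UNIV UNIV_I \<xi>])
       (auto simp: G assms(3))
  then show ?thesis by (simp add: G)
qed

text \<open>If the frequencies have distinct inner products with \<open>u\<close>, the restriction to a line in direction \<open>u\<close>
  is again a sum of distinct exponentials and cannot vanish.\<close>

lemma expsum_line_direction:
  fixes \<omega> :: "'i \<Rightarrow> 'a::real_inner" and c :: "'i \<Rightarrow> complex"
  assumes "finite I" "i \<in> I" "c i \<noteq> 0" "\<And>t. expsum I c \<omega> (x + t *\<^sub>R u) = 0"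
  shows "\<exists>j\<in>I. \<exists>k\<in>I. j \<noteq> k \<and> (\<omega> j - \<omega> k) \<bullet> u = 0"
proof (rule ccontr)
  assume "\<not> ?thesis"
  then have inj: "inj_on (\<lambda>j. \<omega> j \<bullet> u) I" by (auto simp: inj_on_def inner_diff_left)
  have "expsum I (\<lambda>i. c i * echar (\<omega> i \<bullet> x)) (\<lambda>j. \<omega> j \<bullet> u) t = 0" for t
    using assms(4)[of t] by (simp add: expsum_def inner_add_right echar_add mult_ac)
  from expsum_independent[OF assms(1) inj this assms(2)] assms(3) show False by simp
qed

lemma span_pair:
  assumes "span {u, v} = (UNIV::'a::real_vector set)"
  obtains s t where "w = s *\<^sub>R u + t *\<^sub>R v"
proof -
  have "w \<in> span {u, v}" using assms by simp
  then obtain s where "w - s *\<^sub>R u \<in> span {v}" by (auto simp: span_breakdown_eq)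
  then obtain t where "w - s *\<^sub>R u = t *\<^sub>R v" by (auto simp: span_singleton)
  then show ?thesis by (intro that[of s t]) (simp add: algebra_simps)
qed

text \<open>Dimension-free form of the fact that in a plane the direction \<open>u\<close> is determined by a normal vector
  \<open>a\<close>.\<close>

lemma orthogonal_to_pair_member:
  fixes a u v w :: "'a::real_inner"
  assumes "span {u, v} = UNIV" "a \<noteq> 0" "a \<bullet> u = 0"
  shows "a \<bullet> v \<noteq> 0" and "a \<bullet> w = 0 \<Longrightarrow> \<exists>s. w = s *\<^sub>R u"
proof -
  show av: "a \<bullet> v \<noteq> 0"
  proof
    assume "a \<bullet> v = 0"
    obtain s t where "a = s *\<^sub>R u + t *\<^sub>R v" by (rule span_pair[OF assms(1)])
    then have "a \<bullet> a = s * (a \<bullet> u) + t * (a \<bullet> v)" by (metis inner_add_right inner_scaleR_right)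
    then show False using assms \<open>a \<bullet> v = 0\<close> by simp
  qed
  assume "a \<bullet> w = 0"
  obtain s t where w: "w = s *\<^sub>R u + t *\<^sub>R v" by (rule span_pair[OF assms(1)])
  then have "t * (a \<bullet> v) = 0" using \<open>a \<bullet> w = 0\<close> assms(3) by (simp add: inner_add_right)
  then show "\<exists>s. w = s *\<^sub>R u" using av w by auto
qed

text \<open>A transversal line would meet infinitely many of the lines in a bounded range, so the sum would vanish on
  each transversal line, that is, everywhere.\<close>

lemma finitely_many_parallel_zero_lines:
  fixes \<omega> :: "'i \<Rightarrow> 'a::real_inner" and c :: "'i \<Rightarrow> complex"
  assumes I: "finite I" "inj_on \<omega> I" "i \<in> I" "c i \<noteq> 0"
    and uv: "span {u, v} = UNIV" "a \<noteq> 0" "a \<bullet> u = 0"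
    and Q: "bounded Q" "\<And>x t. x \<in> Q \<Longrightarrow> expsum I c \<omega> (x + t *\<^sub>R u) = 0"
  shows "finite ((\<lambda>x. a \<bullet> x) ` Q)"
proof (rule ccontr)
  assume inf: "infinite ((\<lambda>x. a \<bullet> x) ` Q)"
  have av: "a \<bullet> v \<noteq> 0" using orthogonal_to_pair_member[OF uv] by blast
  have "expsum I c \<omega> p = 0" for p
  proof -
    define Z where "Z = (\<lambda>x. (a \<bullet> (x - p)) / (a \<bullet> v)) ` Q"
    have eq: "Z = (\<lambda>s. (s - a \<bullet> p) / (a \<bullet> v)) ` ((\<lambda>x. a \<bullet> x) ` Q)"
      by (simp add: Z_def image_image inner_diff_right)
    have "inj (\<lambda>s. (s - a \<bullet> p) / (a \<bullet> v))" using av by (auto simp: inj_def)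
    then have "infinite Z" unfolding eq using inf by (metis finite_imageD inj_on_subset subset_UNIV)
    moreover have "bounded Z"
    proof -
      obtain R where R: "\<And>x. x \<in> Q \<Longrightarrow> norm x \<le> R" using Q(1) by (auto simp: bounded_iff)
      have "\<bar>(a \<bullet> (x - p)) / (a \<bullet> v)\<bar> \<le> norm a * (R + norm p) / \<bar>a \<bullet> v\<bar>" if "x \<in> Q" for x
      proof -
        have "\<bar>a \<bullet> (x - p)\<bar> \<le> norm a * norm (x - p)" by (rule Cauchy_Schwarz_ineq2)
        also have "\<dots> \<le> norm a * (R + norm p)"
          using R[OF that] norm_triangle_ineq4[of x p] by (intro mult_left_mono) auto
        finally show ?thesis by (simp add: divide_right_mono)
      qed
      then show ?thesis unfolding Z_def bounded_iff by auto
    qed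
    moreover have "expsum I c \<omega> (p + t *\<^sub>R v) = 0" if tZ: "t \<in> Z" for t
    proof -
      obtain x where x: "x \<in> Q" "t = (a \<bullet> (x - p)) / (a \<bullet> v)" using tZ by (auto simp: Z_def)
      have "a \<bullet> (p + t *\<^sub>R v - x) = 0"
        using av x(2) by (simp add: inner_add_right inner_diff_right)
      then obtain s where "p + t *\<^sub>R v - x = s *\<^sub>R u" using orthogonal_to_pair_member[OF uv] by blast
      then have "p + t *\<^sub>R v = x + s *\<^sub>R u" by (simp add: algebra_simps)
      then show ?thesis using Q(2)[OF x(1)] by simp
    qed
    ultimately have "expsum I c \<omega> (p + 0 *\<^sub>R v) = 0" by (rule expsum_line_zeros)
    then show ?thesis by simp
  qed
  then show False using expsum_independent[OF I(1,2) _ I(3)] I(4) by blast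
qed

text \<open>A line on which the sum vanishes is orthogonal to a difference of two frequencies, so only finitely many
  directions occur, and for each pair of directions only finitely many lines.\<close>

lemma finitely_many_crossings:
  fixes \<omega> :: "'i \<Rightarrow> 'a::real_inner" and c :: "'i \<Rightarrow> complex"
  assumes I: "finite I" "inj_on \<omega> I" "i \<in> I" "c i \<noteq> 0" and K: "bounded K"
  shows "finite {x\<in>K. \<exists>u v. span {u, v} = UNIV \<and>
      (\<forall>t. expsum I c \<omega> (x + t *\<^sub>R u) = 0) \<and> (\<forall>t. expsum I c \<omega> (x + t *\<^sub>R v) = 0)}"
proof -
  let ?h = "expsum I c \<omega>"
  define Df where "Df = (\<lambda>(j, k). \<omega> j - \<omega> k) ` {(j, k). j \<in> I \<and> k \<in> I \<and> j \<noteq> k}"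
  have "{(j, k). j \<in> I \<and> k \<in> I \<and> j \<noteq> k} \<subseteq> I \<times> I" by auto
  then have finDf: "finite Df" unfolding Df_def using I(1) by (meson finite_SigmaI finite_imageI finite_subset)
  have Df0: "a \<noteq> 0" if "a \<in> Df" for a using that I(2) by (auto simp: Df_def inj_on_def)
  define E where "E = (\<lambda>(a, b). {x\<in>K. \<exists>u v. span {u, v} = UNIV \<and> a \<bullet> u = 0 \<and> b \<bullet> v = 0 \<and>
      (\<forall>t. ?h (x + t *\<^sub>R u) = 0) \<and> (\<forall>t. ?h (x + t *\<^sub>R v) = 0)})"
  have dir: "\<exists>a\<in>Df. a \<bullet> u = 0" if "\<forall>t. ?h (x + t *\<^sub>R u) = 0" for x u
    using expsum_line_direction[of I i c \<omega> x u] I that by (fastforce simp: Df_def)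
  have "{x\<in>K. \<exists>u v. span {u, v} = UNIV \<and> (\<forall>t. ?h (x + t *\<^sub>R u) = 0) \<and> (\<forall>t. ?h (x + t *\<^sub>R v) = 0)}
      \<subseteq> (\<Union>p\<in>Df \<times> Df. E p)"
  proof clarify
    fix x u v assume x: "x \<in> K" "span {u, v} = UNIV" "\<forall>t. ?h (x + t *\<^sub>R u) = 0" "\<forall>t. ?h (x + t *\<^sub>R v) = 0"
    obtain a b where "a \<in> Df" "b \<in> Df" "a \<bullet> u = 0" "b \<bullet> v = 0" using dir[OF x(3)] dir[OF x(4)] by blast
    then show "x \<in> (\<Union>p\<in>Df \<times> Df. E p)"
      using x by (intro UN_I[of "(a, b)"]) (auto simp: E_def)
  qed
  moreover have "finite (E p)" if pD: "p \<in> Df \<times> Df" for p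
  proof (cases "E p = {}")
    case False
    obtain a b where p: "p = (a, b)" "a \<noteq> 0" "b \<noteq> 0" using pD Df0 by auto
    from False obtain u v where uv: "span {u, v} = UNIV" "a \<bullet> u = 0" "b \<bullet> v = 0"
      by (auto simp: E_def p)
    have vu: "span {v, u} = UNIV" using uv(1) by (simp add: insert_commute)
    have lines: "?h (x + t *\<^sub>R u) = 0" "?h (x + t *\<^sub>R v) = 0" if x: "x \<in> E p" for x t
    proof -
      obtain u' v' where u': "span {u', v'} = UNIV" "a \<bullet> u' = 0" "b \<bullet> v' = 0"
          "\<forall>t. ?h (x + t *\<^sub>R u') = 0" "\<forall>t. ?h (x + t *\<^sub>R v') = 0"
        using x by (auto simp: E_def p)
      have v'u': "span {v', u'} = UNIV" using u'(1) by (simp add: insert_commute)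
      obtain s s' where "u = s *\<^sub>R u'" "v = s' *\<^sub>R v'"
        using orthogonal_to_pair_member(2)[OF u'(1) p(2) u'(2) uv(2)]
          orthogonal_to_pair_member(2)[OF v'u' p(3) u'(3) uv(3)] by blast
      then show "?h (x + t *\<^sub>R u) = 0" "?h (x + t *\<^sub>R v) = 0" using u'(4,5) by simp_all
    qed
    have bE: "bounded (E p)" using K by (rule bounded_subset) (auto simp: E_def p)
    have "finite ((\<lambda>x. a \<bullet> x) ` E p)"
      by (rule finitely_many_parallel_zero_lines[where \<omega>=\<omega> and c=c, OF I uv(1) p(2) uv(2) bE]) (rule lines)
    moreover have "finite ((\<lambda>x. b \<bullet> x) ` E p)"
      by (rule finitely_many_parallel_zero_lines[where \<omega>=\<omega> and c=c, OF I vu p(3) uv(3) bE]) (rule lines)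
    ultimately have "finite ((\<lambda>x. (a \<bullet> x, b \<bullet> x)) ` E p)"
      by (intro finite_subset[of "(\<lambda>x. (a \<bullet> x, b \<bullet> x)) ` E p" "((\<lambda>x. a \<bullet> x) ` E p) \<times> ((\<lambda>x. b \<bullet> x) ` E p)"]) auto
    moreover have "inj (\<lambda>x. (a \<bullet> x, b \<bullet> x))"
    proof (rule injI)
      fix x y assume "(a \<bullet> x, b \<bullet> x) = (a \<bullet> y, b \<bullet> y)"
      then have xy: "a \<bullet> (x - y) = 0" "b \<bullet> (x - y) = 0" by (simp_all add: inner_diff_right)
      obtain s where s: "x - y = s *\<^sub>R u"
        using orthogonal_to_pair_member(2)[OF uv(1) p(2) uv(2) xy(1)] by blast
      have "b \<bullet> u \<noteq> 0" by (rule orthogonal_to_pair_member(1)[OF vu p(3) uv(3)])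
      then have "s = 0" using xy(2) s by simp
      then show "x = y" using s by simp
    qed
    ultimately show ?thesis by (meson finite_imageD inj_on_subset subset_UNIV)
  qed simp
  ultimately show ?thesis using finDf by (meson finite_SigmaI finite_UN_I finite_subset)
qed

section \<open>Lebesgue measure of linear images\<close>

lemma nn_integral_lborel_translate:
  fixes f :: "'a::euclidean_space \<Rightarrow> ennreal"
  assumes [measurable]: "f \<in> borel_measurable borel"
  shows "(\<integral>\<^sup>+x. f (x + a) \<partial>lborel) = (\<integral>\<^sup>+x. f x \<partial>lborel)"
proof -
  have "(\<integral>\<^sup>+x. f x \<partial>lborel) = (\<integral>\<^sup>+x. f x \<partial>(distr lborel borel ((+) a)))"
    by (simp add: lborel_distr_plus)
  also have "\<dots> = (\<integral>\<^sup>+x. f (a + x) \<partial>lborel)"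
    by (rule nn_integral_distr) auto
  finally show ?thesis by (simp add: add.commute)
qed

lemma nn_integral_lborel_reflect:
  fixes f :: "'a::euclidean_space \<Rightarrow> ennreal"
  assumes [measurable]: "f \<in> borel_measurable borel"
  shows "(\<integral>\<^sup>+x. f (a - x) \<partial>lborel) = (\<integral>\<^sup>+x. f x \<partial>lborel)"
proof -
  have eq: "lborel = distr lborel borel (\<lambda>x. a + (-1) *\<^sub>R x)"
    using lborel_affine[of "-1" a] by (simp add: density_1)
  have "(\<integral>\<^sup>+x. f x \<partial>lborel) = (\<integral>\<^sup>+x. f x \<partial>(distr lborel borel (\<lambda>x. a + (-1) *\<^sub>R x)))"
    by (subst eq) (rule refl)
  also have "\<dots> = (\<integral>\<^sup>+x. f (a - x) \<partial>lborel)"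
    by (subst nn_integral_distr) auto
  finally show ?thesis by simp
qed

lemma nn_integral_lborel_indicator_comp:
  assumes f: "f \<in> borel_measurable borel" and U: "U \<in> sets borel"
  shows "(\<integral>\<^sup>+x. indicator U (f x) \<partial>lborel) = emeasure lborel (f -` U)"
proof -
  have "(\<integral>\<^sup>+x. indicator U (f x) \<partial>lborel) = (\<integral>\<^sup>+x. indicator (f -` U) x \<partial>lborel)"
    by (simp add: indicator_def)
  also have "\<dots> = emeasure lborel (f -` U)"
    using measurable_sets_borel[OF f U] by (intro nn_integral_indicator) simp
  finally show ?thesis .
qed

lemma emeasure_lborel_translate:
  fixes S :: "'a::euclidean_space set"
  assumes "S \<in> sets borel"
  shows "emeasure lborel ((\<lambda>x. x + a) ` S) = emeasure lborel S"
proof -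
  have "(\<lambda>x. x + a) ` S = (\<lambda>x. x + (-a)) -` S" by (force simp: image_iff)
  then have "emeasure lborel ((\<lambda>x. x + a) ` S) = (\<integral>\<^sup>+x. indicator S (x + (-a)) \<partial>lborel)"
    using nn_integral_lborel_indicator_comp[of "\<lambda>x. x + (-a)" S] assms by simp
  also have "\<dots> = emeasure lborel S"
    using assms by (subst nn_integral_lborel_translate) auto
  finally show ?thesis .
qed

text \<open>Uniqueness of translation-invariant measures: integrate \<open>1\<^sub>S (g x) * 1\<^sub>T (g x - y)\<close> over \<open>x\<close> and \<open>y\<close>
  in both orders. Hence \<open>f\<close> scales all measures by one common factor.\<close>

lemma linear_image_emeasure_proportional:
  fixes f g :: "'a::euclidean_space \<Rightarrow> 'a"
  assumes lin: "linear f" "linear g" and inv: "\<And>x. g (f x) = x" "\<And>x. f (g x) = x"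
    and S: "S \<in> sets borel" and T: "T \<in> sets borel"
  shows "emeasure lborel (f ` S) * emeasure lborel T = emeasure lborel S * emeasure lborel (f ` T)"
proof -
  have g[measurable]: "g \<in> borel_measurable borel"
    using lin(2) by (intro borel_measurable_continuous_onI linear_continuous_on) (simp add: linear_linear)
  note S[measurable] T[measurable]
  have img: "f ` U = g -` U" for U by (rule set_eqI) (auto simp: image_iff inv intro!: bexI[of _ "g _"])
  have em: "(\<integral>\<^sup>+x. indicator U (g x) \<partial>lborel) = emeasure lborel (f ` U)" if "U \<in> sets borel" for U
    unfolding img by (rule nn_integral_lborel_indicator_comp[OF g that])
  have "emeasure lborel (f ` S) * emeasure lborel T
      = (\<integral>\<^sup>+x. indicator S (g x) * (\<integral>\<^sup>+y. indicator T (g x - y) \<partial>lborel) \<partial>lborel)"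
    by (subst nn_integral_lborel_reflect) (simp_all add: nn_integral_multc em)
  also have "\<dots> = (\<integral>\<^sup>+x. (\<integral>\<^sup>+y. indicator S (g x) * indicator T (g x - y) \<partial>lborel) \<partial>lborel)"
    by (subst nn_integral_cmult) simp_all
  also have "\<dots> = (\<integral>\<^sup>+y. (\<integral>\<^sup>+x. indicator S (g x) * indicator T (g x - y) \<partial>lborel) \<partial>lborel)"
    by (rule lborel_pair.Fubini') simp
  also have "\<dots> = (\<integral>\<^sup>+y. (\<integral>\<^sup>+x. indicator S (g x + y) * indicator T (g x) \<partial>lborel) \<partial>lborel)"
  proof (rule nn_integral_cong)
    fix y
    have "(\<integral>\<^sup>+x. indicator S (g x) * indicator T (g x - y) \<partial>lborel)
      = (\<integral>\<^sup>+x. indicator S (g (x + f y)) * indicator T (g (x + f y) - y) \<partial>lborel)"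
      by (subst nn_integral_lborel_translate) simp_all
    then show "(\<integral>\<^sup>+x. indicator S (g x) * indicator T (g x - y) \<partial>lborel)
      = (\<integral>\<^sup>+x. indicator S (g x + y) * indicator T (g x) \<partial>lborel)"
      by (simp add: linear_add[OF lin(2)] inv)
  qed
  also have "\<dots> = (\<integral>\<^sup>+x. (\<integral>\<^sup>+y. indicator S (g x + y) * indicator T (g x) \<partial>lborel) \<partial>lborel)"
    by (rule lborel_pair.Fubini'[symmetric]) simp
  also have "\<dots> = (\<integral>\<^sup>+x. (\<integral>\<^sup>+y. indicator S (y + g x) \<partial>lborel) * indicator T (g x) \<partial>lborel)"
    by (subst nn_integral_multc) (simp_all add: add.commute)
  also have "\<dots> = (\<integral>\<^sup>+x. emeasure lborel S * indicator T (g x) \<partial>lborel)"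
    by (subst nn_integral_lborel_translate) simp_all
  also have "\<dots> = emeasure lborel S * emeasure lborel (f ` T)"
    by (simp add: nn_integral_cmult em)
  finally show ?thesis .
qed

text \<open>Cut each domain into its intersections with the translates of the other; translation by \<open>h\<close> matches the
  pieces of the two dissections.\<close>

lemma fundamental_domains_equal_measure:
  fixes F1 F2 H :: "'a::euclidean_space set"
  assumes F: "F1 \<in> sets borel" "F2 \<in> sets borel" and H: "countable H" "\<And>h. h \<in> H \<Longrightarrow> - h \<in> H"
    and cov: "\<And>x. \<exists>!h. h \<in> H \<and> x + h \<in> F1" "\<And>x. \<exists>!h. h \<in> H \<and> x + h \<in> F2"
  shows "emeasure lborel F1 = emeasure lborel F2"
proof -
  have T: "(\<lambda>x. x + h) -` U \<in> sets borel" if "U \<in> sets borel" for U and h :: 'a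
    using that measurable_sets_borel[of "\<lambda>x. x + h" borel U] by simp
  have split: "emeasure lborel U = (\<integral>\<^sup>+h. emeasure lborel (U \<inter> (\<lambda>x. x + h) -` V) \<partial>count_space H)"
    if "U \<in> sets borel" "V \<in> sets borel" "\<And>x. \<exists>!h. h \<in> H \<and> x + h \<in> V" for U V
  proof -
    have "\<exists>h\<in>H. x + h \<in> V" for x using that(3)[of x] by auto
    then have "U = (\<Union>h\<in>H. U \<inter> (\<lambda>x. x + h) -` V)" by auto
    then have "emeasure lborel U = emeasure lborel (\<Union>h\<in>H. U \<inter> (\<lambda>x. x + h) -` V)" by simp
    also have "\<dots> = (\<integral>\<^sup>+h. emeasure lborel (U \<inter> (\<lambda>x. x + h) -` V) \<partial>count_space H)"
    proof (rule emeasure_UN_countable)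
      show "disjoint_family_on (\<lambda>h. U \<inter> (\<lambda>x. x + h) -` V) H"
      proof (unfold disjoint_family_on_def, intro ballI impI)
        fix h k assume "h \<in> H" "k \<in> H" "h \<noteq> k"
        then have "\<not> (x + h \<in> V \<and> x + k \<in> V)" for x using that(3)[of x] by auto
        then show "(U \<inter> (\<lambda>x. x + h) -` V) \<inter> (U \<inter> (\<lambda>x. x + k) -` V) = {}" by auto
      qed
    qed (use that T H in auto)
    finally show ?thesis .
  qed
  have bij: "bij_betw uminus H H"
    by (rule bij_betwI[where g=uminus]) (use H in auto)
  have "emeasure lborel F1 = (\<integral>\<^sup>+h. emeasure lborel (F1 \<inter> (\<lambda>x. x + h) -` F2) \<partial>count_space H)"
    by (rule split[OF F cov(2)])
  also have "\<dots> = (\<integral>\<^sup>+h. emeasure lborel (F1 \<inter> (\<lambda>x. x + (- h)) -` F2) \<partial>count_space H)"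
    using nn_integral_bij_count_space[OF bij, of "\<lambda>h. emeasure lborel (F1 \<inter> (\<lambda>x. x + h) -` F2)"] by simp
  also have "\<dots> = (\<integral>\<^sup>+h. emeasure lborel (F2 \<inter> (\<lambda>x. x + h) -` F1) \<partial>count_space H)"
  proof (rule nn_integral_cong)
    fix h
    have "F1 \<inter> (\<lambda>x. x + (- h)) -` F2 = (\<lambda>x. x + h) ` (F2 \<inter> (\<lambda>x. x + h) -` F1)"
      by (force simp: image_iff)
    then show "emeasure lborel (F1 \<inter> (\<lambda>x. x + (- h)) -` F2) = emeasure lborel (F2 \<inter> (\<lambda>x. x + h) -` F1)"
      using emeasure_lborel_translate[of "F2 \<inter> (\<lambda>x. x + h) -` F1" h] F T by simp
  qed
  also have "\<dots> = emeasure lborel F2" by (rule split[OF F(2,1) cov(1), symmetric])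
  finally show ?thesis .
qed

text \<open>Any overlap of two members would be counted twice by the sum.\<close>

lemma measure_eq_sum_imp_pairwise_negligible:
  assumes fin: "finite I" and meas: "\<And>i. i \<in> I \<Longrightarrow> f i \<in> lmeasurable"
    and eq: "measure lebesgue (\<Union>i\<in>I. f i) = (\<Sum>i\<in>I. measure lebesgue (f i))"
    and ij: "i \<in> I" "j \<in> I" "i \<noteq> j"
  shows "negligible (f i \<inter> f j)"
proof -
  let ?J = "I - {i, j}"
  have J: "finite ?J" "\<And>k. k \<in> ?J \<Longrightarrow> f k \<in> lmeasurable" using fin meas by auto
  have UJ: "(\<Union>k\<in>?J. f k) \<in> lmeasurable" by (rule fmeasurable.finite_UN[OF J])
  have split: "(\<Union>k\<in>I. f k) = (f i \<union> f j) \<union> (\<Union>k\<in>?J. f k)" using ij by auto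
  have "I = insert i (insert j ?J)" using ij by auto
  then have sum: "(\<Sum>k\<in>I. measure lebesgue (f k))
      = measure lebesgue (f i) + measure lebesgue (f j) + (\<Sum>k\<in>?J. measure lebesgue (f k))"
    using J(1) ij(3) by (metis (no_types, lifting) Diff_iff insert_iff add.assoc sum.insert finite_insert)
  have "measure lebesgue (\<Union>k\<in>I. f k) \<le> measure lebesgue (f i \<union> f j) + measure lebesgue (\<Union>k\<in>?J. f k)"
    unfolding split using meas ij UJ by (intro measure_Un_le) (auto intro: fmeasurableD)
  also have "measure lebesgue (f i \<union> f j) = measure lebesgue (f i) + measure lebesgue (f j) - measure lebesgue (f i \<inter> f j)"
    using meas ij by (intro measure_Un3) auto
  also have "measure lebesgue (\<Union>k\<in>?J. f k) \<le> (\<Sum>k\<in>?J. measure lebesgue (f k))"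
    using J by (intro measure_UNION_le) (auto intro: fmeasurableD)
  finally have "measure lebesgue (f i \<inter> f j) \<le> 0" using eq sum by linarith
  then have "measure lebesgue (f i \<inter> f j) = 0" by (simp add: measure_le_0_iff)
  moreover have "f i \<inter> f j \<in> lmeasurable" using meas ij by (intro fmeasurable.Int) auto
  ultimately show ?thesis by (simp add: negligible_iff_measure0)
qed

lemma compact_sequences:
  assumes "compact (D :: 'a::topological_space set)"
  shows "compact {\<delta> :: nat \<Rightarrow> 'a. \<forall>j. \<delta> j \<in> D}"
proof -
  have "compactin (product_topology (\<lambda>i::nat. euclidean) UNIV) (Pi\<^sub>E UNIV (\<lambda>_. D))"
    using assms by (simp add: compactin_PiE)
  then have "compact (Pi\<^sub>E (UNIV :: nat set) (\<lambda>_. D))"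
    by (simp add: euclidean_product_topology)
  moreover have "Pi\<^sub>E (UNIV :: nat set) (\<lambda>_. D) = {\<delta>. \<forall>j. \<delta> j \<in> D}" by auto
  ultimately show ?thesis by simp
qed

section \<open>Integer vectors and lattices\<close>

lemma matrix_inv_inverse:
  assumes "invertible A"
  shows matrix_inv_right: "A ** matrix_inv A = mat 1" and matrix_inv_left: "matrix_inv A ** A = mat 1"
proof -
  have "A ** matrix_inv A = mat 1 \<and> matrix_inv A ** A = mat 1"
    unfolding matrix_inv_def by (rule someI_ex) (use assms in \<open>simp add: invertible_def\<close>)
  then show "A ** matrix_inv A = mat 1" "matrix_inv A ** A = mat 1" by auto
qed

lemma int_vecs_0 [simp]: "0 \<in> int_vecs" by (simp add: int_vecs_def)
lemma int_vecs_add [intro]: "x \<in> int_vecs \<Longrightarrow> y \<in> int_vecs \<Longrightarrow> x + y \<in> int_vecs" by (simp add: int_vecs_def)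
lemma int_vecs_diff [intro]: "x \<in> int_vecs \<Longrightarrow> y \<in> int_vecs \<Longrightarrow> x - y \<in> int_vecs" by (simp add: int_vecs_def)
lemma int_vecs_minus [intro]: "x \<in> int_vecs \<Longrightarrow> - x \<in> int_vecs" by (simp add: int_vecs_def)

lemma int_matrix_mult_int_vecs:
  "int_matrix A \<Longrightarrow> z \<in> int_vecs \<Longrightarrow> A *v z \<in> int_vecs"
  by (auto simp: int_matrix_def int_vecs_def matrix_vector_mult_def intro!: Ints_sum Ints_mult)

lemma inner_int_vecs: "x \<in> int_vecs \<Longrightarrow> y \<in> int_vecs \<Longrightarrow> x \<bullet> y \<in> \<int>"
  by (auto simp: int_vecs_def inner_vec_def intro!: Ints_sum Ints_mult)

lemma int_vecs_iff_inner: "x \<in> int_vecs \<longleftrightarrow> (\<forall>z\<in>int_vecs. z \<bullet> x \<in> \<int>)"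
proof
  assume "\<forall>z\<in>int_vecs. z \<bullet> x \<in> \<int>"
  moreover have "axis i 1 \<in> int_vecs" for i :: 'a by (simp add: int_vecs_def axis_def)
  ultimately have "x $ i \<in> \<int>" for i by (metis inner_axis' mult_1 inner_real_def)
  then show "x \<in> int_vecs" by (simp add: int_vecs_def)
qed (use inner_int_vecs in blast)

definition fpart :: "real^'n \<Rightarrow> real^'n" where
  "fpart x = (\<chi> i. frac (x $ i))"

lemma fpart_diff: "x - fpart x \<in> int_vecs"
  by (simp add: fpart_def int_vecs_def frac_def)

lemma fpart_add_int: "z \<in> int_vecs \<Longrightarrow> fpart (x + z) = fpart x"
  by (auto simp: fpart_def int_vecs_def vec_eq_iff frac_def floor_add2 Ints_def)

lemma fpart_eq_imp: "fpart x = fpart y \<Longrightarrow> x - y \<in> int_vecs"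
  using int_vecs_diff[OF fpart_diff[of x] fpart_diff[of y]] by simp

lemma fpart_le_1: "0 \<le> fpart x $ i" "fpart x $ i \<le> 1"
  by (simp_all add: fpart_def less_imp_le[OF frac_lt_1])

definition unit_cube :: "(real^'n) set" where "unit_cube = cbox 0 (\<chi> i. 1)"

lemma fpart_in_cube: "fpart x \<in> unit_cube"
  by (simp add: unit_cube_def mem_box_cart fpart_le_1)

lemma compact_unit_cube: "compact unit_cube" by (simp add: unit_cube_def)

lemma finite_int_vecs_bounded:
  assumes "bounded (S :: (real^'n) set)" "S \<subseteq> int_vecs"
  shows "finite S"
proof -
  obtain R where R: "\<And>x. x \<in> S \<Longrightarrow> norm x \<le> R" using assms(1) by (auto simp: bounded_iff)
  define F where "F = real_of_int ` {-\<lceil>R\<rceil>..\<lceil>R\<rceil>}"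
  have "S \<subseteq> vec_lambda ` (Pi\<^sub>E UNIV (\<lambda>_. F))"
  proof
    fix x assume x: "x \<in> S"
    have "x $ i \<in> F" for i
    proof -
      obtain n where n: "x $ i = of_int n" using x assms(2) by (auto simp: int_vecs_def Ints_def)
      have "\<bar>x $ i\<bar> \<le> R" using R[OF x] component_le_norm_cart[of x i] by linarith
      then have "n \<in> {-\<lceil>R\<rceil>..\<lceil>R\<rceil>}" using n by (simp add: abs_le_iff) linarith
      then show ?thesis using n by (auto simp: F_def)
    qed
    then show "x \<in> vec_lambda ` (Pi\<^sub>E UNIV (\<lambda>_. F))"
      by (intro image_eqI[of _ _ "vec_nth x"]) auto
  qed
  moreover have "finite (Pi\<^sub>E (UNIV::'n set) (\<lambda>_. F))" by (intro finite_PiE) (auto simp: F_def)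
  ultimately show ?thesis using finite_surj by blast
qed

lemma det_int_matrix: "int_matrix (A::real^'n^'n) \<Longrightarrow> det A \<in> \<int>"
  unfolding det_def int_matrix_def by (intro Ints_sum Ints_mult Ints_prod) auto

lemma subgroup_int_multiple:
  fixes P :: "(real^'n) set"
  assumes "0 \<in> P" "\<And>x y. x \<in> P \<Longrightarrow> y \<in> P \<Longrightarrow> x + y \<in> P" "\<And>x. x \<in> P \<Longrightarrow> - x \<in> P"
    and "x \<in> P" "t \<in> \<int>"
  shows "t *\<^sub>R x \<in> P"
proof -
  have nat: "real n *\<^sub>R x \<in> P" for n
    by (induction n) (use assms in \<open>auto simp: scaleR_left_distrib\<close>)
  obtain k where k: "t = of_int k" using assms(5) by (auto simp: Ints_def)
  show ?thesis
  proof (cases "k \<ge> 0")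
    case True
    then show ?thesis using nat[of "nat k"] k by simp
  next
    case False
    then show ?thesis using assms(3)[OF nat[of "nat (- k)"]] k by simp
  qed
qed

lemma subgroup_lattice_combination:
  fixes P :: "(real^'n) set" and M :: "real^'n^'n"
  assumes P: "0 \<in> P" "\<And>x y. x \<in> P \<Longrightarrow> y \<in> P \<Longrightarrow> x + y \<in> P" "\<And>x. x \<in> P \<Longrightarrow> - x \<in> P"
    and M: "\<And>j. column j M \<in> P" and z: "z \<in> int_vecs"
  shows "M *v z \<in> P"
proof -
  have sum: "finite I \<Longrightarrow> (\<Sum>j\<in>I. z $ j *\<^sub>R column j M) \<in> P" for I
    by (induction I rule: finite_induct)
       (use P z M subgroup_int_multiple[of P] in \<open>auto simp: int_vecs_def\<close>)
  have "M *v z = (\<Sum>j\<in>UNIV. z $ j *\<^sub>R column j M)"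
    by (simp add: matrix_mult_sum scalar_mult_eq_scaleR)
  then show ?thesis using sum[of UNIV] by simp
qed

text \<open>The matrix \<open>T\<close> expresses that \<open>P\<close> is discrete. It makes \<open>\<bar>det T\<bar> * \<bar>det M\<bar>\<close> a natural number for each
  matrix \<open>M\<close> with columns in \<open>P\<close>, so there is an invertible such \<open>M\<close> with least determinant; its columns
  form a basis of \<open>P\<close>.\<close>

lemma discrete_subgroup_is_lattice:
  fixes P :: "(real^'n) set" and T :: "real^'n^'n"
  assumes P: "0 \<in> P" "\<And>x y. x \<in> P \<Longrightarrow> y \<in> P \<Longrightarrow> x + y \<in> P" "\<And>x. x \<in> P \<Longrightarrow> - x \<in> P"
    and int: "int_vecs \<subseteq> P"
    and T: "det T \<noteq> 0" "\<And>x. x \<in> P \<Longrightarrow> T *v x \<in> int_vecs"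
  shows "is_lattice P"
proof -
  define ok where "ok = (\<lambda>M::real^'n^'n. (\<forall>j. column j M \<in> P) \<and> det M \<noteq> 0)"
  define f where "f = (\<lambda>M::real^'n^'n. nat \<lfloor>\<bar>det (T ** M)\<bar>\<rfloor>)"
  have f: "real (f M) = \<bar>det T\<bar> * \<bar>det M\<bar>" if "ok M" for M
  proof -
    have "T *v column j M \<in> int_vecs" for j using that T(2) by (simp add: ok_def)
    moreover have "(T ** M) $ i $ j = (T *v column j M) $ i" for i j
      by (simp add: matrix_matrix_mult_def matrix_vector_mult_def column_def)
    ultimately have "int_matrix (T ** M)" by (simp add: int_matrix_def int_vecs_def)
    then have "\<bar>det (T ** M)\<bar> \<in> \<int>" by (intro Ints_abs det_int_matrix)
    then have "real (f M) = \<bar>det (T ** M)\<bar>" unfolding f_def by (auto simp: Ints_def)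
    then show ?thesis by (simp add: det_mul abs_mult)
  qed
  have "ok (mat 1)"
  proof -
    have "column j (mat 1 :: real^'n^'n) \<in> int_vecs" for j
      by (simp add: int_vecs_def column_def mat_def)
    then show ?thesis using int by (auto simp: ok_def)
  qed
  then obtain M where M: "ok M" and least: "\<And>M'. ok M' \<Longrightarrow> f M \<le> f M'"
    using ex_has_least_nat[of ok "mat 1" f] by blast
  have inv: "invertible M" using M by (simp add: ok_def invertible_det_nz)
  have "P \<subseteq> (\<lambda>z. M *v z) ` int_vecs"
  proof
    fix x assume x: "x \<in> P"
    define t where "t = matrix_inv M *v x"
    have Mt: "M *v t = x"
      by (simp add: t_def matrix_vector_mul_assoc matrix_inv_right[OF inv])
    have "t \<in> int_vecs"
    proof (rule ccontr)
      assume "t \<notin> int_vecs"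
      then obtain k where k: "t $ k \<notin> \<int>" by (auto simp: int_vecs_def)
      \<comment> \<open>exchanging column \<open>k\<close> of \<open>M\<close> for \<open>y\<close> multiplies the determinant by \<open>frac (t $ k)\<close>\<close>
      define y where "y = M *v fpart t"
      have "y = x + - (M *v (t - fpart t))"
        by (simp add: y_def Mt matrix_vector_mult_diff_distrib)
      moreover have "M *v (t - fpart t) \<in> P"
        using M by (intro subgroup_lattice_combination[OF P]) (auto simp: ok_def fpart_diff)
      ultimately have y: "y \<in> P" by (simp only: P(2)[OF x P(3)])
      define M' :: "real^'n^'n" where "M' = (\<chi> i j. if j = k then (M *v fpart t) $ i else M $ i $ j)"
      have det: "det M' = frac (t $ k) * det M"
        unfolding M'_def cramer_lemma by (simp add: fpart_def)
      have col: "column j M' = (if j = k then y else column j M)" for j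
        by (simp add: M'_def column_def vec_eq_iff y_def)
      have fr: "0 < frac (t $ k)" "frac (t $ k) < 1" using k by (simp_all add: frac_gt_0_iff frac_lt_1)
      have "ok M'" using M y col det fr by (auto simp: ok_def)
      then have "real (f M) \<le> real (f M')" using least by simp
      then have "\<bar>det T\<bar> * \<bar>det M\<bar> \<le> \<bar>det T\<bar> * (frac (t $ k) * \<bar>det M\<bar>)"
        using f[OF M] f[OF \<open>ok M'\<close>] fr by (simp add: det abs_mult)
      then have "\<bar>det M\<bar> \<le> frac (t $ k) * \<bar>det M\<bar>" using T(1) by simp
      then show False using fr M by (simp add: ok_def)
    qed
    then show "x \<in> (\<lambda>z. M *v z) ` int_vecs" using Mt by blast
  qed
  moreover have "(\<lambda>z. M *v z) ` int_vecs \<subseteq> P"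
    using M subgroup_lattice_combination[OF P] by (auto simp: ok_def)
  ultimately show ?thesis using inv unfolding is_lattice_def by blast
qed

lemma spanning_set_contains_rows:
  fixes Q :: "(real^'n) set"
  assumes "span Q = UNIV"
  shows "\<exists>T::real^'n^'n. det T \<noteq> 0 \<and> (\<forall>i. row i T \<in> Q)"
proof -
  obtain b where b: "b \<subseteq> Q" "independent b" "Q \<subseteq> span b" "card b = dim Q"
    using basis_exists by blast
  have "dim Q = CARD('n)" using assms dim_eq_full[of Q] by simp
  then obtain g where g: "bij_betw g (UNIV::'n set) b"
    using b(4) finite_same_card_bij[of "UNIV::'n set" b] independent_imp_finite[OF b(2)] by auto
  define T :: "real^'n^'n" where "T = (\<chi> i. g i)"
  have "rows T = b" using g by (auto simp: rows_def row_def T_def bij_betw_def)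
  moreover have "span b = UNIV"
    using assms b(3) by (metis span_mono span_span top.extremum_uniqueI)
  ultimately have "\<exists>T'. T' ** T = mat 1"
    by (simp add: matrix_left_invertible_span_rows_gen span_vec_eq)
  then have "invertible T" by (simp add: invertible_left_inverse)
  then have "det T \<noteq> 0" by (simp add: invertible_det_nz)
  moreover have "row i T \<in> Q" for i
    using g b(1) by (auto simp: row_def T_def bij_betw_def)
  ultimately show ?thesis by blast
qed

definition half_cube :: "(real^'n) set" where
  "half_cube = {x. \<forall>i. 0 \<le> x $ i \<and> x $ i < 1}"

text \<open>The half-open cube is a fundamental domain of the integer vectors.\<close>

lemma half_cube_fpart: "x + z \<in> half_cube \<and> z \<in> int_vecs \<longleftrightarrow> z = fpart x - x"
proof
  assume a: "x + z \<in> half_cube \<and> z \<in> int_vecs"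
  have "fpart (x + z) = x + z" using a by (auto simp: half_cube_def fpart_def vec_eq_iff frac_eq)
  then show "z = fpart x - x" using a fpart_add_int[of z x] by (simp add: algebra_simps)
next
  assume "z = fpart x - x"
  then show "x + z \<in> half_cube \<and> z \<in> int_vecs"
    using int_vecs_minus[OF fpart_diff[of x]] by (simp add: half_cube_def fpart_def frac_lt_1)
qed

lemma half_cube_borel: "(half_cube :: (real^'n) set) \<in> sets borel"
proof -
  have "(half_cube :: (real^'n) set) = (\<Inter>i. {x::real^'n. 0 \<le> x $ i} \<inter> {x. x $ i < 1})" by (auto simp: half_cube_def)
  moreover have 1: "{x::real^'n. 0 \<le> x $ i} \<in> sets borel" for i
    by (intro borel_closed closed_Collect_le continuous_intros)
  moreover have 2: "{x::real^'n. x $ i < 1} \<in> sets borel" for i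
    by (intro borel_open open_Collect_less continuous_intros)
  moreover have "(\<Inter>i\<in>UNIV. {x::real^'n. 0 \<le> x $ i} \<inter> {x. x $ i < 1}) \<in> sets borel"
    by (intro sets.finite_INT sets.Int 1 2) simp_all
  ultimately show ?thesis by simp
qed

lemma half_cube_emeasure:
  shows "emeasure lborel (half_cube :: (real^'n) set) \<noteq> 0"
    and "emeasure lborel (half_cube :: (real^'n) set) \<noteq> \<infinity>"
proof -
  have "box 0 (\<chi> i. 1) \<subseteq> (half_cube :: (real^'n) set)" by (auto simp: half_cube_def mem_box_cart less_imp_le)
  then have "emeasure lborel (box 0 (\<chi> i. 1) :: (real^'n) set) \<le> emeasure lborel (half_cube :: (real^'n) set)"
    by (rule emeasure_mono) (simp add: half_cube_borel)
  moreover have "emeasure lborel (box 0 (\<chi> i. 1) :: (real^'n) set) \<noteq> 0"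
  proof -
    have "(\<chi> i. 1/2) \<in> (box 0 (\<chi> i. 1) :: (real^'n) set)" by (simp add: mem_box_cart)
    then have "\<not> negligible (box 0 (\<chi> i. 1) :: (real^'n) set)"
      using open_not_negligible[OF open_box] by blast
    then show ?thesis by (simp add: negligible_iff_emeasure0)
  qed
  ultimately show "emeasure lborel (half_cube :: (real^'n) set) \<noteq> 0" by auto
  have "(half_cube :: (real^'n) set) \<subseteq> unit_cube" by (auto simp: half_cube_def unit_cube_def mem_box_cart less_imp_le)
  then have "emeasure lborel (half_cube :: (real^'n) set) \<le> emeasure lborel (unit_cube :: (real^'n) set)"
    by (rule emeasure_mono) (simp add: unit_cube_def)
  also have "\<dots> < \<infinity>" unfolding unit_cube_def by (intro emeasure_bounded_finite bounded_cbox)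
  finally show "emeasure lborel (half_cube :: (real^'n) set) \<noteq> \<infinity>" by simp
qed

section \<open>Digits, frequencies and the mask\<close>

text \<open>Unitarity of the Hadamard matrix enters through its row and column relations. Since \<open>D\<close> represents all
  classes modulo \<open>transpose A\<close>, they imply that \<open>L\<close> is a complete set of representatives modulo \<open>A\<close>.\<close>

locale irreducible_hadamard =
  fixes A :: "real^'n^'n" and D L :: "(real^'n) set"
  assumes hadamard: "hadamard_triple A D L"
    and representatives: "complete_representatives (transpose A) D"
    and irreducible: "no_proper_invariant_subspaces A"
begin

declare transpose_matrix_vector [simp del]

abbreviation "B \<equiv> transpose A"
abbreviation "Ai \<equiv> matrix_inv A"
abbreviation "Bi \<equiv> matrix_inv (transpose A)"

definition q :: real where "q = real (card D)"

lemma
  shows int_A: "int_matrix A" and int_B: "int_matrix B" and expansive_A: "expansive A"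
    and D_int: "D \<subseteq> int_vecs" and L_int: "L \<subseteq> int_vecs"
    and finite_D: "finite D" and finite_L: "finite L"
    and det_A: "\<bar>det A\<bar> = q" and card_L: "real (card L) = q"
    and unitary: "unitary_on D L (\<lambda>d l. complex_of_real (1 / sqrt q) * echar ((Bi *v d) \<bullet> l))"
  using hadamard unfolding hadamard_triple_def q_def
  by (auto simp: int_matrix_def transpose_def exp_eq_echar)

text \<open>An eigenfunctional of \<open>A\<close>. The norm \<open>cmod \<circ> \<phi>\<close> turns \<open>A\<close> into an exact similarity, so the inverse
  branches contract by the same factor in all directions.\<close>

definition \<phi> :: "real^'n \<Rightarrow> complex" where
  "\<phi> = (SOME f. linear f \<and> inj f \<and> (\<exists>ev. (\<forall>x. f (A *v x) = ev * f x) \<and> 1 < cmod ev))"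

definition r :: real where "r = (SOME r. 1 < r \<and> (\<forall>x. cmod (\<phi> (A *v x)) = r * cmod (\<phi> x)))"

lemma linear_\<phi>: "linear \<phi>" and inj_\<phi>: "inj \<phi>" and \<phi>_eigen: "\<exists>ev. (\<forall>x. \<phi> (A *v x) = ev * \<phi> x) \<and> 1 < cmod ev"
proof -
  have "\<exists>f. linear f \<and> inj f \<and> (\<exists>ev. (\<forall>x. f (A *v x) = ev * f x) \<and> 1 < cmod ev)"
    using irreducible_expansive_similarity[OF irreducible expansive_A] by blast
  from someI_ex[OF this]
  have "linear \<phi> \<and> inj \<phi> \<and> (\<exists>ev. (\<forall>x. \<phi> (A *v x) = ev * \<phi> x) \<and> 1 < cmod ev)"
    unfolding \<phi>_def[symmetric] .
  then show "linear \<phi>" "inj \<phi>" "\<exists>ev. (\<forall>x. \<phi> (A *v x) = ev * \<phi> x) \<and> 1 < cmod ev" by auto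
qed

lemma r_gt_1: "1 < r" and norm_\<phi>_A: "cmod (\<phi> (A *v x)) = r * cmod (\<phi> x)"
proof -
  obtain ev where "\<forall>x. \<phi> (A *v x) = ev * \<phi> x" "1 < cmod ev" using \<phi>_eigen by blast
  then have "\<exists>r. 1 < r \<and> (\<forall>x. cmod (\<phi> (A *v x)) = r * cmod (\<phi> x))"
    by (intro exI[of _ "cmod ev"]) (simp add: norm_mult)
  from someI_ex[OF this] have "1 < r \<and> (\<forall>x. cmod (\<phi> (A *v x)) = r * cmod (\<phi> x))"
    unfolding r_def[symmetric] .
  then show "1 < r" "cmod (\<phi> (A *v x)) = r * cmod (\<phi> x)" by auto
qed

lemma \<phi>_eq_0_iff: "\<phi> x = 0 \<longleftrightarrow> x = 0"
  using linear_\<phi> inj_\<phi> by (metis linear_0 linear_injective_0)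

lemma \<phi>_bounds: obtains c C where "c > 0" "C > 0" "\<And>x. c * norm x \<le> cmod (\<phi> x)" "\<And>x. cmod (\<phi> x) \<le> C * norm x"
proof -
  obtain c where "c > 0" "\<And>x. c * norm x \<le> cmod (\<phi> x)"
    using linear_inj_bounded_below_pos[OF linear_\<phi> inj_\<phi>] by blast
  moreover obtain C where "C > 0" "\<And>x. cmod (\<phi> x) \<le> C * norm x"
    using linear_bounded_pos[OF linear_\<phi>] by blast
  ultimately show ?thesis using that by blast
qed

lemma invertible_A: "invertible A"
proof -
  have "x = 0" if "A *v x = 0" for x
    using norm_\<phi>_A[of x] that r_gt_1 \<phi>_eq_0_iff[of 0] \<phi>_eq_0_iff[of x] by simp
  then have "\<exists>B. B ** A = mat 1" by (simp add: matrix_left_invertible_ker)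
  then show ?thesis by (simp add: invertible_left_inverse)
qed

lemma invertible_B: "invertible B"
  using invertible_A by (simp add: invertible_det_nz)

lemma q_pos: "q > 0" using invertible_A det_A by (metis invertible_det_nz zero_less_abs_iff)

lemma A_Ai [simp]: "A *v (Ai *v x) = x" and Ai_A [simp]: "Ai *v (A *v x) = x"
  and B_Bi [simp]: "B *v (Bi *v x) = x" and Bi_B [simp]: "Bi *v (B *v x) = x"
  using matrix_inv_inverse[OF invertible_A] matrix_inv_inverse[OF invertible_B]
  by (simp_all only: matrix_vector_mul_assoc matrix_vector_mul_lid)

lemma inner_B: "(B *v x) \<bullet> y = x \<bullet> (A *v y)"
  by (rule inner_transpose[symmetric])

lemma inner_Bi: "(Bi *v x) \<bullet> y = x \<bullet> (Ai *v y)"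
  using inner_B[of "Bi *v x" "Ai *v y"] by simp

lemma A_int_vecs: "z \<in> int_vecs \<Longrightarrow> A *v z \<in> int_vecs"
  and B_int_vecs: "z \<in> int_vecs \<Longrightarrow> B *v z \<in> int_vecs"
  using int_matrix_mult_int_vecs int_A int_B by blast+

lemma norm_\<phi>_Ai: "cmod (\<phi> (Ai *v x)) = cmod (\<phi> x) / r"
  using norm_\<phi>_A[of "Ai *v x"] r_gt_1 by (simp add: field_simps)

lemma norm_\<phi>_Ai_iterate: "cmod (\<phi> (((*v) Ai ^^ k) x)) = cmod (\<phi> x) / r ^ k"
  by (induction k) (simp_all add: norm_\<phi>_Ai)

lemma representative_unique:
  assumes "d \<in> D" "d' \<in> D" "d - d' = B *v z" "z \<in> int_vecs"
  shows "d = d'"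
proof -
  have "d \<in> int_vecs" using assms D_int by auto
  then have "\<exists>!e. e \<in> D \<and> d - e \<in> (\<lambda>y. B *v y) ` int_vecs"
    using representatives unfolding complete_representatives_def by blast
  moreover have "d - d \<in> (\<lambda>y. B *v y) ` int_vecs"
    using image_eqI[of 0 "\<lambda>y. B *v y" 0 int_vecs] by simp
  moreover have "d - d' \<in> (\<lambda>y. B *v y) ` int_vecs" using assms by auto
  ultimately show ?thesis using assms by blast
qed

lemma representative_exists:
  assumes "z \<in> int_vecs"
  obtains d y where "d \<in> D" "y \<in> int_vecs" "z = d + B *v y"
proof -
  obtain d where "d \<in> D" "z - d \<in> (\<lambda>y. B *v y) ` int_vecs"
    using representatives assms unfolding complete_representatives_def by blast
  then obtain y where "y \<in> int_vecs" "z - d = B *v y" by auto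
  with \<open>d \<in> D\<close> show ?thesis by (intro that[of d y]) (auto simp: algebra_simps)
qed

lemma D_nonempty: "D \<noteq> {}" using representative_exists[of 0] by auto

text \<open>Orthogonality of the rows of the Hadamard matrix.\<close>

lemma sum_L_D:
  assumes "d \<in> D" "d' \<in> D"
  shows "(\<Sum>l\<in>L. echar ((d - d') \<bullet> (Ai *v l))) = (if d = d' then q else 0)"
proof -
  have "(\<Sum>l\<in>L. (complex_of_real (1 / sqrt q) * echar ((Bi *v d) \<bullet> l)) *
      cnj (complex_of_real (1 / sqrt q) * echar ((Bi *v d') \<bullet> l))) = (if d = d' then 1 else 0)"
    using unitary assms unfolding unitary_on_def by blast
  moreover have "(complex_of_real (1 / sqrt q) * echar ((Bi *v d) \<bullet> l)) *
      cnj (complex_of_real (1 / sqrt q) * echar ((Bi *v d') \<bullet> l)) = echar ((d - d') \<bullet> (Ai *v l)) / q" for l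
  proof -
    have "complex_of_real (sqrt q) * complex_of_real (sqrt q) = q"
      using q_pos by (simp flip: of_real_mult)
    then show ?thesis by (simp add: inner_Bi inner_diff_left echar_diff)
  qed
  ultimately have "(\<Sum>l\<in>L. echar ((d - d') \<bullet> (Ai *v l))) / q = (if d = d' then 1 else 0)"
    by (simp add: sum_divide_distrib)
  then show ?thesis using q_pos by (simp add: field_simps split: if_splits)
qed

text \<open>The frequencies \<open>l\<close> separate the classes of \<open>\<int>\<^sup>n\<close> modulo \<open>B\<close>: each class contains a digit, and
  digits are separated by the rows of the matrix.\<close>

lemma sum_L:
  assumes "k \<in> int_vecs"
  shows "(\<Sum>l\<in>L. echar (k \<bullet> (Ai *v l))) = (if k \<in> (\<lambda>y. B *v y) ` int_vecs then q else 0)"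
proof -
  obtain d y where d: "d \<in> D" "y \<in> int_vecs" "k = d + B *v y" by (rule representative_exists[OF assms])
  obtain d0 y0 where d0: "d0 \<in> D" "y0 \<in> int_vecs" "0 = d0 + B *v y0" by (rule representative_exists[of 0]) auto
  have "k = (d - d0) + B *v (y - y0)"
    using d(3) d0(3) by (simp add: matrix_vector_mult_diff_distrib add_eq_0_iff)
  then have "k \<bullet> (Ai *v l) = (d - d0) \<bullet> (Ai *v l) + (y - y0) \<bullet> l" for l
    by (simp only: inner_add_left inner_B A_Ai)
  then have "echar (k \<bullet> (Ai *v l)) = echar ((d - d0) \<bullet> (Ai *v l))" if "l \<in> L" for l
    using that L_int d d0 by (simp add: echar_add_Ints inner_int_vecs int_vecs_diff subset_iff)
  then have "(\<Sum>l\<in>L. echar (k \<bullet> (Ai *v l))) = (if d = d0 then q else 0)"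
    using sum_L_D[OF d(1) d0(1)] by simp
  moreover have "k \<in> (\<lambda>y. B *v y) ` int_vecs \<longleftrightarrow> d = d0"
  proof
    assume "d = d0"
    then have "k = B *v (y - y0)" using \<open>k = (d - d0) + B *v (y - y0)\<close> by simp
    then show "k \<in> (\<lambda>y. B *v y) ` int_vecs" using d d0 by blast
  next
    assume "k \<in> (\<lambda>y. B *v y) ` int_vecs"
    then obtain w where w: "w \<in> int_vecs" "k = B *v w" by blast
    have "d - d0 = B *v (w - (y - y0))"
      using \<open>k = (d - d0) + B *v (y - y0)\<close> w(2) by (simp add: matrix_vector_mult_diff_distrib algebra_simps)
    then show "d = d0" using representative_unique[OF d(1) d0(1)] w d d0 by blast
  qed
  ultimately show ?thesis by simp
qed

text \<open>The characters of \<open>\<int>\<^sup>n\<close> modulo \<open>B\<close> given by \<open>z + l\<close>, summed over the digits, cannot all add up to zero;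
  a character with nonzero sum over the group is trivial, which means \<open>Ai *v (z + l) \<in> int_vecs\<close>.\<close>

lemma L_representative_exists:
  assumes z: "z \<in> int_vecs"
  obtains l where "l \<in> L" "Ai *v (z + l) \<in> int_vecs"
proof -
  define S where "S = (\<lambda>s. \<Sum>d\<in>D. echar (d \<bullet> (Ai *v s)))"
  obtain d0 y0 where d0: "d0 \<in> D" "y0 \<in> int_vecs" "0 = d0 + B *v y0" by (rule representative_exists[of 0]) auto
  have inB: "d \<in> (\<lambda>y. B *v y) ` int_vecs \<longleftrightarrow> d = d0" if "d \<in> D" for d
  proof
    assume "d \<in> (\<lambda>y. B *v y) ` int_vecs"
    then obtain w where w: "w \<in> int_vecs" "d = B *v w" by blast
    have "d - d0 = B *v (w + y0)"
      using w(2) d0(3) by (simp add: matrix_vector_right_distrib) (metis add_eq_0_iff)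
    then show "d = d0" using representative_unique[OF that d0(1)] w d0 by blast
  next
    assume "d = d0"
    moreover have "d0 = B *v (0 - y0)"
      using d0(3) by (simp only: matrix_vector_mult_diff_distrib[of _ 0]) (simp add: eq_neg_iff_add_eq_0)
    ultimately show "d \<in> (\<lambda>y. B *v y) ` int_vecs"
      using int_vecs_diff[OF int_vecs_0 d0(2)] by (intro image_eqI[of _ _ "0 - y0"]) simp_all
  qed
  have "(\<Sum>l\<in>L. S (z + l)) = (\<Sum>d\<in>D. echar (d \<bullet> (Ai *v z)) * (\<Sum>l\<in>L. echar (d \<bullet> (Ai *v l))))"
    unfolding S_def by (subst sum.swap)
      (simp add: matrix_vector_right_distrib inner_add_right echar_add sum_distrib_left)
  also have "\<dots> = (\<Sum>d\<in>D. if d = d0 then echar (d \<bullet> (Ai *v z)) * q else 0)"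
    by (intro sum.cong refl) (use D_int sum_L inB in auto)
  also have "\<dots> = echar (d0 \<bullet> (Ai *v z)) * q" using finite_D d0(1) by simp
  finally have "(\<Sum>l\<in>L. S (z + l)) \<noteq> 0" using q_pos by simp
  then obtain l where l: "l \<in> L" "S (z + l) \<noteq> 0" using sum.neutral by metis
  define s where "s = z + l"
  have s: "s \<in> int_vecs" using z l L_int by (auto simp: s_def)
  \<comment> \<open>adding \<open>e\<close> permutes the digit classes and multiplies the sum \<open>S s\<close> by this factor\<close>
  have one: "echar (e \<bullet> (Ai *v s)) = 1" if e: "e \<in> int_vecs" for e
  proof -
    have "\<exists>d'\<in>D. \<exists>y\<in>int_vecs. d + e = d' + B *v y" if "d \<in> D" for d
      using representative_exists[of "d + e"] e that D_int by (metis int_vecs_add subsetD)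
    then obtain p y where p: "\<And>d. d \<in> D \<Longrightarrow> p d \<in> D \<and> y d \<in> int_vecs \<and> d + e = p d + B *v y d"
      by metis
    have "inj_on p D"
    proof (rule inj_onI)
      fix d d' assume dd: "d \<in> D" "d' \<in> D" "p d = p d'"
      have e1: "d + e = p d + B *v y d" and e2: "d' + e = p d + B *v y d'"
        using p[of d] p[of d'] dd by auto
      have "d - d' = (d + e) - (d' + e)" by simp
      also have "\<dots> = B *v y d - B *v y d'" unfolding e1 e2 by simp
      also have "\<dots> = B *v (y d - y d')" by (rule matrix_vector_mult_diff_distrib[symmetric])
      finally have "d - d' = B *v (y d - y d')" .
      from representative_unique[OF dd(1,2) this] p[OF dd(1)] p[OF dd(2)] show "d = d'"
        by (simp add: int_vecs_diff)
    qed
    moreover have "p ` D \<subseteq> D" using p by auto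
    ultimately have bij: "bij_betw p D D"
      by (simp add: bij_betw_def endo_inj_surj finite_D)
    have "echar (e \<bullet> (Ai *v s)) * S s = (\<Sum>d\<in>D. echar ((d + e) \<bullet> (Ai *v s)))"
      unfolding S_def by (simp add: sum_distrib_left inner_add_left echar_add mult.commute)
    also have "\<dots> = (\<Sum>d\<in>D. echar (p d \<bullet> (Ai *v s)))"
    proof (rule sum.cong)
      fix d assume d: "d \<in> D"
      have "(d + e) \<bullet> (Ai *v s) = p d \<bullet> (Ai *v s) + y d \<bullet> s"
        using p[OF d] by (simp only: inner_add_left inner_B A_Ai)
      then show "echar ((d + e) \<bullet> (Ai *v s)) = echar (p d \<bullet> (Ai *v s))"
        using p[OF d] s by (simp add: echar_add_Ints inner_int_vecs)
    qed simp
    also have "\<dots> = S s" unfolding S_def by (rule sum.reindex_bij_betw[OF bij])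
    finally show ?thesis using l(2) by (simp add: s_def)
  qed
  have "e \<bullet> (Ai *v s) \<in> \<int>" if "e \<in> int_vecs" for e using one[OF that] by (simp add: echar_eq_1_iff)
  then have "Ai *v s \<in> int_vecs" using int_vecs_iff_inner by blast
  then show ?thesis using that l(1) by (simp add: s_def)
qed

text \<open>Congruent frequencies give equal columns of the Hadamard matrix.\<close>

lemma L_representative_unique:
  assumes "l \<in> L" "l' \<in> L" "Ai *v (l - l') \<in> int_vecs"
  shows "l = l'"
proof (rule ccontr)
  assume "l \<noteq> l'"
  then have "(\<Sum>d\<in>D. cnj (complex_of_real (1 / sqrt q) * echar ((Bi *v d) \<bullet> l)) *
      (complex_of_real (1 / sqrt q) * echar ((Bi *v d) \<bullet> l'))) = 0"
    using unitary assms unfolding unitary_on_def by auto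
  moreover have "cnj (complex_of_real (1 / sqrt q) * echar ((Bi *v d) \<bullet> l)) *
      (complex_of_real (1 / sqrt q) * echar ((Bi *v d) \<bullet> l')) = 1 / q" if "d \<in> D" for d
  proof -
    have 1: "complex_of_real (sqrt q) * complex_of_real (sqrt q) = q"
      using q_pos by (simp flip: of_real_mult)
    have "d \<bullet> (Ai *v (l - l')) \<in> \<int>" using that D_int assms(3) by (auto intro: inner_int_vecs)
    then have "echar (d \<bullet> (Ai *v l') + d \<bullet> (Ai *v (l - l'))) = echar (d \<bullet> (Ai *v l'))"
      by (rule echar_add_Ints)
    then have 2: "echar (d \<bullet> (Ai *v l)) = echar (d \<bullet> (Ai *v l'))"
      by (simp add: matrix_vector_mult_diff_distrib inner_diff_right)
    have "cnj (echar t) * echar t = 1" for t by (simp add: mult.commute complex_norm_square[symmetric])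
    then show ?thesis using 1 2 by (simp add: inner_Bi)
  qed
  ultimately have "(\<Sum>d\<in>D. 1 / complex_of_real q) = 0" by simp
  then show False using q_pos by (simp add: q_def)
qed

abbreviation "m \<equiv> mask A D"

lemma mask_eq: "m x = (\<Sum>d\<in>D. echar (d \<bullet> x)) / q"
  by (simp add: mask_def det_A exp_eq_echar)

lemma mask_periodic: "z \<in> int_vecs \<Longrightarrow> m (x + z) = m x"
  unfolding mask_eq using D_int by (intro arg_cong2[where f="(/)"] sum.cong)
    (auto simp: inner_add_right intro!: echar_add_Ints inner_int_vecs)

lemma continuous_on_mask: "continuous_on S m"
  unfolding mask_eq[abs_def] using q_pos by (intro continuous_intros) auto

lemma norm_mask_square:
  "complex_of_real ((cmod (m x))\<^sup>2) = (\<Sum>d\<in>D. \<Sum>d'\<in>D. echar ((d - d') \<bullet> x)) / q\<^sup>2"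
proof -
  have "complex_of_real ((cmod (m x))\<^sup>2) = m x * cnj (m x)"
    by (rule complex_norm_square)
  also have "\<dots> = ((\<Sum>d\<in>D. echar (d \<bullet> x)) * (\<Sum>d'\<in>D. cnj (echar (d' \<bullet> x)))) / q\<^sup>2"
    by (simp add: mask_eq power2_eq_square)
  also have "\<dots> = (\<Sum>d\<in>D. \<Sum>d'\<in>D. echar ((d - d') \<bullet> x)) / q\<^sup>2"
    by (simp add: sum_product inner_diff_left echar_diff)
  finally show ?thesis .
qed

text \<open>The transfer operator with weight \<open>\<bar>m\<bar>\<^sup>2\<close> applied to a character: expanding the square gives the
  frequencies \<open>n + (d - d')\<close>, and summation over \<open>L\<close> keeps those divisible by \<open>B\<close>.\<close>

lemma transfer_character:
  assumes n: "n \<in> int_vecs"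
  shows "(\<Sum>l\<in>L. (cmod (m (Ai *v (x + l))))\<^sup>2 * echar (n \<bullet> (Ai *v (x + l))))
    = (\<Sum>d\<in>D. \<Sum>d'\<in>D. if n + (d - d') \<in> (\<lambda>y. B *v y) ` int_vecs
          then echar ((n + (d - d')) \<bullet> (Ai *v x)) else 0) / q"
proof -
  have "(\<Sum>l\<in>L. (cmod (m (Ai *v (x + l))))\<^sup>2 * echar (n \<bullet> (Ai *v (x + l))))
     = (\<Sum>l\<in>L. \<Sum>d\<in>D. \<Sum>d'\<in>D. echar ((n + (d - d')) \<bullet> (Ai *v (x + l)))) / q\<^sup>2"
    by (simp add: norm_mask_square sum_distrib_right sum_distrib_left sum_divide_distrib inner_add_left echar_add mult.commute
        flip: of_real_power)
  also have "(\<Sum>l\<in>L. \<Sum>d\<in>D. \<Sum>d'\<in>D. echar ((n + (d - d')) \<bullet> (Ai *v (x + l))))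
     = (\<Sum>d\<in>D. \<Sum>d'\<in>D. \<Sum>l\<in>L. echar ((n + (d - d')) \<bullet> (Ai *v (x + l))))"
    by (subst sum.swap) (intro sum.cong refl sum.swap)
  also have "\<dots> = (\<Sum>d\<in>D. \<Sum>d'\<in>D. echar ((n + (d - d')) \<bullet> (Ai *v x))
       * (\<Sum>l\<in>L. echar ((n + (d - d')) \<bullet> (Ai *v l))))"
    by (simp add: matrix_vector_right_distrib inner_add_right echar_add sum_distrib_left)
  also have "\<dots> = (\<Sum>d\<in>D. \<Sum>d'\<in>D. (if n + (d - d') \<in> (\<lambda>y. B *v y) ` int_vecs
          then echar ((n + (d - d')) \<bullet> (Ai *v x)) else 0) * q)"
  proof (intro sum.cong refl)
    fix d d' assume "d \<in> D" "d' \<in> D"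
    then have "n + (d - d') \<in> int_vecs" using n D_int by auto
    from sum_L[OF this] show "echar ((n + (d - d')) \<bullet> (Ai *v x)) * (\<Sum>l\<in>L. echar ((n + (d - d')) \<bullet> (Ai *v l)))
      = (if n + (d - d') \<in> (\<lambda>y. B *v y) ` int_vecs then echar ((n + (d - d')) \<bullet> (Ai *v x)) else 0) * q"
      by simp
  qed
  finally show ?thesis using q_pos
    by (simp add: power2_eq_square flip: sum_distrib_right)
qed

text \<open>The transfer operator fixes the constant function 1, because distinct digits are incongruent modulo
  \<open>B\<close>.\<close>

lemma sum_mask_square: "(\<Sum>l\<in>L. (cmod (m (Ai *v (x + l))))\<^sup>2) = 1"
proof -
  have "(\<Sum>l\<in>L. complex_of_real ((cmod (m (Ai *v (x + l))))\<^sup>2))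
     = (\<Sum>d\<in>D. \<Sum>d'\<in>D. if 0 + (d - d') \<in> (\<lambda>y. B *v y) ` int_vecs
          then echar ((0 + (d - d')) \<bullet> (Ai *v x)) else 0) / q"
    using transfer_character[of 0 x] by simp
  also have "(\<Sum>d\<in>D. \<Sum>d'\<in>D. if 0 + (d - d') \<in> (\<lambda>y. B *v y) ` int_vecs
          then echar ((0 + (d - d')) \<bullet> (Ai *v x)) else 0) = (\<Sum>d\<in>D. \<Sum>d'\<in>D. if d' = d then 1 else 0)"
  proof (intro sum.cong refl)
    fix d d' assume d: "d \<in> D" "d' \<in> D"
    have "d - d' \<in> (\<lambda>y. B *v y) ` int_vecs \<longleftrightarrow> d' = d"
      using representative_unique[OF d] image_eqI[of 0 "\<lambda>y. B *v y" 0 int_vecs] by auto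
    then show "(if 0 + (d - d') \<in> (\<lambda>y. B *v y) ` int_vecs then echar ((0 + (d - d')) \<bullet> (Ai *v x)) else 0)
       = (if d' = d then 1 else 0)" by auto
  qed
  also have "\<dots> = complex_of_real q" using finite_D by (simp add: q_def)
  finally have "complex_of_real (\<Sum>l\<in>L. (cmod (m (Ai *v (x + l))))\<^sup>2) = complex_of_real 1"
    using q_pos by simp
  then show ?thesis by (simp only: of_real_eq_iff)
qed

lemma norm_mask_le_1: "cmod (m x) \<le> 1"
proof -
  have "cmod (\<Sum>d\<in>D. echar (d \<bullet> x)) \<le> (\<Sum>d\<in>D. 1)"
    by (intro sum_norm_le) simp
  then show ?thesis using q_pos by (simp add: mask_eq norm_divide q_def)
qed

text \<open>Equality in the triangle inequality: all the unit numbers that are averaged agree.\<close>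

lemma norm_mask_eq_1_iff: "cmod (m x) = 1 \<longleftrightarrow> (\<forall>d\<in>D. \<forall>d'\<in>D. (d - d') \<bullet> x \<in> \<int>)"
proof
  assume int: "\<forall>d\<in>D. \<forall>d'\<in>D. (d - d') \<bullet> x \<in> \<int>"
  then have "\<forall>d\<in>D. \<forall>d'\<in>D. echar ((d - d') \<bullet> x) = 1" by (simp add: echar_eq_1_iff)
  then have "complex_of_real ((cmod (m x))\<^sup>2) = complex_of_real 1"
    unfolding norm_mask_square using q_pos by (simp add: q_def power2_eq_square)
  then have "(cmod (m x))\<^sup>2 = 1\<^sup>2" by (simp only: of_real_eq_iff power_one)
  then show "cmod (m x) = 1" by (simp only: power2_eq_iff_nonneg norm_ge_zero zero_le_one)
next
  assume one: "cmod (m x) = 1"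
  have "(\<Sum>d\<in>D. \<Sum>d'\<in>D. echar ((d - d') \<bullet> x)) = complex_of_real (q\<^sup>2)"
    using norm_mask_square[of x] one q_pos by simp
  then have "Re (\<Sum>d\<in>D. \<Sum>d'\<in>D. echar ((d - d') \<bullet> x)) = q\<^sup>2" by simp
  then have "(\<Sum>d\<in>D. \<Sum>d'\<in>D. Re (echar ((d - d') \<bullet> x))) = q\<^sup>2" by (simp add: Re_sum)
  then have "(\<Sum>d\<in>D. \<Sum>d'\<in>D. 1 - Re (echar ((d - d') \<bullet> x))) = 0"
    by (simp add: sum_subtractf q_def power2_eq_square)
  moreover have nn: "0 \<le> 1 - Re (echar t)" for t
    using complex_Re_le_cmod[of "echar t"] by simp
  ultimately have "\<forall>d\<in>D. (\<Sum>d'\<in>D. 1 - Re (echar ((d - d') \<bullet> x))) = 0"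
    using finite_D by (subst (asm) sum_nonneg_eq_0_iff) (auto intro!: sum_nonneg)
  then have z: "\<forall>d\<in>D. \<forall>d'\<in>D. 1 - Re (echar ((d - d') \<bullet> x)) = 0"
    using finite_D nn by (auto simp: sum_nonneg_eq_0_iff)
  show "\<forall>d\<in>D. \<forall>d'\<in>D. (d - d') \<bullet> x \<in> \<int>"
  proof (intro ballI)
    fix d d' assume "d \<in> D" "d' \<in> D"
    then have re: "Re (echar ((d - d') \<bullet> x)) = 1" using z by force
    have "(Re (echar ((d - d') \<bullet> x)))\<^sup>2 + (Im (echar ((d - d') \<bullet> x)))\<^sup>2 = 1"
      by (simp flip: cmod_power2)
    then have "echar ((d - d') \<bullet> x) = 1" using re by (simp add: complex_eq_iff)
    then show "(d - d') \<bullet> x \<in> \<int>" by (simp add: echar_eq_1_iff)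
  qed
qed

section \<open>The smallest admissible lattice\<close>

text \<open>By \<open>norm_mask_eq_1_iff\<close> this is the dual of the \<open>B\<close>-invariant group generated by the differences of digits; it
  turns out to be the smallest admissible lattice.\<close>

definition P :: "(real^'n) set" where
  "P = {x. \<forall>k. cmod (m (((*v) A ^^ k) x)) = 1}"

lemma P_iff: "x \<in> P \<longleftrightarrow> (\<forall>k. \<forall>d\<in>D. \<forall>d'\<in>D. (d - d') \<bullet> ((*v) A ^^ k) x \<in> \<int>)"
  by (simp add: P_def norm_mask_eq_1_iff)

lemma linear_iterate: "linear ((*v) M ^^ k)" for M :: "real^'n^'n"
proof (induction k)
  case 0
  show ?case by (simp add: linear_ident)
next
  case (Suc k)
  then show ?case using linear_compose[OF Suc matrix_vector_mul_linear[of M]] by (simp only: funpow.simps)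
qed

lemma iterate_int_vecs: "z \<in> int_vecs \<Longrightarrow> ((*v) A ^^ k) z \<in> int_vecs"
  by (induction k) (auto simp: A_int_vecs)

lemma P_0: "0 \<in> P" and P_add: "x \<in> P \<Longrightarrow> y \<in> P \<Longrightarrow> x + y \<in> P" and P_minus: "x \<in> P \<Longrightarrow> - x \<in> P"
  by (auto simp: P_iff linear_0[OF linear_iterate] linear_add[OF linear_iterate] linear_neg[OF linear_iterate]
      inner_add_right intro: Ints_add)

lemma P_diff: "x \<in> P \<Longrightarrow> y \<in> P \<Longrightarrow> x - y \<in> P"
  using P_add[of x "- y"] P_minus by simp

lemma int_vecs_subset_P: "int_vecs \<subseteq> P"
  using D_int by (auto simp: P_iff subset_iff intro!: inner_int_vecs iterate_int_vecs int_vecs_diff)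

lemma P_A: "x \<in> P \<Longrightarrow> A *v x \<in> P"
  unfolding P_def by (simp flip: funpow_swap1) (metis funpow.simps(2) comp_apply)

lemma P_mask: "x \<in> P \<Longrightarrow> cmod (m x) = 1"
  unfolding P_def by (metis (mono_tags) funpow_0 mem_Collect_eq)

lemma inner_B_iterate: "(((*v) B ^^ k) x) \<bullet> y = x \<bullet> (((*v) A ^^ k) y)"
proof (induction k arbitrary: y)
  case (Suc k)
  show ?case using Suc[of "A *v y"] by (simp add: inner_B funpow_swap1[of "(*v) A"])
qed simp

text \<open>With one digit, \<open>A\<close> would be invertible over the integers, and its inverse would shrink a nonzero integer
  vector to arbitrarily small nonzero integer vectors.\<close>

lemma D_not_singleton: "\<exists>d\<in>D. \<exists>d'\<in>D. d \<noteq> d'"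
proof (rule ccontr)
  assume "\<not> ?thesis"
  then obtain d0 where "D = {d0}" using D_nonempty by blast
  then have "q = 1" unfolding q_def by simp
  then have "card L = 1" using card_L by simp
  then obtain l0 where L: "L = {l0}" by (auto simp: card_1_singleton_iff)
  have div: "Ai *v z \<in> int_vecs" if "z \<in> int_vecs" for z
  proof -
    have "Ai *v (z + l0) \<in> int_vecs" using L_representative_exists[OF that] L by auto
    moreover have "Ai *v (0 + l0) \<in> int_vecs" using L_representative_exists[OF int_vecs_0] L by auto
    moreover have "Ai *v z = Ai *v (z + l0) - Ai *v (0 + l0)" by (simp add: matrix_vector_right_distrib)
    ultimately show ?thesis by (simp only: int_vecs_diff)
  qed
  define e :: "real^'n" where "e = 1"
  have e: "((*v) Ai ^^ k) e \<in> int_vecs" for k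
    by (induction k) (simp_all add: div, simp add: e_def int_vecs_def)
  obtain c C where c: "c > 0" "\<And>x. c * norm x \<le> cmod (\<phi> x)" by (rule \<phi>_bounds) blast
  have "e \<noteq> 0" by (simp add: e_def)
  have low: "1 \<le> norm z" if "z \<in> int_vecs" "z \<noteq> 0" for z :: "real^'n"
  proof -
    obtain i where i: "z $ i \<noteq> 0" using \<open>z \<noteq> 0\<close> by (auto simp: vec_eq_iff)
    have "z $ i \<in> \<int>" using that(1) by (simp add: int_vecs_def)
    then have "1 \<le> \<bar>z $ i\<bar>" using i by (rule Ints_nonzero_abs_ge1)
    also have "\<dots> \<le> norm z" by (rule component_le_norm_cart)
    finally show ?thesis .
  qed
  have "c \<le> cmod (\<phi> e) / r ^ k" for k
  proof -
    have "((*v) Ai ^^ k) e \<noteq> 0"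
      using norm_\<phi>_Ai_iterate[of k e] \<phi>_eq_0_iff[of e] \<phi>_eq_0_iff[of 0] \<open>e \<noteq> 0\<close> r_gt_1 by auto
    then have "c * 1 \<le> c * norm (((*v) Ai ^^ k) e)" using low[OF e] c(1) by (intro mult_left_mono) auto
    also have "\<dots> \<le> cmod (\<phi> e) / r ^ k" using c(2) norm_\<phi>_Ai_iterate by metis
    finally show ?thesis by simp
  qed
  then have "c * r ^ k \<le> cmod (\<phi> e)" for k
    using r_gt_1 by (simp add: pos_le_divide_eq)
  moreover obtain k where "cmod (\<phi> e) / c < r ^ k" using real_arch_pow[OF r_gt_1] by blast
  moreover from this have "cmod (\<phi> e) < c * r ^ k" using c(1) by (simp add: pos_divide_less_eq mult.commute)
  ultimately show False by (meson not_le)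
qed

text \<open>The generators of the group whose dual is \<open>P\<close>.\<close>

definition Q :: "(real^'n) set" where
  "Q = {((*v) B ^^ k) (d - d') |k d d'. d \<in> D \<and> d' \<in> D}"

lemma span_Q: "span Q = UNIV"
proof -
  have "\<forall>x\<in>span Q. B *v x \<in> span Q"
  proof
    fix x assume "x \<in> span Q"
    then have "B *v x \<in> (\<lambda>x. B *v x) ` span Q" by simp
    also have "\<dots> = span ((\<lambda>x. B *v x) ` Q)" by (rule linear_span_image[symmetric]) simp
    also have "\<dots> \<subseteq> span Q"
    proof (rule span_mono, clarify)
      fix x assume "x \<in> Q"
      then obtain k d d' where "d \<in> D" "d' \<in> D" "x = ((*v) B ^^ k) (d - d')" by (auto simp: Q_def)
      then show "B *v x \<in> Q" unfolding Q_def by (intro CollectI exI[of _ "Suc k"] exI[of _ d] exI[of _ d']) simp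
    qed
    finally show "B *v x \<in> span Q" .
  qed
  then have "span Q = {0} \<or> span Q = UNIV"
    using irreducible_transpose[OF irreducible] unfolding no_proper_invariant_subspaces_def by blast
  moreover have "span Q \<noteq> {0}"
  proof
    assume "span Q = {0}"
    obtain d d' where d: "d \<in> D" "d' \<in> D" "d \<noteq> d'" using D_not_singleton by blast
    then have "d - d' \<in> Q" unfolding Q_def by (intro CollectI exI[of _ 0] exI[of _ d] exI[of _ d']) simp
    then have "d - d' \<in> {0}" using span_base[of "d - d'" Q] \<open>span Q = {0}\<close> by metis
    then show False using d by simp
  qed
  ultimately show ?thesis by blast
qed

lemma P_integral_coordinates: obtains T :: "real^'n^'n" where "det T \<noteq> 0" "\<And>x. x \<in> P \<Longrightarrow> T *v x \<in> int_vecs"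
proof -
  obtain T :: "real^'n^'n" where T: "det T \<noteq> 0" "\<And>i. row i T \<in> Q"
    using spanning_set_contains_rows[OF span_Q] by blast
  have "T *v x \<in> int_vecs" if "x \<in> P" for x
  proof -
    have "(T *v x) $ i \<in> \<int>" for i
    proof -
      obtain k d d' where d: "d \<in> D" "d' \<in> D" "row i T = ((*v) B ^^ k) (d - d')"
        using T(2)[of i] by (auto simp: Q_def)
      have "(T *v x) $ i = (row i T) \<bullet> x"
        by (simp add: matrix_vector_mult_def row_def inner_vec_def)
      also have "\<dots> = (d - d') \<bullet> ((*v) A ^^ k) x" unfolding d(3) by (rule inner_B_iterate)
      also have "\<dots> \<in> \<int>" using that d by (auto simp: P_iff)
      finally show ?thesis .
    qed
    then show ?thesis by (simp add: int_vecs_def)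
  qed
  with T(1) show ?thesis by (rule that)
qed

lemma is_lattice_P: "is_lattice P"
  by (rule P_integral_coordinates, rule discrete_subgroup_is_lattice)
     (auto intro: P_0 P_add P_minus int_vecs_subset_P[THEN subsetD])

lemma finite_P_bounded:
  assumes "bounded S" "S \<subseteq> P"
  shows "finite S"
proof -
  obtain T :: "real^'n^'n" where T: "det T \<noteq> 0" "\<And>x. x \<in> P \<Longrightarrow> T *v x \<in> int_vecs"
    by (rule P_integral_coordinates) blast
  have "bounded ((\<lambda>x. T *v x) ` S)"
    by (intro bounded_linear_image assms(1)) simp
  then have "finite ((\<lambda>x. T *v x) ` S)"
    using T(2) assms(2) by (intro finite_int_vecs_bounded) auto
  moreover have "inj_on (\<lambda>x. T *v x) S"
    using T(1) by (metis inj_matrix_vector_mult invertible_det_nz inj_on_subset subset_UNIV)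
  ultimately show ?thesis by (rule finite_imageD)
qed

text \<open>As \<open>A *v y\<close> is integral, \<open>z \<bullet> y\<close> depends modulo integers only on the digit that represents \<open>z\<close>, and
  for \<open>y\<close> in \<open>P\<close> all digits give the same value. So the value is that of \<open>z = 0\<close>.\<close>

lemma P_A_int_vecs:
  assumes y: "y \<in> P" and Ay: "A *v y \<in> int_vecs"
  shows "y \<in> int_vecs"
proof -
  obtain d0 where d0: "d0 \<in> D" using D_nonempty by blast
  have diff: "z \<bullet> y - d0 \<bullet> y \<in> \<int>" if z: "z \<in> int_vecs" for z
  proof -
    obtain d w where d: "d \<in> D" "w \<in> int_vecs" "z = d + B *v w" by (rule representative_exists[OF z])
    have "(d - d0) \<bullet> ((*v) A ^^ 0) y \<in> \<int>" using y d(1) d0 unfolding P_iff by blast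
    moreover have "w \<bullet> (A *v y) \<in> \<int>" using d(2) Ay by (rule inner_int_vecs)
    moreover have "z \<bullet> y - d0 \<bullet> y = (d - d0) \<bullet> y + w \<bullet> (A *v y)"
      by (simp add: d(3) inner_add_left inner_diff_left inner_B)
    ultimately show ?thesis by simp
  qed
  have "z \<bullet> y \<in> \<int>" if "z \<in> int_vecs" for z
    using Ints_diff[OF diff[OF that] diff[OF int_vecs_0]] by simp
  then show ?thesis using int_vecs_iff_inner by blast
qed

text \<open>By \<open>P_A_int_vecs\<close> the map \<open>A\<close> is injective on the finite group \<open>P\<close> modulo integer vectors, hence
  surjective.\<close>

lemma P_A_surj_mod_int_vecs:
  assumes x: "x \<in> P"
  obtains y z where "y \<in> P" "z \<in> int_vecs" "x = A *v y + z"
proof -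
  let ?F = "fpart ` P" and ?f = "\<lambda>y. fpart (A *v y)"
  have fP: "fpart y \<in> P" if "y \<in> P" for y
    using P_diff[OF that, of "y - fpart y"] int_vecs_subset_P fpart_diff[of y] by auto
  have idem: "fpart (fpart y) = fpart y" for y :: "real^'n"
    by (simp add: fpart_def)
  have "bounded ?F" using compact_imp_bounded[OF compact_unit_cube] fpart_in_cube by (auto intro: bounded_subset)
  then have "finite ?F" using fP by (intro finite_P_bounded) auto
  moreover have "?f ` ?F \<subseteq> ?F" using fP P_A by blast
  moreover have "inj_on ?f ?F"
  proof (rule inj_onI)
    fix y y' assume y: "y \<in> ?F" "y' \<in> ?F" "?f y = ?f y'"
    have "A *v (y - y') \<in> int_vecs"
      using fpart_eq_imp[OF y(3)] by (simp add: matrix_vector_mult_diff_distrib)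
    moreover have "y - y' \<in> P" using y fP by (auto intro: P_diff)
    ultimately have "y - y' \<in> int_vecs" by (rule P_A_int_vecs[rotated])
    then have "fpart (y' + (y - y')) = fpart y'" by (rule fpart_add_int)
    then have "fpart y = fpart y'" by simp
    moreover have "fpart y = y" "fpart y' = y'" using y(1,2) idem by force+
    ultimately show "y = y'" by simp
  qed
  ultimately have "?f ` ?F = ?F" by (simp add: endo_inj_surj)
  then obtain y where y: "y \<in> ?F" "fpart x = ?f y" using x by blast
  have "x - A *v y \<in> int_vecs" by (rule fpart_eq_imp[OF y(2)])
  moreover have "y \<in> P" using y(1) fP by auto
  ultimately show ?thesis by (intro that[of y "x - A *v y"]) auto
qed

lemma P_preimage:
  assumes x: "x \<in> P"
  shows "\<exists>l\<in>L. Ai *v (x + l) \<in> P"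
proof -
  obtain y z where y: "y \<in> P" "z \<in> int_vecs" "x = A *v y + z" by (rule P_A_surj_mod_int_vecs[OF x])
  obtain l where l: "l \<in> L" "Ai *v (z + l) \<in> int_vecs" by (rule L_representative_exists[OF y(2)])
  have "Ai *v (x + l) = y + Ai *v (z + l)"
    by (simp add: y(3) matrix_vector_right_distrib add.assoc)
  also have "\<dots> \<in> P" using y(1) l(2) int_vecs_subset_P by (intro P_add) auto
  finally show ?thesis using l(1) by blast
qed

text \<open>Modulo integer vectors, \<open>A\<close> runs through the cycle backwards.\<close>

lemma extreme_cycle_subset_P:
  assumes "extreme_cycle A D L C"
  shows "C \<subseteq> P"
proof -
  obtain p x l where p: "0 < (p::nat)" "C = x ` {..<p}" "\<forall>i<p. l i \<in> L"
      "\<forall>i. Suc i < p \<longrightarrow> sigma_map A (l i) (x i) = x (Suc i)"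
      "sigma_map A (l (p - 1)) (x (p - 1)) = x 0"
    using assms unfolding extreme_cycle_def is_cycle_def by blast
  have step: "\<exists>c'\<in>C. A *v c - c' \<in> int_vecs" if c: "c \<in> C" for c
  proof -
    obtain j where j: "j < p" "c = x j" using c p(2) by auto
    define i where "i = (if j = 0 then p - 1 else j - 1)"
    have i: "i < p" using j by (auto simp: i_def)
    have "c = Ai *v (x i + l i)"
    proof (cases j)
      case 0
      then show ?thesis using p(5) j by (simp add: i_def sigma_map_def)
    next
      case (Suc j')
      then show ?thesis using p(4) j by (simp add: i_def sigma_map_def)
    qed
    then have "A *v c - x i = l i" by simp
    then show ?thesis using i p L_int by (intro bexI[of _ "x i"]) auto
  qed
  have orbit: "\<exists>c'\<in>C. ((*v) A ^^ k) c - c' \<in> int_vecs" if "c \<in> C" for c k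
  proof (induction k)
    case 0
    show ?case using that by (intro bexI[of _ c]) auto
  next
    case (Suc k)
    then obtain c' where c': "c' \<in> C" "((*v) A ^^ k) c - c' \<in> int_vecs" by blast
    obtain c'' where c'': "c'' \<in> C" "A *v c' - c'' \<in> int_vecs" using step[OF c'(1)] by blast
    have "((*v) A ^^ Suc k) c - c'' = A *v (((*v) A ^^ k) c - c') + (A *v c' - c'')"
      by (simp add: matrix_vector_mult_diff_distrib)
    also have "\<dots> \<in> int_vecs" using A_int_vecs[OF c'(2)] c''(2) by (rule int_vecs_add)
    finally show ?case using c''(1) by blast
  qed
  show ?thesis
  proof
    fix c assume "c \<in> C"
    have "cmod (m (((*v) A ^^ k) c)) = 1" for k
    proof -
      obtain c' where c': "c' \<in> C" "((*v) A ^^ k) c - c' \<in> int_vecs" using orbit[OF \<open>c \<in> C\<close>] by blast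
      then have "m (((*v) A ^^ k) c) = m c'" using mask_periodic[OF c'(2), of c'] by simp
      then show ?thesis using assms c'(1) by (simp add: extreme_cycle_def)
    qed
    then show "c \<in> P" by (simp add: P_def)
  qed
qed

lemma admissible_P: "admissible_lattice A D L P"
  unfolding admissible_lattice_def
  using is_lattice_P extreme_cycle_subset_P P_minus P_add P_A L_int int_vecs_subset_P by blast

text \<open>The steps \<open>x \<mapsto> Ai *v (x + s x)\<close> inside \<open>P\<close> have bounded orbits, so every orbit runs into a cycle, which
  is extreme since it lies in \<open>P\<close>. An admissible lattice contains the negative of the cycle, and its invariance
  under \<open>x \<mapsto> A *v x + l\<close> leads back along the orbit.\<close>

lemma P_subset_admissible:
  assumes adm: "admissible_lattice A D L \<Lambda>"
  shows "P \<subseteq> \<Lambda>"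
proof -
  have cyc: "\<And>C. extreme_cycle A D L C \<Longrightarrow> uminus ` C \<subseteq> \<Lambda>"
    and inv: "\<And>l x. l \<in> L \<Longrightarrow> x \<in> \<Lambda> \<Longrightarrow> A *v x + l \<in> \<Lambda>"
    using adm unfolding admissible_lattice_def image_subset_iff by blast+
  obtain s where s: "\<And>x. x \<in> P \<Longrightarrow> s x \<in> L \<and> Ai *v (x + s x) \<in> P" using P_preimage by metis
  have "- x \<in> \<Lambda>" if x: "x \<in> P" for x
  proof -
    define R where "R = (\<lambda>x. Ai *v (x + s x))"
    define y where "y = (\<lambda>k. (R ^^ k) x)"
    have yP: "y k \<in> P" for k by (induction k) (use x s in \<open>auto simp: y_def R_def\<close>)
    have ySuc: "y (Suc k) = Ai *v (y k + s (y k))" for k by (simp add: y_def R_def)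
    have descend: "- y k \<in> \<Lambda>" if "- y (Suc k) \<in> \<Lambda>" for k
    proof -
      have "A *v y (Suc k) = y k + s (y k)" by (simp add: ySuc)
      then have "A *v (- y (Suc k)) + s (y k) = - y k" by (simp add: linear_neg)
      then show ?thesis using inv[of "s (y k)", OF _ that] s[OF yP] by simp
    qed
    obtain c C where c: "c > 0" "\<And>x. c * norm x \<le> cmod (\<phi> x)" by (rule \<phi>_bounds) blast
    define K where "K = (\<Sum>l\<in>L. cmod (\<phi> l))"
    have K: "cmod (\<phi> l) \<le> K" if "l \<in> L" for l
      unfolding K_def using that finite_L by (intro member_le_sum) auto
    have K0: "K \<ge> 0" unfolding K_def by (intro sum_nonneg) auto
    \<comment> \<open>\<open>K / (r - 1)\<close> is the fixed point of \<open>t \<mapsto> (t + K) / r\<close>, so bounds above this value are preserved\<close>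
    define b where "b = cmod (\<phi> x) + K / (r - 1)"
    have bnd: "cmod (\<phi> (y k)) \<le> b" for k
    proof (induction k)
      case 0
      then show ?case using K0 r_gt_1 by (simp add: y_def b_def)
    next
      case (Suc k)
      have "cmod (\<phi> (y (Suc k))) = cmod (\<phi> (y k) + \<phi> (s (y k))) / r"
        by (simp add: ySuc norm_\<phi>_Ai linear_add[OF linear_\<phi>])
      also have "\<dots> \<le> (b + K) / r"
        using norm_triangle_ineq[of "\<phi> (y k)" "\<phi> (s (y k))"] Suc K[of "s (y k)"] s[OF yP] r_gt_1
        by (intro divide_right_mono) auto
      also have "\<dots> \<le> b"
      proof -
        have "K / (r - 1) \<le> b" by (simp add: b_def)
        then have "K \<le> b * (r - 1)" using r_gt_1 by (simp add: pos_divide_le_eq)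
        then show ?thesis using r_gt_1 by (simp add: pos_divide_le_eq algebra_simps)
      qed
      finally show ?case .
    qed
    have "norm (y k) \<le> b / c" for k
      using bnd[of k] c(2)[of "y k"] c(1) by (simp add: pos_le_divide_eq mult.commute)
    then have "bounded (range y)" by (auto simp: bounded_iff)
    then have "finite (range y)" using yP by (intro finite_P_bounded) auto
    then have "\<not> inj y" using finite_imageD infinite_UNIV_nat by blast
    \<comment> \<open>a repetition in the orbit closes a cycle\<close>
    then obtain i j where ij: "i < j" "y i = y j"
      by (metis injI linorder_neqE_nat)
    have "sigma_map A (s (y (j - 1))) (y (j - 1)) = y i"
      using ij ySuc[of "j - 1"] by (simp add: sigma_map_def)
    moreover have "i + (j - i - 1) = j - 1" using ij(1) by simp
    ultimately have "is_cycle A L ((\<lambda>k. y (i + k)) ` {..<j - i})"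
      unfolding is_cycle_def using ij(1) s[OF yP]
      by (intro exI[of _ "j - i"] exI[of _ "\<lambda>k. y (i + k)"] exI[of _ "\<lambda>k. s (y (i + k))"])
         (simp add: sigma_map_def ySuc)
    then have "extreme_cycle A D L ((\<lambda>k. y (i + k)) ` {..<j - i})"
      unfolding extreme_cycle_def using P_mask yP by auto
    then have "uminus ` ((\<lambda>k. y (i + k)) ` {..<j - i}) \<subseteq> \<Lambda>" by (rule cyc)
    then have "- y i \<in> \<Lambda>" using ij(1) by (auto simp: image_subset_iff dest: bspec[of _ _ 0])
    moreover have "- y k \<in> \<Lambda> \<longrightarrow> - y 0 \<in> \<Lambda>" for k
      by (induction k) (auto dest: descend)
    ultimately have "- y 0 \<in> \<Lambda>" by blast
    then show ?thesis by (simp add: y_def)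
  qed
  then show ?thesis using P_minus by (metis minus_minus subsetI)
qed

lemma smallest_admissible_iff: "smallest_admissible_lattice A D L \<Lambda> \<longleftrightarrow> \<Lambda> = P"
  unfolding smallest_admissible_lattice_def using admissible_P P_subset_admissible by blast

section \<open>Sets invariant under the inverse branches\<close>

text \<open>Invariance under the inverse branches \<open>x \<mapsto> Ai *v (x + l)\<close> at whose values the mask does not vanish, together
  with integer periodicity. The mask is integer periodic, so all integer vectors \<open>l\<close> can be treated alike.\<close>

definition invariant_set :: "(real^'n) set \<Rightarrow> bool" where
  "invariant_set N \<longleftrightarrow> N \<noteq> {} \<and> (\<forall>x\<in>N. \<forall>z\<in>int_vecs. x + z \<in> N) \<and> (\<forall>x. A *v x \<in> N \<longrightarrow> m x \<noteq> 0 \<longrightarrow> x \<in> N)"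

lemma invariant_periodic: "invariant_set N \<Longrightarrow> z \<in> int_vecs \<Longrightarrow> x + z \<in> N \<longleftrightarrow> x \<in> N"
proof -
  assume N: "invariant_set N" and z: "z \<in> int_vecs"
  have per: "\<And>x z. x \<in> N \<Longrightarrow> z \<in> int_vecs \<Longrightarrow> x + z \<in> N" using N by (simp add: invariant_set_def)
  show ?thesis using per[of x z] per[of "x + z" "- z"] z by auto
qed

lemma invariant_fpart: "invariant_set N \<Longrightarrow> fpart x \<in> N \<longleftrightarrow> x \<in> N"
  using invariant_periodic[OF _ fpart_diff, of N "fpart x" x] by simp

lemma invariant_pullback: "invariant_set N \<Longrightarrow> A *v x \<in> N \<Longrightarrow> m x \<noteq> 0 \<Longrightarrow> x \<in> N"
  by (simp add: invariant_set_def)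

lemma exists_nonzero_preimage: "\<exists>l\<in>L. m (Ai *v (x + l)) \<noteq> 0"
proof (rule ccontr)
  assume "\<not> ?thesis"
  then have "(\<Sum>l\<in>L. (cmod (m (Ai *v (x + l))))\<^sup>2) = 0" by simp
  then show False using sum_mask_square[of x] by simp
qed

text \<open>Sum the identity \<open>sum_mask_square\<close> over representatives of \<open>N\<close>. Every representative receives weight at
  most 1 and the total weight equals their number, so the mask has modulus 1 on \<open>N\<close> and every point of \<open>N\<close> is
  hit, that is, \<open>A\<close> maps \<open>N\<close> into itself. So the whole of \<open>N\<close> lies in \<open>P\<close>.\<close>

lemma finite_invariant_meets_P:
  assumes N: "invariant_set N" and fin: "finite (N \<inter> unit_cube)"
  shows "\<exists>x\<in>N. x \<in> P"
proof -
  define F where "F = fpart ` N"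
  have FN: "F \<subseteq> N" using invariant_fpart[OF N] by (auto simp: F_def)
  have finF: "finite F" using FN fpart_in_cube by (intro finite_subset[OF _ fin]) (auto simp: F_def)
  have fF: "fpart y = y" if "y \<in> F" for y using that by (auto simp: F_def fpart_def vec_eq_iff)
  define g where "g = (\<lambda>(x, l). fpart (Ai *v (x + l)))"
  define S where "S = {p \<in> F \<times> L. m (g p) \<noteq> 0}"
  have mg: "m (g (x, l)) = m (Ai *v (x + l))" for x l
    using mask_periodic[OF fpart_diff, of "fpart (Ai *v (x + l))" "Ai *v (x + l)"] by (simp add: g_def)
  have finS: "finite S" using finF finite_L by (simp add: S_def)
  have gS: "g p \<in> F" if pS: "p \<in> S" for p
  proof -
    obtain x l where p: "p = (x, l)" "x \<in> F" "l \<in> L" "m (Ai *v (x + l)) \<noteq> 0"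
      using pS mg by (auto simp: S_def)
    have "x + l \<in> N" using p FN L_int invariant_periodic[OF N] by auto
    then have "Ai *v (x + l) \<in> N" using invariant_pullback[OF N, of "Ai *v (x + l)"] p(4) by simp
    then show ?thesis by (simp add: g_def p(1) F_def)
  qed
  have inj: "inj_on g (F \<times> L)"
  proof (rule inj_onI, clarify)
    fix x l x' l' assume x: "x \<in> F" "l \<in> L" "x' \<in> F" "l' \<in> L" "g (x, l) = g (x', l')"
    then have *: "Ai *v (x + l) - Ai *v (x' + l') \<in> int_vecs"
      using fpart_eq_imp by (simp add: g_def)
    then have "A *v (Ai *v (x + l) - Ai *v (x' + l')) \<in> int_vecs" by (rule A_int_vecs)
    then have "(x + l) - (x' + l') \<in> int_vecs" by (simp only: matrix_vector_mult_diff_distrib A_Ai)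
    moreover have "l' - l \<in> int_vecs" using x L_int by auto
    ultimately have "((x + l) - (x' + l')) + (l' - l) \<in> int_vecs" by (rule int_vecs_add)
    then have "x - x' \<in> int_vecs" by (simp add: algebra_simps)
    then have "fpart (x' + (x - x')) = fpart x'" by (rule fpart_add_int)
    then have xx: "x = x'" using fF x by simp
    have "Ai *v (l - l') \<in> int_vecs"
      using * by (simp add: xx matrix_vector_right_distrib matrix_vector_mult_diff_distrib)
    then show "x = x' \<and> l = l'" using L_representative_unique x xx by blast
  qed
  have "real (card F) = (\<Sum>x\<in>F. \<Sum>l\<in>L. (cmod (m (g (x, l))))\<^sup>2)"
    by (simp add: mg sum_mask_square)
  also have "\<dots> = (\<Sum>p\<in>F \<times> L. (cmod (m (g p)))\<^sup>2)"
    by (simp add: sum.cartesian_product split_def)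
  also have "\<dots> = (\<Sum>p\<in>S. (cmod (m (g p)))\<^sup>2)"
    using finF finite_L by (intro sum.mono_neutral_right) (auto simp: S_def)
  also have "\<dots> = (\<Sum>y\<in>g ` S. (cmod (m y))\<^sup>2)"
    by (subst sum.reindex) (auto intro: inj_on_subset[OF inj] simp: S_def)
  finally have card: "real (card F) = (\<Sum>y\<in>g ` S. (cmod (m y))\<^sup>2)" .
  have le: "(cmod (m y))\<^sup>2 \<le> 1" for y using norm_mask_le_1[of y] by (simp add: power_le_one)
  have gSF: "g ` S \<subseteq> F" using gS by auto
  have "(\<Sum>y\<in>g ` S. (cmod (m y))\<^sup>2) \<le> (\<Sum>y\<in>F. (cmod (m y))\<^sup>2)"
    using finF gSF by (intro sum_mono2) auto
  then have "(\<Sum>y\<in>F. 1 - (cmod (m y))\<^sup>2) \<le> 0" using card by (simp add: sum_subtractf)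
  then have "(\<Sum>y\<in>F. 1 - (cmod (m y))\<^sup>2) = 0" using le by (intro antisym sum_nonneg) auto
  then have sq: "(cmod (m y))\<^sup>2 = 1" if "y \<in> F" for y
    using that finF le by (subst (asm) sum_nonneg_eq_0_iff) auto
  have one: "cmod (m y) = 1" if "y \<in> F" for y
    using sq[OF that] by (metis abs_norm_cancel abs_square_eq_1)
  have "real (card F) = real (card (g ` S))" using card sq gSF by (simp add: subset_iff)
  then have surj: "g ` S = F" using finF gSF by (intro card_subset_eq) auto
  have AF: "A *v y \<in> N" if yF: "y \<in> F" for y
  proof -
    have "y \<in> g ` S" using yF surj by simp
    then obtain x l where x: "x \<in> F" "l \<in> L" "y = fpart (Ai *v (x + l))"
      by (auto simp: S_def g_def)
    have "A *v (Ai *v (x + l) - y) \<in> int_vecs" unfolding x(3) by (intro A_int_vecs fpart_diff)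
    then have "x + l - A *v y \<in> int_vecs" by (simp add: matrix_vector_mult_diff_distrib)
    then have "A *v y + (x + l - A *v y) \<in> N \<longleftrightarrow> A *v y \<in> N" by (rule invariant_periodic[OF N])
    moreover have "x + l \<in> N" using x FN L_int invariant_periodic[OF N] by auto
    ultimately show ?thesis by simp
  qed
  have mN: "cmod (m w) = 1" and AN: "A *v w \<in> N" if "w \<in> N" for w
  proof -
    have f: "fpart w \<in> F" using that by (simp add: F_def)
    then show "cmod (m w) = 1" using one mask_periodic[OF fpart_diff, of "fpart w" w] by fastforce
    have "A *v fpart w + A *v (w - fpart w) \<in> N"
      using invariant_periodic[OF N A_int_vecs[OF fpart_diff]] AF[OF f] by blast
    then show "A *v w \<in> N" by (simp add: matrix_vector_mult_diff_distrib)
  qed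
  obtain w where w: "w \<in> N" using N by (auto simp: invariant_set_def)
  have "((*v) A ^^ k) w \<in> N" for k by (induction k) (use w AN in auto)
  then have "w \<in> P" by (simp add: P_def mN)
  with w show ?thesis by blast
qed

lemma invariant_closure:
  assumes N: "invariant_set N"
  shows "invariant_set (closure N)"
  unfolding invariant_set_def
proof (intro conjI ballI allI impI)
  show "closure N \<noteq> {}" using N by (auto simp: invariant_set_def)
next
  fix x z :: "real^'n" assume x: "x \<in> closure N" and z: "z \<in> int_vecs"
  obtain f where f: "\<And>n. f n \<in> N" "f \<longlonglongrightarrow> x" using x by (auto simp: closure_sequential)
  have "(\<lambda>n. f n + z) \<longlonglongrightarrow> x + z" by (intro tendsto_intros f)
  moreover have "f n + z \<in> N" for n using f(1) invariant_periodic[OF N z] by blast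
  ultimately show "x + z \<in> closure N"
    unfolding closure_sequential by (intro exI[of _ "\<lambda>n. f n + z"]) simp
next
  fix x assume x: "A *v x \<in> closure N" and mx: "m x \<noteq> 0"
  obtain f where f: "\<And>n. f n \<in> N" "f \<longlonglongrightarrow> A *v x" using x by (auto simp: closure_sequential)
  define g where "g = (\<lambda>n. Ai *v f n)"
  have "isCont (\<lambda>x. Ai *v x) (A *v x)" by (simp add: linear_continuous_at linear_linear)
  then have "g \<longlonglongrightarrow> Ai *v (A *v x)" unfolding g_def using f(2) by (rule isCont_tendsto_compose)
  then have g: "g \<longlonglongrightarrow> x" by simp
  have "isCont m x" using continuous_on_mask[of UNIV] by (simp add: continuous_on_eq_continuous_at)
  then have "(\<lambda>n. m (g n)) \<longlonglongrightarrow> m x" using g by (rule isCont_tendsto_compose)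
  then have "eventually (\<lambda>n. m (g n) \<noteq> 0) sequentially" using mx by (rule tendsto_imp_eventually_ne)
  then have ev: "eventually (\<lambda>n. g n \<in> closure N) sequentially"
  proof (rule eventually_mono)
    fix n assume "m (g n) \<noteq> 0"
    moreover have "A *v g n \<in> N" using f(1) by (simp add: g_def)
    ultimately show "g n \<in> closure N" using invariant_pullback[OF N] closure_subset by blast
  qed
  show "x \<in> closure N"
    by (rule Lim_in_closed_set[OF closed_closure ev _ g]) simp
qed

text \<open>Among all closed invariant subsets and all nonzero sums vanishing on them, take a sum with the least number
  of frequencies. On \<open>N\<close>, subtracting a multiple of the sum from its derivative in the direction \<open>u\<close> changes
  nothing but removes one frequency; so the derivative can vanish on no closed invariant subset of \<open>N\<close>.\<close>

lemma minimal_vanishing_sum: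
  assumes M: "invariant_set M" "closed M"
    and I: "finite I" "i \<in> I" "c i \<noteq> 0" "\<And>x. x \<in> M \<Longrightarrow> expsum I c (\<lambda>n. n) x = 0"
  obtains N S b u where "closed N" "invariant_set N" "N \<subseteq> M"
    "\<And>x. x \<in> N \<Longrightarrow> expsum S b (\<lambda>n. n) x = 0"
    "\<And>N'. closed N' \<Longrightarrow> invariant_set N' \<Longrightarrow> N' \<subseteq> N \<Longrightarrow>
        \<exists>x\<in>N'. expsum S (\<lambda>n. b n * complex_of_real (n \<bullet> u)) (\<lambda>n. n) x \<noteq> 0"
proof -
  define ok where "ok = (\<lambda>k N S b. closed N \<and> invariant_set N \<and> N \<subseteq> M \<and> finite S \<and> card S = k \<and> S \<noteq> {} \<and>
     (\<forall>n\<in>S. b n \<noteq> 0) \<and> (\<forall>x\<in>N. expsum S b (\<lambda>n::real^'n. n) x = 0))"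
  have restrict: "expsum {n\<in>J. a n \<noteq> 0} a (\<lambda>n::real^'n. n) x = expsum J a (\<lambda>n. n) x" if "finite J" for J a x
    unfolding expsum_def using that by (intro sum.mono_neutral_left) auto
  have "ok (card {n\<in>I. c n \<noteq> 0}) M {n\<in>I. c n \<noteq> 0} c"
    unfolding ok_def using M I by (auto simp: restrict)
  then have "\<exists>k N S b. ok k N S b" by blast
  define k where "k = (LEAST k. \<exists>N S b. ok k N S b)"
  have "\<exists>N S b. ok k N S b" unfolding k_def by (rule LeastI_ex) fact
  then obtain N S b where ok: "ok k N S b" by blast
  have least: "k \<le> j" if "ok j N' S' b'" for j N' S' b'
    unfolding k_def using that by (intro Least_le) blast
  from ok have N: "closed N" "invariant_set N" "N \<subseteq> M" and S: "finite S" "card S = k" "S \<noteq> {}"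
    and b: "\<And>n. n \<in> S \<Longrightarrow> b n \<noteq> 0" and van: "\<And>x. x \<in> N \<Longrightarrow> expsum S b (\<lambda>n. n) x = 0"
    by (auto simp: ok_def)
  obtain n0 where n0: "n0 \<in> S" using S(3) by blast
  have "\<exists>n1\<in>S. n1 \<noteq> n0"
  proof (rule ccontr)
    assume "\<not> ?thesis"
    then have Sn0: "S = {n0}" using n0 by blast
    have "N \<noteq> {}" using N(2) unfolding invariant_set_def by blast
    then obtain x where "x \<in> N" by blast
    then have "b n0 * echar (n0 \<bullet> x) = 0" using van[of x] unfolding Sn0 expsum_def by simp
    then show False using b[OF n0] by simp
  qed
  then obtain n1 where n1: "n1 \<in> S" "n1 \<noteq> n0" by blast
  define u where "u = n1 - n0"
  have nz: "\<exists>x\<in>N'. expsum S (\<lambda>n. b n * complex_of_real (n \<bullet> u)) (\<lambda>n. n) x \<noteq> 0"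
    if N': "closed N'" "invariant_set N'" "N' \<subseteq> N" for N'
  proof (rule ccontr)
    assume "\<not> ?thesis"
    then have z: "expsum S (\<lambda>n. b n * complex_of_real (n \<bullet> u)) (\<lambda>n. n) x = 0" if "x \<in> N'" for x
      using that by blast
    \<comment> \<open>on \<open>N'\<close> the coefficients \<open>b'\<close> give a vanishing sum without the frequency \<open>n0\<close>\<close>
    define b' where "b' = (\<lambda>n. b n * complex_of_real ((n - n0) \<bullet> u))"
    define S' where "S' = {n\<in>S. b' n \<noteq> 0}"
    have "expsum S' b' (\<lambda>n. n) x = 0" if "x \<in> N'" for x
    proof -
      have "expsum S b' (\<lambda>n. n) x = expsum S (\<lambda>n. b n * complex_of_real (n \<bullet> u)) (\<lambda>n. n) x
          - complex_of_real (n0 \<bullet> u) * expsum S b (\<lambda>n. n) x"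
        by (simp add: expsum_def b'_def inner_diff_left algebra_simps sum_subtractf sum_distrib_left)
      then show ?thesis using z[OF that] van[of x] that N'(3) restrict[OF S(1), of b' x] by (auto simp: S'_def)
    qed
    moreover have "n1 \<in> S'" using n1 b[OF n1(1)] by (simp add: S'_def b'_def u_def)
    ultimately have "ok (card S') N' S' b'"
      unfolding ok_def using N' N(3) S(1) by (auto simp: S'_def)
    then have "k \<le> card S'" by (rule least)
    moreover have "n0 \<notin> S'" "S' \<subseteq> S" by (auto simp: S'_def b'_def)
    then have "S' \<subset> S" using n0 by blast
    then have "card S' < card S" using S(1) by (rule psubset_card_mono[rotated])
    ultimately show False using S(2) by simp
  qed
  show ?thesis by (rule that[OF N van nz])
qed

text \<open>All of \<open>N\<close> within distance \<open>\<epsilon>\<close> of \<open>z\<close> is carried into \<open>N\<close> by the affine map with linear part \<open>Ai\<^sup>k\<close>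
  that sends \<open>z\<close> to \<open>y\<close>; such maps arise from \<open>k\<close> successive inverse branches. The distance is measured by \<open>cmod \<circ> \<phi>\<close>, which \<open>Ai\<close> decreases; therefore
  one radius serves for compositions of any length.\<close>

definition transports :: "(real^'n) set \<Rightarrow> real \<Rightarrow> real^'n \<Rightarrow> nat \<Rightarrow> real^'n \<Rightarrow> bool" where
  "transports N \<epsilon> z k y \<longleftrightarrow>
     (\<forall>\<delta>. cmod (\<phi> \<delta>) < \<epsilon> \<longrightarrow> z + \<delta> \<in> N \<longrightarrow> y + ((*v) Ai ^^ k) \<delta> \<in> N)"

lemma norm_\<phi>_iterate_le: "cmod (\<phi> (((*v) Ai ^^ k) x)) \<le> cmod (\<phi> x)"
proof -
  have "cmod (\<phi> x) / r ^ k \<le> cmod (\<phi> x) / 1"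
    using r_gt_1 by (intro divide_left_mono) auto
  then show ?thesis by (simp add: norm_\<phi>_Ai_iterate)
qed

lemma transports_compose:
  assumes "transports N \<epsilon> z k y" "transports N \<epsilon> y j x"
  shows "transports N \<epsilon> z (j + k) x"
  unfolding transports_def
proof (intro allI impI)
  fix \<delta> assume d: "cmod (\<phi> \<delta>) < \<epsilon>" "z + \<delta> \<in> N"
  have "y + ((*v) Ai ^^ k) \<delta> \<in> N" using assms(1) d unfolding transports_def by blast
  moreover have "cmod (\<phi> (((*v) Ai ^^ k) \<delta>)) < \<epsilon>" using norm_\<phi>_iterate_le[of k \<delta>] d(1) by simp
  ultimately have "x + ((*v) Ai ^^ j) (((*v) Ai ^^ k) \<delta>) \<in> N" using assms(2) unfolding transports_def by blast
  then show "x + ((*v) Ai ^^ (j + k)) \<delta> \<in> N" by (simp add: funpow_add)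
qed

lemma transports_mono: "transports N \<epsilon> z k y \<Longrightarrow> \<epsilon>' \<le> \<epsilon> \<Longrightarrow> transports N \<epsilon>' z k y"
  unfolding transports_def by force

lemma transports_mem:
  assumes "transports N \<epsilon> z k y" "\<epsilon> > 0" "z \<in> N"
  shows "y \<in> N"
proof -
  have "cmod (\<phi> 0) < \<epsilon>" using assms(2) linear_0[OF linear_\<phi>] by simp
  moreover have "z + 0 \<in> N" using assms(3) by simp
  ultimately have "y + ((*v) Ai ^^ k) 0 \<in> N" using assms(1) unfolding transports_def by blast
  then show ?thesis by (simp add: linear_0[OF linear_iterate])
qed

lemma \<phi>_small: assumes "e > 0" obtains \<epsilon> where "\<epsilon> > 0" "\<And>x. cmod (\<phi> x) < \<epsilon> \<Longrightarrow> norm x < e"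
proof -
  obtain c C where c: "c > 0" "\<And>x. c * norm x \<le> cmod (\<phi> x)" by (rule \<phi>_bounds) blast
  show ?thesis
  proof (rule that[of "c * e"])
    show "c * e > 0" using c(1) assms by simp
    fix x assume "cmod (\<phi> x) < c * e"
    then have "c * norm x < c * e" using c(2)[of x] by simp
    then show "norm x < e" using c(1) by simp
  qed
qed

text \<open>The mask stays nonzero near \<open>y\<close>.\<close>

lemma transports_step:
  assumes N: "invariant_set N" and y: "m y \<noteq> 0"
  shows "\<exists>\<epsilon>>0. transports N \<epsilon> (A *v y) 1 y"
proof -
  have "isCont m y" using continuous_on_mask[of UNIV] by (simp add: continuous_on_eq_continuous_at)
  then obtain e where e: "e > 0" "\<And>x. dist x y < e \<Longrightarrow> m x \<noteq> 0"
    using continuous_at_avoid[of y m 0] y by (metis dist_commute)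
  obtain \<epsilon> where \<epsilon>: "\<epsilon> > 0" "\<And>x. cmod (\<phi> x) < \<epsilon> \<Longrightarrow> norm x < e" by (rule \<phi>_small[OF e(1)]) blast
  have "transports N \<epsilon> (A *v y) 1 y"
    unfolding transports_def
  proof (intro allI impI)
    fix \<delta> assume d: "cmod (\<phi> \<delta>) < \<epsilon>" "A *v y + \<delta> \<in> N"
    have "cmod (\<phi> (Ai *v \<delta>)) < \<epsilon>" using norm_\<phi>_iterate_le[of 1 \<delta>] d(1) by simp
    then have "m (y + Ai *v \<delta>) \<noteq> 0" using e(2)[of "y + Ai *v \<delta>"] \<epsilon>(2) by (simp add: dist_norm)
    moreover have "A *v (y + Ai *v \<delta>) \<in> N" using d(2) by (simp add: matrix_vector_right_distrib)
    ultimately show "y + ((*v) Ai ^^ 1) \<delta> \<in> N" using invariant_pullback[OF N] by simp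
  qed
  then show ?thesis using \<epsilon>(1) by blast
qed

lemma transports_periodic:
  assumes N: "invariant_set N" and z: "z - z' \<in> int_vecs" and t: "transports N \<epsilon> z k y"
  shows "transports N \<epsilon> z' k y"
  unfolding transports_def
proof (intro allI impI)
  fix \<delta> assume d: "cmod (\<phi> \<delta>) < \<epsilon>" "z' + \<delta> \<in> N"
  have "(z' + \<delta>) + (z - z') \<in> N" using invariant_periodic[OF N z] d(2) by blast
  then have "z + \<delta> \<in> N" by (simp add: algebra_simps)
  then show "y + ((*v) Ai ^^ k) \<delta> \<in> N" using t d(1) unfolding transports_def by blast
qed

lemma transports_shift:
  assumes t: "transports N \<epsilon> z k y" and w: "cmod (\<phi> (z' - z)) < \<epsilon> / 2"
  shows "transports N (\<epsilon> / 2) z' k (y + ((*v) Ai ^^ k) (z' - z))"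
  unfolding transports_def
proof (intro allI impI)
  fix \<delta> assume d: "cmod (\<phi> \<delta>) < \<epsilon> / 2" "z' + \<delta> \<in> N"
  have "cmod (\<phi> ((z' - z) + \<delta>)) < \<epsilon>"
    using norm_triangle_ineq[of "\<phi> (z' - z)" "\<phi> \<delta>"] w d(1) by (simp add: linear_add[OF linear_\<phi>])
  moreover have "z + ((z' - z) + \<delta>) \<in> N" using d(2) by simp
  ultimately have "y + ((*v) Ai ^^ k) ((z' - z) + \<delta>) \<in> N" using t unfolding transports_def by blast
  then show "y + ((*v) Ai ^^ k) (z' - z) + ((*v) Ai ^^ k) \<delta> \<in> N"
    by (simp add: linear_add[OF linear_iterate] add.assoc)
qed

text \<open>The closure of the set of all \<open>y\<close> to which a neighbourhood of \<open>z\<close> is transported is an invariant subset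
  of \<open>N\<close>.\<close>

lemma reach_nonvanishing:
  assumes N: "closed N" "invariant_set N" and z: "z \<in> N"
    and nz: "\<And>N'. closed N' \<Longrightarrow> invariant_set N' \<Longrightarrow> N' \<subseteq> N \<Longrightarrow> \<exists>x\<in>N'. g x \<noteq> 0"
    and g: "continuous_on UNIV (g :: real^'n \<Rightarrow> complex)"
  shows "\<exists>k\<ge>1. \<exists>y. \<exists>\<epsilon>>0. transports N \<epsilon> z k y \<and> g y \<noteq> 0"
proof -
  define R where "R = {y. \<exists>k\<ge>1. \<exists>\<epsilon>>0. transports N \<epsilon> z k y}"
  have RN: "R \<subseteq> N" using transports_mem z by (auto simp: R_def)
  have "invariant_set R"
    unfolding invariant_set_def
  proof (intro conjI ballI allI impI)
    obtain l where l: "l \<in> L" "m (Ai *v (z + l)) \<noteq> 0" using exists_nonzero_preimage by blast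
    obtain \<epsilon> where e: "\<epsilon> > 0" "transports N \<epsilon> (A *v (Ai *v (z + l))) 1 (Ai *v (z + l))"
      using transports_step[OF N(2) l(2)] by blast
    have "transports N \<epsilon> z 1 (Ai *v (z + l))"
      by (rule transports_periodic[OF N(2) _ e(2)]) (use l(1) L_int in auto)
    then have "Ai *v (z + l) \<in> R" using e(1) unfolding R_def by blast
    then show "R \<noteq> {}" by blast
  next
    fix y w :: "real^'n" assume y: "y \<in> R" and w: "w \<in> int_vecs"
    obtain k \<epsilon> where k: "k \<ge> 1" "\<epsilon> > 0" "transports N \<epsilon> z k y" using y by (auto simp: R_def)
    have "transports N \<epsilon> z k (y + w)"
      unfolding transports_def
    proof (intro allI impI)
      fix \<delta> assume "cmod (\<phi> \<delta>) < \<epsilon>" "z + \<delta> \<in> N"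
      then have "y + ((*v) Ai ^^ k) \<delta> \<in> N" using k(3) unfolding transports_def by blast
      then have "(y + ((*v) Ai ^^ k) \<delta>) + w \<in> N" using invariant_periodic[OF N(2) w] by blast
      then show "y + w + ((*v) Ai ^^ k) \<delta> \<in> N" by (simp add: algebra_simps)
    qed
    then show "y + w \<in> R" using k unfolding R_def by blast
  next
    fix y assume y: "A *v y \<in> R" and my: "m y \<noteq> 0"
    obtain k \<epsilon> where k: "k \<ge> 1" "\<epsilon> > 0" "transports N \<epsilon> z k (A *v y)" using y by (auto simp: R_def)
    obtain \<epsilon>' where e: "\<epsilon>' > 0" "transports N \<epsilon>' (A *v y) 1 y"
      using transports_step[OF N(2) my] by blast
    have "transports N (min \<epsilon> \<epsilon>') z (1 + k) y"
      by (rule transports_compose[OF transports_mono[OF k(3)] transports_mono[OF e(2)]]) auto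
    then show "y \<in> R" using k(2) e(1) unfolding R_def by (intro CollectI exI[of _ "1 + k"] conjI exI[of _ "min \<epsilon> \<epsilon>'"]) auto
  qed
  then have "invariant_set (closure R)" by (rule invariant_closure)
  moreover have "closure R \<subseteq> N" using RN N(1) by (rule closure_minimal)
  ultimately obtain x where x: "x \<in> closure R" "g x \<noteq> 0" using nz[of "closure R"] by blast
  obtain f where f: "\<And>n. f n \<in> R" "f \<longlonglongrightarrow> x" using x(1) by (auto simp: closure_sequential)
  have "isCont g x" using g by (simp add: continuous_on_eq_continuous_at)
  then have "(\<lambda>n. g (f n)) \<longlonglongrightarrow> g x" using f(2) by (rule isCont_tendsto_compose)
  then have "eventually (\<lambda>n. g (f n) \<noteq> 0) sequentially" using x(2) by (rule tendsto_imp_eventually_ne)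
  then obtain n where "g (f n) \<noteq> 0" by (auto simp: eventually_sequentially)
  then show ?thesis using f(1)[of n] unfolding R_def by blast
qed

text \<open>A transport from a point also serves all nearby points, with half the radius; the unit cube is compact.\<close>

lemma uniform_reach:
  assumes N: "closed N" "invariant_set N"
    and nz: "\<And>N'. closed N' \<Longrightarrow> invariant_set N' \<Longrightarrow> N' \<subseteq> N \<Longrightarrow> \<exists>x\<in>N'. g x \<noteq> 0"
    and g: "continuous_on UNIV (g :: real^'n \<Rightarrow> complex)"
  shows "\<exists>\<rho>>0. \<forall>z\<in>N. \<exists>k\<ge>1. \<exists>y. transports N \<rho> z k y \<and> \<rho> \<le> cmod (g y)"
proof (rule ccontr)
  assume neg: "\<not> ?thesis"
  have "\<exists>z\<in>N \<inter> unit_cube. \<forall>k\<ge>1. \<forall>y. transports N \<rho> z k y \<longrightarrow> cmod (g y) < \<rho>" if pos: "\<rho> > 0" for \<rho>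
  proof -
    have "\<not> (\<forall>z\<in>N. \<exists>k\<ge>1. \<exists>y. transports N \<rho> z k y \<and> \<rho> \<le> cmod (g y))" using neg pos by blast
    then obtain z where z: "z \<in> N" "\<And>k y. k \<ge> 1 \<Longrightarrow> transports N \<rho> z k y \<Longrightarrow> cmod (g y) < \<rho>"
      unfolding not_le[symmetric] by blast
    show ?thesis
    proof (intro bexI[of _ "fpart z"] allI impI)
      fix k y assume k: "1 \<le> k" "transports N \<rho> (fpart z) k y"
      have "fpart z - z \<in> int_vecs" using int_vecs_minus[OF fpart_diff[of z]] by simp
      then have "transports N \<rho> z k y" using k(2) by (rule transports_periodic[OF N(2)])
      then show "cmod (g y) < \<rho>" using z(2) k(1) by blast
    qed (use z(1) invariant_fpart[OF N(2)] fpart_in_cube in blast)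
  qed
  then have "\<forall>n. \<exists>z. z \<in> N \<inter> unit_cube \<and>
      (\<forall>k\<ge>1. \<forall>y. transports N (inverse (real (Suc n))) z k y \<longrightarrow> cmod (g y) < inverse (real (Suc n)))"
    by (metis inverse_positive_iff_positive of_nat_0_less_iff zero_less_Suc)
  then obtain z where z: "\<And>n. z n \<in> N \<inter> unit_cube"
    "\<And>n k y. k \<ge> 1 \<Longrightarrow> transports N (inverse (real (Suc n))) (z n) k y \<Longrightarrow> cmod (g y) < inverse (real (Suc n))"
    by metis
  have "compact (N \<inter> unit_cube)" using N(1) compact_unit_cube by (rule closed_Int_compact)
  then obtain z0 s where z0: "z0 \<in> N \<inter> unit_cube" "strict_mono (s :: nat \<Rightarrow> nat)" "(z \<circ> s) \<longlonglongrightarrow> z0"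
    using z(1) unfolding compact_def by metis
  obtain k y \<epsilon> where k: "k \<ge> 1" "\<epsilon> > 0" "transports N \<epsilon> z0 k y" "g y \<noteq> 0"
    using reach_nonvanishing[OF N _ nz g, of z0] z0(1) by blast
  define w where "w = (\<lambda>n. z (s n) - z0)"
  have w0: "w \<longlonglongrightarrow> 0" using z0(3) unfolding w_def by (simp add: LIM_zero comp_def)
  have "isCont \<phi> 0" using linear_\<phi> by (simp add: linear_continuous_at linear_linear)
  then have "(\<lambda>n. \<phi> (w n)) \<longlonglongrightarrow> \<phi> 0" using w0 by (rule isCont_tendsto_compose)
  then have "(\<lambda>n. cmod (\<phi> (w n))) \<longlonglongrightarrow> 0" using linear_0[OF linear_\<phi>] tendsto_norm by fastforce
  then have ev1: "eventually (\<lambda>n. cmod (\<phi> (w n)) < \<epsilon> / 2) sequentially"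
    by (rule order_tendstoD) (use k(2) in simp)
  define y' where "y' = (\<lambda>n. y + ((*v) Ai ^^ k) (w n))"
  have "isCont ((*v) Ai ^^ k) 0" using linear_iterate[of k Ai] by (simp add: linear_continuous_at linear_linear)
  then have "(\<lambda>n. ((*v) Ai ^^ k) (w n)) \<longlonglongrightarrow> ((*v) Ai ^^ k) 0" using w0 by (rule isCont_tendsto_compose)
  then have "y' \<longlonglongrightarrow> y + 0" unfolding y'_def by (intro tendsto_intros) (simp add: linear_0[OF linear_iterate])
  moreover have "isCont (\<lambda>x. cmod (g x)) (y + 0)"
    using g by (intro continuous_intros) (simp add: continuous_on_eq_continuous_at)
  ultimately have "(\<lambda>n. cmod (g (y' n))) \<longlonglongrightarrow> cmod (g (y + 0))" by (rule isCont_tendsto_compose[rotated])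
  then have ev2: "eventually (\<lambda>n. cmod (g y) / 2 < cmod (g (y' n))) sequentially"
    by (rule order_tendstoD) (use k(4) in simp)
  have "(\<lambda>n. inverse (real (Suc (s n)))) \<longlonglongrightarrow> 0"
    using LIMSEQ_subseq_LIMSEQ[OF LIMSEQ_inverse_real_of_nat z0(2)] by (simp add: comp_def)
  then have ev3: "eventually (\<lambda>n. inverse (real (Suc (s n))) < min (\<epsilon> / 2) (cmod (g y) / 2)) sequentially"
    by (rule order_tendstoD) (use k(2,4) in simp)
  have "eventually (\<lambda>n. False) sequentially"
    using ev1 ev2 ev3
  proof eventually_elim
    case (elim n)
    have "transports N (\<epsilon> / 2) (z (s n)) k (y' n)"
      using transports_shift[OF k(3), of "z (s n)"] elim(1) by (simp add: y'_def w_def)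
    then have "transports N (inverse (real (Suc (s n)))) (z (s n)) k (y' n)"
      by (rule transports_mono) (use elim(3) in simp)
    then have "cmod (g (y' n)) < inverse (real (Suc (s n)))" by (rule z(2)[OF k(1)])
    then show False using elim by simp
  qed
  then show False by simp
qed

lemma iterated_reach:
  assumes step: "\<forall>z\<in>N. \<exists>k\<ge>1. \<exists>y. transports N \<rho> z k y \<and> \<rho> \<le> cmod (g y)" and \<rho>: "\<rho> > 0" and z: "z \<in> N"
  shows "\<exists>k\<ge>j. \<exists>y. transports N \<rho> z k y \<and> \<rho> \<le> cmod (g y)"
proof (induction j)
  case 0
  show ?case using step z by blast
next
  case (Suc j)
  then obtain k y where k: "k \<ge> j" "transports N \<rho> z k y" by blast
  have "y \<in> N" by (rule transports_mem[OF k(2) \<rho> z])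
  then obtain k' y' where k': "k' \<ge> 1" "transports N \<rho> y k' y'" "\<rho> \<le> cmod (g y')" using step by blast
  have "transports N \<rho> z (k' + k) y'" by (rule transports_compose[OF k(2) k'(2)])
  then show ?case using k k' by (intro exI[of _ "k' + k"]) auto
qed

section \<open>Invariant zero sets of exponential sums\<close>

text \<open>Transport a neighbourhood of \<open>z\<close> by \<open>k\<close> steps to a point \<open>y\<close> with large derivative of the vanishing sum. Both
  \<open>y\<close> and \<open>y + Ai\<^sup>k \<delta>\<close> are zeros, so the derivative at \<open>y\<close> in direction \<open>Ai\<^sup>k \<delta>\<close> is of second order in
  \<open>Ai\<^sup>k \<delta>\<close>. Rescaled by \<open>r\<^sup>k\<close> these derivatives tend to 0 at all such \<open>\<delta>\<close>, while as functionals of \<open>\<delta>\<close> they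
  stay bounded away from 0, because \<open>A\<close> is a similarity.\<close>

lemma locally_in_proper_subspace:
  assumes N: "closed N" "invariant_set N"
    and van: "\<And>x. x \<in> N \<Longrightarrow> expsum S b (\<lambda>n. n) x = 0"
    and nz: "\<And>N'. closed N' \<Longrightarrow> invariant_set N' \<Longrightarrow> N' \<subseteq> N \<Longrightarrow>
        \<exists>x\<in>N'. expsum S (\<lambda>n. b n * complex_of_real (n \<bullet> u)) (\<lambda>n. n) x \<noteq> 0"
  shows "\<exists>\<rho>>0. \<forall>z\<in>N. \<exists>W. subspace W \<and> W \<noteq> UNIV \<and> (\<forall>\<delta>. cmod (\<phi> \<delta>) < \<rho> \<longrightarrow> z + \<delta> \<in> N \<longrightarrow> \<delta> \<in> W)"
proof -
  define DF where "DF = (\<lambda>y w. expsum S (\<lambda>n. b n * complex_of_real (n \<bullet> w)) (\<lambda>n::real^'n. n) y)"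
  have linDF: "linear (DF y)" for y
    by (rule linearI) (simp_all add: DF_def expsum_def inner_add_right algebra_simps sum.distrib
        sum_distrib_left scaleR_conv_of_real[where 'a=complex])
  have cont: "continuous_on UNIV (\<lambda>y. DF y u)" unfolding DF_def by (intro continuous_intros)
  have nz': "\<exists>x\<in>N'. DF x u \<noteq> 0" if "closed N'" "invariant_set N'" "N' \<subseteq> N" for N'
    using nz[OF that] by (simp add: DF_def)
  obtain \<rho> where \<rho>: "\<rho> > 0" "\<forall>z\<in>N. \<exists>k\<ge>1. \<exists>y. transports N \<rho> z k y \<and> \<rho> \<le> cmod (DF y u)"
    using uniform_reach[OF N nz' cont] by blast
  obtain K where "K > 0" and K: "\<And>x \<delta>. cmod (expsum S b (\<lambda>n. n) (x + \<delta>) - expsum S b (\<lambda>n. n) x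
      - 2 * complex_of_real pi * \<i> * expsum S (\<lambda>i. b i * complex_of_real (i \<bullet> \<delta>)) (\<lambda>n::real^'n. n) x) \<le> K * (norm \<delta>)\<^sup>2"
    by (rule expsum_taylor[where I=S and c=b and \<omega>="\<lambda>n::real^'n. n"]) (rule that)
  obtain c C where c: "c > 0" and C: "C > 0" and cl: "\<And>x. c * norm x \<le> cmod (\<phi> x)" and Cl: "\<And>x. cmod (\<phi> x) \<le> C * norm x"
    by (rule \<phi>_bounds) (rule that)
  show ?thesis
  proof (intro exI[of _ \<rho>] conjI ballI \<rho>(1))
    fix z assume z: "z \<in> N"
    have "\<forall>j. \<exists>k y. k \<ge> j \<and> transports N \<rho> z k y \<and> \<rho> \<le> cmod (DF y u)"
      using iterated_reach[OF \<rho>(2,1) z] by blast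
    then obtain k y where k: "\<And>j. k j \<ge> j" and t: "\<And>j. transports N \<rho> z (k j) (y j)"
      and DFy: "\<And>j. \<rho> \<le> cmod (DF (y j) u)" by metis
    define G where "G = (\<lambda>j \<delta>. complex_of_real (r ^ k j) * DF (y j) (((*v) Ai ^^ k j) \<delta>))"
    have linG: "linear (G j)" for j
    proof -
      have "linear (\<lambda>\<delta>. DF (y j) (((*v) Ai ^^ k j) \<delta>))"
        using linear_compose[OF linear_iterate linDF] by (simp add: comp_def)
      then show ?thesis unfolding G_def
        by (intro linearI) (simp_all add: linear_add[OF linDF] linear_scale[OF linDF]
          linear_add[OF linear_iterate] linear_scale[OF linear_iterate] distrib_left scaleR_conv_of_real[where 'a=complex])
    qed
    define W where "W = {\<delta>. (\<lambda>j. G j \<delta>) \<longlonglongrightarrow> 0}"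
    have "subspace W"
      unfolding subspace_def W_def
    proof (intro conjI ballI allI; clarsimp)
      show "(\<lambda>j. G j 0) \<longlonglongrightarrow> 0" by (simp add: linear_0[OF linG])
    next
      fix x y assume "(\<lambda>j. G j x) \<longlonglongrightarrow> 0" "(\<lambda>j. G j y) \<longlonglongrightarrow> 0"
      from tendsto_add[OF this] show "(\<lambda>j. G j (x + y)) \<longlonglongrightarrow> 0" by (simp add: linear_add[OF linG])
    next
      fix s x assume "(\<lambda>j. G j x) \<longlonglongrightarrow> 0"
      from tendsto_scaleR[OF tendsto_const this, of s] show "(\<lambda>j. G j (s *\<^sub>R x)) \<longlonglongrightarrow> 0"
        by (simp add: linear_scale[OF linG])
    qed
    moreover have "W \<noteq> UNIV"
    proof
      assume "W = UNIV"
      then have G0: "(\<lambda>j. G j v) \<longlonglongrightarrow> 0" for v by (auto simp: W_def)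
      define R where "R = cmod (\<phi> u) / c"
      \<comment> \<open>bounded test vectors that are contracted to multiples of \<open>u\<close>\<close>
      define d where "d = (\<lambda>j. (1 / r ^ k j) *\<^sub>R ((*v) A ^^ k j) u)"
      have AA: "((*v) Ai ^^ n) (((*v) A ^^ n) x) = x" for n x
        by (induction n arbitrary: x) (simp_all add: funpow_swap1)
      have Gd: "G j (d j) = DF (y j) u" for j
      proof -
        have "((*v) Ai ^^ k j) (d j) = (1 / r ^ k j) *\<^sub>R u"
          by (simp add: d_def linear_scale[OF linear_iterate] AA)
        then show ?thesis using r_gt_1
          by (simp add: G_def linear_scale[OF linDF] scaleR_conv_of_real[where 'a=complex])
      qed
      have phiA: "cmod (\<phi> (((*v) A ^^ n) x)) = r ^ n * cmod (\<phi> x)" for n x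
        by (induction n) (simp_all add: norm_\<phi>_A)
      have "norm (d j) \<le> R" for j
      proof -
        have "cmod (\<phi> (d j)) = cmod (\<phi> u)"
          using r_gt_1 by (simp add: d_def linear_scale[OF linear_\<phi>] phiA)
        then show ?thesis using cl[of "d j"] c by (simp add: R_def pos_le_divide_eq mult.commute)
      qed
      then have dB: "\<bar>d j \<bullet> e\<bar> \<le> R" if "e \<in> Basis" for j e
        using Basis_le_norm[OF that, of "d j"] by (meson order_trans)
      have le: "\<rho> \<le> (\<Sum>e\<in>Basis. R * cmod (G j e))" for j
      proof -
        have "G j (d j) = G j (\<Sum>e\<in>Basis. (d j \<bullet> e) *\<^sub>R e)" by (simp only: euclidean_representation)
        also have "\<dots> = (\<Sum>e\<in>Basis. (d j \<bullet> e) *\<^sub>R G j e)"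
          by (simp add: linear_sum[OF linG] linear_scale[OF linG])
        finally have "cmod (G j (d j)) \<le> (\<Sum>e\<in>Basis. R * cmod (G j e))"
          by (simp only:) (intro sum_norm_le, simp add: dB mult_right_mono)
        then show ?thesis using DFy[of j] by (simp add: Gd)
      qed
      have "(\<lambda>j. \<Sum>e\<in>Basis. R * cmod (G j e)) \<longlonglongrightarrow> (\<Sum>e\<in>(Basis::(real^'n) set). R * cmod 0)"
        by (intro tendsto_intros G0)
      then have "(\<lambda>j. \<Sum>e\<in>Basis. R * cmod (G j e)) \<longlonglongrightarrow> 0" by simp
      then have "\<rho> \<le> 0" by (rule LIMSEQ_le_const) (use le in blast)
      then show False using \<rho>(1) by simp
    qed
    moreover have "\<delta> \<in> W" if \<delta>: "cmod (\<phi> \<delta>) < \<rho>" "z + \<delta> \<in> N" for \<delta>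
    proof -
      define B0 where "B0 = K / (2 * pi) * (cmod (\<phi> \<delta>) / c)\<^sup>2"
      have "cmod (G j \<delta>) \<le> B0 * (1 / r) ^ j" for j
      proof -
        let ?w = "((*v) Ai ^^ k j) \<delta>"
        have "y j \<in> N" by (rule transports_mem[OF t \<rho>(1) z])
        moreover have "y j + ?w \<in> N" using t[of j] \<delta> unfolding transports_def by blast
        ultimately have "2 * pi * cmod (DF (y j) ?w) \<le> K * (norm ?w)\<^sup>2"
          using K[of "y j" ?w] van by (simp add: DF_def norm_mult)
        then have 1: "cmod (DF (y j) ?w) \<le> K / (2 * pi) * (norm ?w)\<^sup>2"
          by (simp add: field_simps)
        have "c * norm ?w \<le> cmod (\<phi> \<delta>) / r ^ k j" using cl[of ?w] by (simp only: norm_\<phi>_Ai_iterate)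
        then have "norm ?w \<le> cmod (\<phi> \<delta>) / r ^ k j / c"
          using c by (subst pos_le_divide_eq) (simp_all only: mult.commute)
        then have "(norm ?w)\<^sup>2 \<le> (cmod (\<phi> \<delta>) / r ^ k j / c)\<^sup>2" by (intro power_mono) auto
        then have "K / (2 * pi) * (norm ?w)\<^sup>2 \<le> K / (2 * pi) * (cmod (\<phi> \<delta>) / r ^ k j / c)\<^sup>2"
          using \<open>K > 0\<close> by (intro mult_left_mono) auto
        with 1 have "cmod (DF (y j) ?w) \<le> K / (2 * pi) * (cmod (\<phi> \<delta>) / r ^ k j / c)\<^sup>2" by simp
        also have "\<dots> = B0 / (r ^ k j)\<^sup>2" by (simp add: B0_def power_divide power_mult_distrib mult.commute)
        finally have "r ^ k j * cmod (DF (y j) ?w) \<le> r ^ k j * (B0 / (r ^ k j)\<^sup>2)"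
          using r_gt_1 by (intro mult_left_mono) auto
        also have "\<dots> = B0 / r ^ k j" using r_gt_1 by (simp add: power2_eq_square)
        also have "\<dots> \<le> B0 / r ^ j"
          using r_gt_1 k[of j] \<open>K > 0\<close> by (intro divide_left_mono power_increasing mult_pos_pos) (auto simp: B0_def)
        finally show ?thesis using r_gt_1 by (simp add: G_def norm_mult norm_power power_one_over)
      qed
      moreover have "(\<lambda>j. B0 * (1 / r) ^ j) \<longlonglongrightarrow> B0 * 0"
        using r_gt_1 by (intro tendsto_intros LIMSEQ_power_zero) simp
      ultimately have "(\<lambda>j. G j \<delta>) \<longlonglongrightarrow> 0"
        by (intro Lim_null_comparison[of "\<lambda>j. G j \<delta>" "\<lambda>j. B0 * (1 / r) ^ j"]) auto
      then show ?thesis by (simp add: W_def)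
    qed
    ultimately show "\<exists>W. subspace W \<and> W \<noteq> UNIV \<and> (\<forall>\<delta>. cmod (\<phi> \<delta>) < \<rho> \<longrightarrow> z + \<delta> \<in> N \<longrightarrow> \<delta> \<in> W)" by blast
  qed
qed

text \<open>The injection \<open>\<phi>\<close> into the complex numbers bounds the dimension by 2.\<close>

lemma proper_subspace_is_line:
  assumes W: "subspace W" "W \<noteq> (UNIV :: (real^'n) set)" "u \<in> W" "u \<noteq> 0"
  shows "W = span {u}"
proof -
  have "dim (UNIV :: (real^'n) set) = dim (range \<phi>)"
    using dim_image_eq[OF linear_\<phi>, of UNIV] inj_\<phi> by simp
  also have "\<dots> \<le> DIM(complex)" by (rule dim_subset_UNIV)
  finally have "dim (UNIV :: (real^'n) set) \<le> 2" by simp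
  moreover have "dim W < dim (UNIV :: (real^'n) set)"
    using W dim_psubset[of W UNIV] by (metis span_UNIV span_eq_iff psubsetI subset_UNIV)
  ultimately have "dim W \<le> dim {u}" using W(4) by simp
  then have "dim W \<le> dim (span {u})" by simp
  moreover have "span {u} \<subseteq> W" using W by (simp add: span_minimal)
  ultimately show ?thesis using subspace_dim_equal[of "span {u}" W] W(1) by simp
qed

lemma span_line_preimage:
  assumes "u \<noteq> 0" "span {u} \<noteq> (UNIV :: (real^'n) set)"
  shows "span {u, Ai *v u} = UNIV"
proof (rule ccontr)
  assume ne: "span {u, Ai *v u} \<noteq> UNIV"
  have "span {u, Ai *v u} = span {u}"
    by (rule proper_subspace_is_line[OF _ ne]) (auto simp: span_base assms(1))
  then have "Ai *v u \<in> span {u}" by (metis insertCI span_base)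
  then obtain s where s: "Ai *v u = s *\<^sub>R u" by (auto simp: span_singleton)
  then have us: "u = s *\<^sub>R (A *v u)" by (metis A_Ai matrix_vector_mult_scaleR)
  then have "s \<noteq> 0" using assms(1) by auto
  then have Au: "A *v u = (1 / s) *\<^sub>R u" using us by (metis divide_inverse_commute mult.right_neutral scaleR_one scaleR_scaleR left_inverse inverse_eq_divide)
  have "\<forall>x\<in>span {u}. A *v x \<in> span {u}"
    by (auto simp: span_singleton matrix_vector_mult_scaleR Au)
  then have "span {u} = {0} \<or> span {u} = UNIV"
    using irreducible unfolding no_proper_invariant_subspaces_def by blast
  then show False using assms span_base[of u "{u}"] by auto
qed

text \<open>Otherwise every invariant set of zeros is infinite modulo integer vectors. Then some closed invariant set
  accumulates at a point and lies there in a line, which forces two crossing lines of zeros. The set of all such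
  crossings is invariant, yet finite modulo integer vectors.\<close>

theorem vanishing_sum_vanishes_on_P:
  fixes c :: "real^'n \<Rightarrow> complex" and I :: "(real^'n) set"
  defines "h \<equiv> expsum I c (\<lambda>n. n)"
  assumes I: "finite I" "i \<in> I" "c i \<noteq> 0" and M: "invariant_set {x. h x = 0}"
  shows "\<exists>x\<in>P. h x = 0"
proof (rule ccontr)
  assume neg: "\<not> ?thesis"
  let ?M = "{x. h x = 0}"
  have cont: "continuous_on UNIV h" unfolding h_def by (intro continuous_intros)
  have "closed ?M" by (intro closed_Collect_eq cont continuous_on_const)
  have inf: "infinite (N \<inter> unit_cube)" if "invariant_set N" "N \<subseteq> ?M" for N
    using finite_invariant_meets_P[OF that(1)] neg that(2) by blast
  obtain N S b u where N: "closed N" "invariant_set N" "N \<subseteq> ?M"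
    and van: "\<And>x. x \<in> N \<Longrightarrow> expsum S b (\<lambda>n. n) x = 0"
    and nz: "\<And>N'. closed N' \<Longrightarrow> invariant_set N' \<Longrightarrow> N' \<subseteq> N \<Longrightarrow>
        \<exists>x\<in>N'. expsum S (\<lambda>n. b n * complex_of_real (n \<bullet> u)) (\<lambda>n. n) x \<noteq> 0"
    by (rule minimal_vanishing_sum[where I=I and c=c, OF M \<open>closed ?M\<close> I]) (simp add: h_def, rule that)
  obtain \<rho> where \<rho>: "\<rho> > 0" and flat: "\<And>z. z \<in> N \<Longrightarrow>
      \<exists>W. subspace W \<and> W \<noteq> UNIV \<and> (\<forall>\<delta>. cmod (\<phi> \<delta>) < \<rho> \<longrightarrow> z + \<delta> \<in> N \<longrightarrow> \<delta> \<in> W)"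
    using locally_in_proper_subspace[OF N(1,2) van nz] by blast
  obtain c1 C1 where C1: "C1 > 0" "\<And>x. cmod (\<phi> x) \<le> C1 * norm x" by (rule \<phi>_bounds) (rule that)
  obtain z1 where z1: "z1 \<in> unit_cube" "z1 islimpt (N \<inter> unit_cube)"
    using Heine_Borel_imp_Bolzano_Weierstrass[OF compact_unit_cube inf[OF N(2,3)]] by auto
  have lim1: "z1 islimpt N" using z1(2) by (rule islimpt_subset) auto
  have z1N: "z1 \<in> N" using lim1 N(1) by (simp add: closed_limpt)
  obtain l where l: "l \<in> L" "m (Ai *v (z1 + l)) \<noteq> 0" using exists_nonzero_preimage by blast
  define z where "z = z1 + l"
  define y where "y = Ai *v z"
  have lint: "l \<in> int_vecs" using l L_int by auto
  have zN: "z \<in> N" using invariant_periodic[OF N(2) lint] z1N by (simp add: z_def)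
  have acc: "infinite {\<delta>. cmod (\<phi> \<delta>) < e \<and> z + \<delta> \<in> N}" if "e > 0" for e
  proof -
    have "infinite (N \<inter> ball z1 (e / C1))"
      using lim1 that C1(1) by (simp add: islimpt_eq_infinite_ball)
    then have "infinite ((\<lambda>x. x - z1) ` (N \<inter> ball z1 (e / C1)))"
      by (subst finite_image_iff) (auto simp: inj_on_def)
    moreover have "(\<lambda>x. x - z1) ` (N \<inter> ball z1 (e / C1)) \<subseteq> {\<delta>. cmod (\<phi> \<delta>) < e \<and> z + \<delta> \<in> N}"
    proof clarify
      fix x assume x: "x \<in> N" "x \<in> ball z1 (e / C1)"
      have "norm (x - z1) < e / C1" using x(2) by (simp add: dist_norm norm_minus_commute)
      then have "C1 * norm (x - z1) < e" using C1(1) by (simp add: pos_less_divide_eq mult.commute)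
      then have "cmod (\<phi> (x - z1)) < e" using C1(2)[of "x - z1"] by simp
      moreover have "z + (x - z1) \<in> N" using invariant_periodic[OF N(2) lint, of x] x(1) by (simp add: z_def algebra_simps)
      ultimately show "cmod (\<phi> (x - z1)) < e \<and> z + (x - z1) \<in> N" by blast
    qed
    ultimately show ?thesis using finite_subset by blast
  qed
  obtain W where W: "subspace W" "W \<noteq> UNIV" "\<And>\<delta>. cmod (\<phi> \<delta>) < \<rho> \<Longrightarrow> z + \<delta> \<in> N \<Longrightarrow> \<delta> \<in> W"
    using flat[OF zN] by blast
  have "\<not> {\<delta>. cmod (\<phi> \<delta>) < \<rho> \<and> z + \<delta> \<in> N} \<subseteq> {0}" using acc[OF \<rho>] finite_subset by blast
  then obtain v where v: "v \<in> W" "v \<noteq> 0" using W(3) by blast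
  have Wv: "W = span {v}" by (rule proper_subspace_is_line[OF W(1,2) v])
  have line: "infinite {t. cmod (\<phi> (t *\<^sub>R v)) < e \<and> z + t *\<^sub>R v \<in> N}"
    and line_bounded: "bounded {t. cmod (\<phi> (t *\<^sub>R v)) < e \<and> z + t *\<^sub>R v \<in> N}" if e: "e > 0" "e \<le> \<rho>" for e
  proof -
    let ?Z = "{t. cmod (\<phi> (t *\<^sub>R v)) < e \<and> z + t *\<^sub>R v \<in> N}"
    have "{\<delta>. cmod (\<phi> \<delta>) < e \<and> z + \<delta> \<in> N} \<subseteq> (\<lambda>t. t *\<^sub>R v) ` ?Z"
    proof clarify
      fix \<delta> assume d: "cmod (\<phi> \<delta>) < e" "z + \<delta> \<in> N"
      then have "\<delta> \<in> span {v}" using W(3)[of \<delta>] e(2) Wv by simp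
      then obtain t where "\<delta> = t *\<^sub>R v" by (auto simp: span_singleton)
      then show "\<delta> \<in> (\<lambda>t. t *\<^sub>R v) ` ?Z" using d by blast
    qed
    then show "infinite ?Z" using acc[OF e(1)] finite_subset by blast
    have "cmod (\<phi> v) > 0" using v(2) \<phi>_eq_0_iff by simp
    then have "\<bar>t\<bar> \<le> e / cmod (\<phi> v)" if "t \<in> ?Z" for t
      using that by (simp add: linear_scale[OF linear_\<phi>] pos_le_divide_eq)
    then show "bounded ?Z" unfolding bounded_iff real_norm_def by blast
  qed
  have hz: "h (z + t *\<^sub>R v) = 0" for t
    unfolding h_def
    by (rule expsum_line_zeros[OF line[OF \<rho> order_refl] line_bounded[OF \<rho> order_refl]])
       (use N(3) in \<open>auto simp: h_def\<close>)
  have Ay: "A *v y = z" by (simp add: y_def)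
  obtain \<epsilon>0 where e0: "\<epsilon>0 > 0" "transports N \<epsilon>0 (A *v y) 1 y"
    using transports_step[OF N(2), of y] l(2) by (auto simp: y_def z_def)
  define \<epsilon> where "\<epsilon> = min \<epsilon>0 \<rho>"
  have eps: "\<epsilon> > 0" "\<epsilon> \<le> \<rho>" "\<epsilon> \<le> \<epsilon>0" using e0(1) \<rho> by (auto simp: \<epsilon>_def)
  define v' where "v' = Ai *v v"
  have hy: "h (y + t *\<^sub>R v') = 0" for t
    unfolding h_def
  proof (rule expsum_line_zeros[OF line[OF eps(1,2)] line_bounded[OF eps(1,2)]])
    fix t assume "t \<in> {t. cmod (\<phi> (t *\<^sub>R v)) < \<epsilon> \<and> z + t *\<^sub>R v \<in> N}"
    then have "y + ((*v) Ai ^^ 1) (t *\<^sub>R v) \<in> N"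
      using e0(2) eps(3) unfolding transports_def Ay by auto
    then have "y + t *\<^sub>R v' \<in> N" by (simp add: v'_def matrix_vector_mult_scaleR)
    then show "expsum I c (\<lambda>n. n) (y + t *\<^sub>R v') = 0" using N(3) by (auto simp: h_def)
  qed
  have spanv: "span {v, v'} = UNIV"
    unfolding v'_def using v(2) W(2) Wv by (intro span_line_preimage) auto
  define E where "E = {x. \<exists>u w. span {u, w} = UNIV \<and> (\<forall>t. h (x + t *\<^sub>R u) = 0) \<and> (\<forall>t. h (x + t *\<^sub>R w) = 0)}"
  \<comment> \<open>the two lines of zeros meet in the point \<open>z + s v\<close>\<close>
  obtain s s' where ss: "y - z = s *\<^sub>R v + s' *\<^sub>R v'" by (rule span_pair[OF spanv])
  have "z + s *\<^sub>R v \<in> E"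
  proof -
    have "h (z + s *\<^sub>R v + t *\<^sub>R v) = 0" for t
      using hz[of "s + t"] by (simp add: scaleR_left_distrib add.assoc)
    moreover have "h (z + s *\<^sub>R v + t *\<^sub>R v') = 0" for t
    proof -
      have "z + s *\<^sub>R v + t *\<^sub>R v' = y + (t - s') *\<^sub>R v'" using ss by (simp add: algebra_simps)
      then show ?thesis by (simp only: hy)
    qed
    ultimately show ?thesis unfolding E_def using spanv by blast
  qed
  have EM: "E \<subseteq> ?M"
  proof
    fix x assume "x \<in> E"
    then obtain u where "\<forall>t. h (x + t *\<^sub>R u) = 0" by (auto simp: E_def)
    then have "h (x + 0 *\<^sub>R u) = 0" by blast
    then show "x \<in> ?M" by simp
  qed
  \<comment> \<open>near \<open>x\<close> the mask is nonzero, so a line of zeros through \<open>A x\<close> pulls back to a segment of zeros, hence to a line\<close>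
  have pullback_line: "h (x + t *\<^sub>R (Ai *v u)) = 0" if x: "m x \<noteq> 0" and hx: "\<forall>t. h (A *v x + t *\<^sub>R u) = 0" for x u t
  proof -
    obtain \<epsilon> where e: "\<epsilon> > 0" "transports ?M \<epsilon> (A *v x) 1 x" using transports_step[OF M x] by blast
    define \<eta> where "\<eta> = \<epsilon> / (cmod (\<phi> u) + 1)"
    have \<eta>: "\<eta> > 0" using e(1) by (simp add: \<eta>_def add_nonneg_pos)
    have "h (x + t *\<^sub>R (Ai *v u)) = 0" if "t \<in> {0<..<\<eta>}" for t
    proof -
      have "cmod (\<phi> (t *\<^sub>R u)) = t * cmod (\<phi> u)" using that by (simp add: linear_scale[OF linear_\<phi>])
      also have "\<dots> \<le> t * (cmod (\<phi> u) + 1)" using that by (intro mult_left_mono) auto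
      also have "\<dots> < \<epsilon>" using that by (simp add: \<eta>_def pos_less_divide_eq add_nonneg_pos)
      finally have "x + ((*v) Ai ^^ 1) (t *\<^sub>R u) \<in> ?M" using e(2) hx unfolding transports_def by blast
      then show ?thesis by (simp add: matrix_vector_mult_scaleR)
    qed
    then have zero: "expsum I c (\<lambda>n. n) (x + t *\<^sub>R (Ai *v u)) = 0" if "t \<in> {0<..<\<eta>}" for t
      using that unfolding h_def by blast
    have "infinite {0<..<\<eta>}" using \<eta> by (simp add: infinite_Ioo)
    then show ?thesis unfolding h_def
      by (rule expsum_line_zeros[where Z="{0<..<\<eta>}" and I=I and c=c and \<omega>="\<lambda>n. n"]) (simp, rule zero)
  qed
  have "invariant_set E"
    unfolding invariant_set_def
  proof (intro conjI ballI allI impI)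
    show "E \<noteq> {}" using \<open>z + s *\<^sub>R v \<in> E\<close> by blast
  next
    fix x w :: "real^'n" assume x: "x \<in> E" and w: "w \<in> int_vecs"
    have "h ((x + w) + d) = 0" if "h (x + d) = 0" for d
    proof -
      have "(x + d) + w \<in> ?M" using invariant_periodic[OF M w, of "x + d"] that by blast
      then show ?thesis by (simp add: algebra_simps)
    qed
    then show "x + w \<in> E" using x unfolding E_def mem_Collect_eq by blast
  next
    fix x assume x: "A *v x \<in> E" and mx: "m x \<noteq> 0"
    obtain u w where uw: "span {u, w} = UNIV" "\<forall>t. h (A *v x + t *\<^sub>R u) = 0" "\<forall>t. h (A *v x + t *\<^sub>R w) = 0"
      using x by (auto simp: E_def)
    have "span {Ai *v u, Ai *v w} = (\<lambda>x. Ai *v x) ` span {u, w}"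
      using linear_span_image[of "\<lambda>x. Ai *v x" "{u, w}"] by simp
    also have "\<dots> = UNIV" unfolding uw(1) by (rule surjI[of _ "\<lambda>x. A *v x"]) simp
    finally show "x \<in> E" unfolding E_def
      using pullback_line[OF mx uw(2)] pullback_line[OF mx uw(3)] by blast
  qed
  then have "infinite (E \<inter> unit_cube)" using EM by (rule inf)
  moreover have "E \<inter> unit_cube = {x\<in>unit_cube. \<exists>u v. span {u, v} = UNIV \<and>
      (\<forall>t. expsum I c (\<lambda>n. n) (x + t *\<^sub>R u) = 0) \<and> (\<forall>t. expsum I c (\<lambda>n. n) (x + t *\<^sub>R v) = 0)}"
    by (auto simp: E_def h_def)
  moreover have "finite \<dots>"
    by (rule finitely_many_crossings[where c=c and \<omega>="\<lambda>n. n", OF I(1) _ I(2,3) compact_imp_bounded[OF compact_unit_cube]]) simp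
  ultimately show False by simp
qed

section \<open>The self-affine tile\<close>

abbreviation "X \<equiv> attractor (transpose A) D"

definition expand :: "(nat \<Rightarrow> real^'n) \<Rightarrow> real^'n" where
  "expand \<delta> = (\<Sum>j. ((*v) Bi ^^ Suc j) (\<delta> j))"

lemma Bi_contracts: obtains C s where "C > 0" "0 < s" "s < 1" "\<And>k x. norm (((*v) Bi ^^ k) x) \<le> C * s ^ k * norm x"
proof -
  obtain \<psi> ev where \<psi>: "linear \<psi>" "inj \<psi>" "\<And>x. \<psi> (B *v x) = ev * \<psi> x" "1 < cmod ev"
    using irreducible_expansive_similarity[OF irreducible_transpose[OF irreducible] expansive_transpose[OF expansive_A]]
    by blast
  obtain c where c: "c > 0" "\<And>x. c * norm x \<le> cmod (\<psi> x)"
    using linear_inj_bounded_below_pos[OF \<psi>(1,2)] by blast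
  obtain C where C: "C > 0" "\<And>x. cmod (\<psi> x) \<le> C * norm x" using linear_bounded_pos[OF \<psi>(1)] by blast
  let ?s = "1 / cmod ev"
  have "cmod (\<psi> (Bi *v x)) = ?s * cmod (\<psi> x)" for x
  proof -
    have "cmod (\<psi> x) = cmod ev * cmod (\<psi> (Bi *v x))" using \<psi>(3)[of "Bi *v x"] by (simp add: norm_mult)
    moreover have "cmod ev \<noteq> 0" using \<psi>(4) by auto
    ultimately show ?thesis by simp
  qed
  then have it: "cmod (\<psi> (((*v) Bi ^^ k) x)) = ?s ^ k * cmod (\<psi> x)" for k x
    by (induction k) simp_all
  show ?thesis
  proof (rule that[of "C / c" ?s])
    fix k x
    have "c * norm (((*v) Bi ^^ k) x) \<le> ?s ^ k * cmod (\<psi> x)" using c(2) it by metis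
    also have "\<dots> \<le> ?s ^ k * (C * norm x)" by (intro mult_left_mono C(2)) simp
    finally have "norm (((*v) Bi ^^ k) x) \<le> (?s ^ k * (C * norm x)) / c"
      using c(1) by (subst pos_le_divide_eq) (simp_all only: mult.commute)
    then show "norm (((*v) Bi ^^ k) x) \<le> C / c * ?s ^ k * norm x" by (simp add: mult_ac)
  qed (use c C \<psi>(4) in \<open>auto simp: divide_simps\<close>)
qed

lemma digit_term_bound: obtains M where "summable M"
  "\<And>\<delta> j. (\<forall>j. \<delta> j \<in> D) \<Longrightarrow> norm (((*v) Bi ^^ Suc j) (\<delta> j)) \<le> M j"
proof -
  obtain C s where C: "C > 0" "0 < s" "s < 1" "\<And>k x. norm (((*v) Bi ^^ k) x) \<le> C * s ^ k * norm x"
    by (rule Bi_contracts) (rule that)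
  obtain R where R: "\<And>d. d \<in> D \<Longrightarrow> norm d \<le> R"
    using finite_imp_bounded[OF finite_D] by (auto simp: bounded_iff)
  show ?thesis
  proof (rule that[of "\<lambda>j. C * R * s * s ^ j"])
    show "summable (\<lambda>j. C * R * s * s ^ j)"
      by (intro summable_mult summable_geometric) (use C in auto)
    fix \<delta> :: "nat \<Rightarrow> real^'n" and j assume "\<forall>j. \<delta> j \<in> D"
    then have "C * s ^ Suc j * norm (\<delta> j) \<le> C * s ^ Suc j * R" using R C by (intro mult_left_mono) auto
    then show "norm (((*v) Bi ^^ Suc j) (\<delta> j)) \<le> C * R * s * s ^ j"
      using C(4)[of "Suc j" "\<delta> j"] by (simp add: mult_ac)
  qed
qed

lemma summable_digits: "(\<forall>j. \<delta> j \<in> D) \<Longrightarrow> summable (\<lambda>j. ((*v) Bi ^^ Suc j) (\<delta> j))"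
  by (rule digit_term_bound, rule summable_comparison_test) auto

lemma X_eq: "X = expand ` {\<delta>. \<forall>j. \<delta> j \<in> D}"
proof -
  have iff: "(\<lambda>j. ((*v) Bi ^^ Suc j) (\<delta> j)) sums x \<longleftrightarrow> x = expand \<delta>" if "\<forall>j. \<delta> j \<in> D" for \<delta> x
    unfolding expand_def sums_iff using summable_digits[OF that] by blast
  show ?thesis
  proof (intro set_eqI iffI)
    fix x assume "x \<in> X"
    then obtain \<delta> where \<delta>: "\<forall>j. \<delta> j \<in> D" "(\<lambda>j. ((*v) Bi ^^ Suc j) (\<delta> j)) sums x"
      unfolding attractor_def by blast
    then have "x = expand \<delta>" using iff by blast
    then show "x \<in> expand ` {\<delta>. \<forall>j. \<delta> j \<in> D}" using \<delta>(1) by (intro image_eqI) simp_all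
  next
    fix x assume "x \<in> expand ` {\<delta>. \<forall>j. \<delta> j \<in> D}"
    then obtain \<delta> where \<delta>: "\<forall>j. \<delta> j \<in> D" "x = expand \<delta>" by auto
    then show "x \<in> X" unfolding attractor_def using iff by blast
  qed
qed

text \<open>The expansions converge uniformly, so the attractor is a continuous image of the compact space of digit
  sequences.\<close>

lemma compact_X: "compact X"
proof -
  let ?S = "{\<delta> :: nat \<Rightarrow> real^'n. \<forall>j. \<delta> j \<in> D}"
  obtain M where M: "summable M" "\<And>\<delta> j. (\<forall>j. \<delta> j \<in> D) \<Longrightarrow> norm (((*v) Bi ^^ Suc j) (\<delta> j)) \<le> M j"
    by (rule digit_term_bound) (rule that)
  have "uniform_limit ?S (\<lambda>n \<delta>. \<Sum>j<n. ((*v) Bi ^^ Suc j) (\<delta> j)) (\<lambda>\<delta>. \<Sum>j. ((*v) Bi ^^ Suc j) (\<delta> j)) sequentially"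
    by (rule Weierstrass_m_test[OF _ M(1)]) (use M(2) in simp)
  moreover have "\<forall>n. continuous_on ?S (\<lambda>\<delta>. \<Sum>j<n. ((*v) Bi ^^ Suc j) (\<delta> j))"
  proof (intro allI continuous_on_sum)
    fix n j
    have "continuous_on UNIV ((*v) Bi ^^ Suc j)"
      using linear_iterate by (intro linear_continuous_on) (simp only: linear_linear)
    moreover have "continuous_on ?S (\<lambda>\<delta>. \<delta> j)"
      by (rule continuous_on_subset[OF continuous_on_product_coordinates]) simp
    ultimately show "continuous_on ?S (\<lambda>\<delta>. ((*v) Bi ^^ Suc j) (\<delta> j))"
      by (rule continuous_on_compose2) simp
  qed
  ultimately have "continuous_on ?S expand"
    unfolding expand_def by (intro uniform_limit_theorem) auto
  moreover have "compact ?S" by (rule compact_sequences) (simp add: finite_imp_compact finite_D)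
  ultimately show ?thesis unfolding X_eq by (rule compact_continuous_image)
qed

lemma X_nonempty: "X \<noteq> {}"
proof -
  obtain d where "d \<in> D" using D_nonempty by blast
  then have "(\<lambda>_. d) \<in> {\<delta> :: nat \<Rightarrow> real^'n. \<forall>j. \<delta> j \<in> D}" by simp
  then have "expand (\<lambda>_. d) \<in> X" unfolding X_eq by (rule imageI)
  then show ?thesis by blast
qed

lemma expand_Suc:
  assumes "\<forall>j. \<delta> j \<in> D"
  shows "B *v expand \<delta> = \<delta> 0 + expand (\<lambda>j. \<delta> (Suc j))"
proof -
  have s: "summable (\<lambda>j. ((*v) Bi ^^ Suc j) (\<delta> j))" by (rule summable_digits[OF assms])
  have "B *v expand \<delta> = (\<Sum>j. B *v (((*v) Bi ^^ Suc j) (\<delta> j)))"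
    unfolding expand_def by (intro bounded_linear.suminf[OF _ s]) (simp add: linear_linear)
  also have "\<dots> = (\<Sum>j. ((*v) Bi ^^ j) (\<delta> j))" by simp
  also have "\<dots> = \<delta> 0 + (\<Sum>j. ((*v) Bi ^^ Suc j) (\<delta> (Suc j)))"
  proof -
    have "summable (\<lambda>j. B *v (((*v) Bi ^^ Suc j) (\<delta> j)))"
      by (intro bounded_linear.summable[OF _ s]) (simp add: linear_linear)
    then have "summable (\<lambda>j. ((*v) Bi ^^ j) (\<delta> j))" by simp
    then show ?thesis by (subst suminf_split_head) simp_all
  qed
  finally show ?thesis by (simp add: expand_def)
qed

lemma B_X: "(\<lambda>x. B *v x) ` X = (\<Union>d\<in>D. (+) d ` X)"
proof (intro set_eqI iffI)
  fix y assume "y \<in> (\<lambda>x. B *v x) ` X"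
  then obtain \<delta> where \<delta>: "\<forall>j. \<delta> j \<in> D" "y = B *v expand \<delta>" unfolding X_eq by auto
  then have "y = \<delta> 0 + expand (\<lambda>j. \<delta> (Suc j))" using expand_Suc by simp
  moreover have "expand (\<lambda>j. \<delta> (Suc j)) \<in> X" using \<delta>(1) unfolding X_eq by auto
  ultimately show "y \<in> (\<Union>d\<in>D. (+) d ` X)" using \<delta>(1) by blast
next
  fix y assume "y \<in> (\<Union>d\<in>D. (+) d ` X)"
  then obtain d \<delta> where \<delta>: "d \<in> D" "\<forall>j. \<delta> j \<in> D" "y = d + expand \<delta>" unfolding X_eq by auto
  define \<delta>' where "\<delta>' = (\<lambda>j. case j of 0 \<Rightarrow> d | Suc i \<Rightarrow> \<delta> i)"
  have \<delta>': "\<forall>j. \<delta>' j \<in> D" using \<delta> by (auto simp: \<delta>'_def split: nat.splits)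
  have "y = B *v expand \<delta>'" using expand_Suc[OF \<delta>'] \<delta>(3) by (simp add: \<delta>'_def)
  then show "y \<in> (\<lambda>x. B *v x) ` X" using \<delta>' unfolding X_eq by blast
qed

text \<open>Both \<open>B\<close> applied to the half-open cube and the union of its translates by the digits are fundamental domains
  of \<open>B \<int>\<^sup>n\<close>.\<close>

lemma emeasure_B_half_cube: "emeasure lborel ((\<lambda>x. B *v x) ` half_cube) = ennreal q * emeasure lborel (half_cube :: (real^'n) set)"
proof -
  let ?H = "(\<lambda>z. B *v z) ` int_vecs" and ?F2 = "\<Union>d\<in>D. (\<lambda>x. x + d) ` half_cube"
  have tr: "(\<lambda>x. x + d) ` half_cube = (\<lambda>x. x + (- d)) -` half_cube" for d
    by (force simp: image_iff)
  have trb: "(\<lambda>x. x + d) ` half_cube \<in> sets borel" for d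
    unfolding tr by (rule measurable_sets_borel[OF _ half_cube_borel]) simp
  have "(\<lambda>x. B *v x) ` half_cube = (\<lambda>x. Bi *v x) -` half_cube"
    by (force simp: image_iff)
  moreover have "(\<lambda>x. Bi *v x) -` half_cube \<in> sets borel"
    by (intro measurable_sets_borel[OF _ half_cube_borel] borel_measurable_continuous_onI linear_continuous_on) (simp add: linear_linear)
  ultimately have Bb: "(\<lambda>x. B *v x) ` half_cube \<in> sets borel"
    by simp
  have "countable ?H"
  proof (rule countable_image)
    have "int_vecs \<subseteq> (\<lambda>f. \<chi> i. real_of_int (f i)) ` (UNIV :: ('n \<Rightarrow> int) set)"
    proof
      fix x :: "real^'n" assume "x \<in> int_vecs"
      then have "x = (\<lambda>f. \<chi> i. real_of_int (f i)) (\<lambda>i. \<lfloor>x $ i\<rfloor>)"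
        by (auto simp: int_vecs_def vec_eq_iff Ints_def)
      then show "x \<in> (\<lambda>f. \<chi> i. real_of_int (f i)) ` (UNIV :: ('n \<Rightarrow> int) set)"
        by (metis UNIV_I image_eqI)
    qed
    moreover have "countable (UNIV :: ('n \<Rightarrow> int) set)" by (rule countableI_type)
    ultimately show "countable (int_vecs :: (real^'n) set)" by (meson countable_image countable_subset)
  qed
  moreover have "- h \<in> ?H" if hH: "h \<in> ?H" for h
  proof -
    obtain z where z: "z \<in> int_vecs" "h = B *v z" using hH by auto
    have "- h = B *v (- z)" using linear_neg[OF matrix_vector_mul_linear, of B z] z(2) by simp
    then show ?thesis using int_vecs_minus[OF z(1)] by blast
  qed
  moreover have "\<exists>!h. h \<in> ?H \<and> x + h \<in> (\<lambda>x. B *v x) ` half_cube" for x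
  proof -
    define w where "w = Bi *v x"
    have iff: "x + B *v z \<in> (\<lambda>x. B *v x) ` half_cube \<longleftrightarrow> w + z \<in> half_cube" for z
    proof -
      have "x + B *v z = B *v (w + z)" by (simp add: w_def matrix_vector_right_distrib)
      then show ?thesis using inj_image_mem_iff[of "\<lambda>x. B *v x" "w + z" half_cube] Bi_B by (metis injI)
    qed
    show ?thesis
    proof (rule ex1I[of _ "B *v (fpart w - w)"])
      show "B *v (fpart w - w) \<in> ?H \<and> x + B *v (fpart w - w) \<in> (\<lambda>x. B *v x) ` half_cube"
        using half_cube_fpart[of w "fpart w - w"] iff by blast
      fix h assume h: "h \<in> ?H \<and> x + h \<in> (\<lambda>x. B *v x) ` half_cube"
      then obtain z where "z \<in> int_vecs" "h = B *v z" by blast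
      then show "h = B *v (fpart w - w)" using h iff half_cube_fpart[of w z] by simp
    qed
  qed
  moreover have "\<exists>!h. h \<in> ?H \<and> x + h \<in> ?F2" for x
  proof -
    have "x - fpart x \<in> int_vecs" by (rule fpart_diff)
    then obtain d y where d: "d \<in> D" "y \<in> int_vecs" "x - fpart x = d + B *v y" by (rule representative_exists)
    have By: "- (B *v y) = B *v (- y)" using linear_neg[OF matrix_vector_mul_linear, of B y] by simp
    have fp: "fpart x \<in> half_cube" by (simp add: half_cube_def fpart_def frac_lt_1)
    show ?thesis
    proof (rule ex1I[of _ "- (B *v y)"])
      have "x + - (B *v y) = fpart x + d" using d(3) by (simp add: algebra_simps)
      then have "x + - (B *v y) \<in> ?F2" using d(1) fp by blast
      then show "- (B *v y) \<in> ?H \<and> x + - (B *v y) \<in> ?F2"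
        unfolding By using int_vecs_minus[OF d(2)] by blast
      fix h assume h: "h \<in> ?H \<and> x + h \<in> ?F2"
      then obtain z d' t where z: "z \<in> int_vecs" "h = B *v z" "d' \<in> D" "t \<in> half_cube" "x + h = t + d'" by blast
      have "t = x + (B *v z - d')" using z by (simp add: algebra_simps)
      moreover have "B *v z - d' \<in> int_vecs" using z B_int_vecs D_int by auto
      ultimately have "B *v z - d' = fpart x - x" using half_cube_fpart[of x "B *v z - d'"] z(4) by simp
      then have "B *v z - d' = - (d + B *v y)" by (metis d(3) minus_diff_eq)
      then have e: "d' - d = B *v z + B *v y" by (simp add: algebra_simps)
      then have "d' - d = B *v (z + y)" by (simp only: matrix_vector_right_distrib)
      then have "d' = d" by (rule representative_unique[OF z(3) d(1) _ int_vecs_add[OF z(1) d(2)]])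
      then show "h = - (B *v y)" using e z(2) by (simp add: eq_neg_iff_add_eq_0)
    qed
  qed
  moreover have "?F2 \<in> sets borel" using trb finite_D by (intro sets.finite_UN) auto
  ultimately have "emeasure lborel ((\<lambda>x. B *v x) ` half_cube) = emeasure lborel ?F2"
    using Bb by (intro fundamental_domains_equal_measure[of _ _ ?H]) auto
  also have "\<dots> = (\<Sum>d\<in>D. emeasure lborel ((\<lambda>x. x + d) ` half_cube))"
  proof (rule sum_emeasure[symmetric])
    show "disjoint_family_on (\<lambda>d. (\<lambda>x. x + d) ` half_cube) D"
      unfolding disjoint_family_on_def
    proof (intro ballI impI, rule ccontr)
      fix d d' assume d: "d \<in> D" "d' \<in> D" "d \<noteq> d'"
        "(\<lambda>x. x + d) ` half_cube \<inter> (\<lambda>x. x + d') ` half_cube \<noteq> {}"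
      then obtain s t where st: "s \<in> half_cube" "t \<in> half_cube" "s + d = t + d'" by blast
      have "d - d' \<in> int_vecs" using d D_int by auto
      moreover have ts: "t = s + (d - d')" using st(3) by (simp add: algebra_simps)
      ultimately have "d - d' = fpart s - s" "0 = fpart s - s"
        using half_cube_fpart[of s "d - d'"] half_cube_fpart[of s 0] st by auto
      then show False using d(3) by simp
    qed
  qed (use trb finite_D in auto)
  also have "\<dots> = (\<Sum>d\<in>D. emeasure lborel (half_cube :: (real^'n) set))"
    by (intro sum.cong refl emeasure_lborel_translate half_cube_borel)
  also have "\<dots> = ennreal q * emeasure lborel (half_cube :: (real^'n) set)"
    by (simp add: q_def ennreal_of_nat_eq_real_of_nat)
  finally show ?thesis .
qed

lemma measure_B_image:
  assumes "compact S"
  shows "measure lebesgue ((\<lambda>x. B *v x) ` S) = q * measure lebesgue S"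
proof -
  have S: "S \<in> sets borel" using assms by (simp add: borel_compact)
  have BS: "compact ((\<lambda>x. B *v x) ` S)"
    using assms by (intro compact_continuous_image linear_continuous_on) (simp_all add: linear_linear)
  have "emeasure lborel ((\<lambda>x. B *v x) ` S) * emeasure lborel (half_cube :: (real^'n) set)
      = emeasure lborel S * emeasure lborel ((\<lambda>x. B *v x) ` half_cube)"
    by (rule linear_image_emeasure_proportional[where g="\<lambda>x. Bi *v x"]) (simp_all add: S half_cube_borel)
  also have "\<dots> = (ennreal q * emeasure lborel S) * emeasure lborel (half_cube :: (real^'n) set)"
    by (simp add: emeasure_B_half_cube mult_ac)
  finally have "emeasure lborel ((\<lambda>x. B *v x) ` S) = ennreal q * emeasure lborel S"
    using half_cube_emeasure[where 'n='n] by (simp add: mult.commute[of _ "emeasure lborel half_cube"] ennreal_mult_cancel_left)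
  then have "measure lborel ((\<lambda>x. B *v x) ` S) = q * measure lborel S"
    using q_pos by (simp add: measure_def enn2real_mult)
  then show ?thesis using S BS by (simp add: borel_compact)
qed

text \<open>The \<open>q\<close> translates have union \<open>B X\<close>, whose measure is the sum of their measures.\<close>

lemma digit_translates_disjoint:
  assumes "d \<in> D" "d' \<in> D" "d \<noteq> d'"
  shows "negligible ((+) d ` X \<inter> (+) d' ` X)"
proof (rule measure_eq_sum_imp_pairwise_negligible[OF finite_D _ _ assms])
  show "(+) e ` X \<in> lmeasurable" for e by (intro measurable_translation lmeasurable_compact compact_X)
  have "measure lebesgue (\<Union>e\<in>D. (+) e ` X) = q * measure lebesgue X"
    using measure_B_image[OF compact_X] by (simp only: B_X)
  also have "\<dots> = (\<Sum>e\<in>D. measure lebesgue ((+) e ` X))" by (simp add: measure_translation q_def)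
  finally show "measure lebesgue (\<Union>e\<in>D. (+) e ` X) = (\<Sum>e\<in>D. measure lebesgue ((+) e ` X))" .
qed

section \<open>Overlaps of translates of the tile\<close>

definition overlap :: "real^'n \<Rightarrow> real" where
  "overlap n = measure lebesgue (X \<inter> (+) n ` X)"

lemma compact_translate_X: "compact ((+) a ` X)"
  by (intro compact_translation compact_X)

lemma overlap_translate: "measure lebesgue ((+) a ` X \<inter> (+) b ` X) = overlap (b - a)"
proof -
  have "(+) a ` X \<inter> (+) b ` X = (+) a ` (X \<inter> (+) (b - a) ` X)"
    by (simp add: image_Int image_image)
  then show ?thesis by (simp add: measure_translation overlap_def)
qed

lemma overlap_minus: "overlap (- n) = overlap n"
  using overlap_translate[of n 0] by (simp add: overlap_def Int_commute)

text \<open>Apply \<open>B\<close> to \<open>X \<inter> (X + n)\<close> and decompose both sets by \<open>B_X\<close>.\<close>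

lemma overlap_refinement: "q * overlap n = (\<Sum>d\<in>D. \<Sum>d'\<in>D. overlap (B *v n + d' - d))"
proof -
  define F where "F = (\<lambda>(d, d'). (+) d ` X \<inter> (+) (B *v n + d') ` X)"
  have inj: "inj (\<lambda>x. B *v x)" using Bi_B by (metis injI)
  have "(\<lambda>x. B *v x) ` ((+) n ` X) = (+) (B *v n) ` ((\<lambda>x. B *v x) ` X)"
    by (simp add: image_image matrix_vector_right_distrib)
  also have "\<dots> = (\<Union>d'\<in>D. (+) (B *v n + d') ` X)"
    unfolding B_X by (simp add: image_UN image_image add.assoc)
  finally have "(\<lambda>x. B *v x) ` (X \<inter> (+) n ` X) = (\<Union>p\<in>D \<times> D. F p)"
    unfolding image_Int[OF inj] B_X by (auto simp: F_def)
  then have "q * overlap n = measure lebesgue (\<Union>p\<in>D \<times> D. F p)"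
    using measure_B_image[of "X \<inter> (+) n ` X"] compact_Int[OF compact_X compact_translate_X]
    by (simp add: overlap_def)
  also have "\<dots> = (\<Sum>p\<in>D \<times> D. measure lebesgue (F p))"
  proof (rule measure_negligible_finite_Union_image)
    show "F p \<in> lmeasurable" for p
      unfolding F_def by (cases p) (auto intro!: lmeasurable_compact compact_Int compact_translate_X)
    show "pairwise (\<lambda>p p'. negligible (F p \<inter> F p')) (D \<times> D)"
    proof (rule pairwiseI)
      fix p p' assume p: "p \<in> D \<times> D" "p' \<in> D \<times> D" "p \<noteq> p'"
      obtain d d' e e' where pp: "p = (d, d')" "p' = (e, e')" by (meson surj_pair)
      then have D: "d \<in> D" "d' \<in> D" "e \<in> D" "e' \<in> D" and ne: "(d, d') \<noteq> (e, e')" using p by auto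
      have "negligible (F (d, d') \<inter> F (e, e'))"
      proof (cases "d = e")
        case False
        then have "negligible ((+) d ` X \<inter> (+) e ` X)" using digit_translates_disjoint D by blast
        then show ?thesis by (rule negligible_subset) (auto simp: F_def)
      next
        case True
        then have "negligible ((+) d' ` X \<inter> (+) e' ` X)" using digit_translates_disjoint D ne by blast
        then have "negligible ((+) (B *v n) ` ((+) d' ` X \<inter> (+) e' ` X))" by (rule negligible_translation)
        moreover have "F (d, d') \<inter> F (e, e') \<subseteq> (+) (B *v n) ` ((+) d' ` X \<inter> (+) e' ` X)"
          by (simp add: F_def image_Int image_image add.assoc) blast
        ultimately show ?thesis by (rule negligible_subset)
      qed
      then show "negligible (F p \<inter> F p')" by (simp only: pp)
    qed
  qed (use finite_D in simp)
  also have "\<dots> = (\<Sum>d\<in>D. \<Sum>d'\<in>D. measure lebesgue (F (d, d')))"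
    by (simp add: sum.cartesian_product)
  finally show ?thesis by (simp add: F_def overlap_translate)
qed

definition G :: "(real^'n) set" where "G = dual_lattice P"

lemma G_iff: "n \<in> G \<longleftrightarrow> (\<forall>x\<in>P. n \<bullet> x \<in> \<int>)"
  by (simp add: G_def dual_lattice_def)

lemma G_int_vecs: "G \<subseteq> int_vecs"
proof
  fix n assume "n \<in> G"
  then have "\<forall>z\<in>int_vecs. z \<bullet> n \<in> \<int>" using int_vecs_subset_P by (auto simp: G_iff inner_commute)
  then show "n \<in> int_vecs" using int_vecs_iff_inner by blast
qed

lemma G_0: "0 \<in> G" and G_add: "n \<in> G \<Longrightarrow> k \<in> G \<Longrightarrow> n + k \<in> G" and G_minus: "n \<in> G \<Longrightarrow> - n \<in> G"
  by (auto simp: G_iff inner_add_left)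

lemma G_diff: "n \<in> G \<Longrightarrow> k \<in> G \<Longrightarrow> n - k \<in> G"
  using G_add[of n "- k"] G_minus by simp

lemma G_digits: "d \<in> D \<Longrightarrow> d' \<in> D \<Longrightarrow> d - d' \<in> G"
  unfolding G_iff using P_mask norm_mask_eq_1_iff by blast

lemma G_B: "n \<in> G \<Longrightarrow> B *v n \<in> G"
  unfolding G_iff using P_A by (simp add: inner_B)

text \<open>Dual to the surjectivity of \<open>A\<close> on \<open>P\<close> modulo integer vectors.\<close>

lemma G_B_imp:
  assumes k: "k \<in> int_vecs" and Bk: "B *v k \<in> G"
  shows "k \<in> G"
  unfolding G_iff
proof
  fix x assume "x \<in> P"
  then obtain y z where y: "y \<in> P" "z \<in> int_vecs" "x = A *v y + z" by (rule P_A_surj_mod_int_vecs)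
  have "k \<bullet> x = (B *v k) \<bullet> y + k \<bullet> z" by (simp add: y(3) inner_add_right inner_B)
  then show "k \<bullet> x \<in> \<int>" using Bk y inner_int_vecs[OF k y(2)] by (simp add: G_iff)
qed

definition overlaps :: "(real^'n) set" where "overlaps = {n\<in>G. overlap n \<noteq> 0}"

lemma finite_overlaps: "finite overlaps"
proof (rule finite_int_vecs_bounded)
  obtain R where R: "\<And>x. x \<in> X \<Longrightarrow> norm x \<le> R"
    using compact_imp_bounded[OF compact_X] by (auto simp: bounded_iff)
  have "norm n \<le> R + R" if "n \<in> overlaps" for n
  proof -
    have "X \<inter> (+) n ` X \<noteq> {}" using that by (auto simp: overlaps_def overlap_def)
    then obtain x y where "x \<in> X" "y \<in> X" "x = n + y" by blast
    then have "n = x - y" by simp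
    then show ?thesis using norm_triangle_ineq4[of x y] R[OF \<open>x \<in> X\<close>] R[OF \<open>y \<in> X\<close>] by simp
  qed
  then show "bounded overlaps" by (auto simp: bounded_iff)
  show "overlaps \<subseteq> int_vecs" using G_int_vecs by (auto simp: overlaps_def)
qed

text \<open>The Fourier series of the overlaps with indices in \<open>G\<close>; only finitely many are nonzero.\<close>

definition correlation :: "real^'n \<Rightarrow> complex" where
  "correlation = expsum overlaps (\<lambda>n. complex_of_real (overlap n)) (\<lambda>n. n)"

text \<open>The Fourier transform of \<open>overlap_refinement\<close>. Restricting the indices to \<open>G\<close> is compatible with the
  recursion, because for an integer vector \<open>k\<close> the vector \<open>B *v k + d' - d\<close> lies in \<open>G\<close> exactly if \<open>k\<close> does.\<close>

lemma correlation_transfer: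
  "correlation x = (\<Sum>l\<in>L. (cmod (m (Ai *v (x + l))))\<^sup>2 * correlation (Ai *v (x + l)))"
proof -
  let ?BZ = "(\<lambda>y. B *v y) ` int_vecs"
  define T where "T = (\<lambda>n d d'. if n + (d - d') \<in> ?BZ then echar ((n + (d - d')) \<bullet> (Ai *v x)) else 0)"
  have nonneg: "overlap n \<ge> 0" for n by (simp add: overlap_def)
  have "(\<Sum>l\<in>L. (cmod (m (Ai *v (x + l))))\<^sup>2 * correlation (Ai *v (x + l)))
    = (\<Sum>n\<in>overlaps. overlap n * (\<Sum>l\<in>L. (cmod (m (Ai *v (x + l))))\<^sup>2 * echar (n \<bullet> (Ai *v (x + l)))))"
    unfolding correlation_def expsum_def sum_distrib_left by (subst sum.swap) (simp add: mult_ac)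
  also have "\<dots> = (\<Sum>n\<in>overlaps. overlap n * ((\<Sum>d\<in>D. \<Sum>d'\<in>D. T n d d') / q))"
    unfolding T_def using G_int_vecs
    by (intro sum.cong refl arg_cong2[where f="(*)"] transfer_character) (auto simp: overlaps_def)
  also have "\<dots> = (\<Sum>n\<in>overlaps. \<Sum>d\<in>D. \<Sum>d'\<in>D. overlap n * T n d d') / q"
    by (simp add: sum_distrib_left sum_divide_distrib)
  also have "(\<Sum>n\<in>overlaps. \<Sum>d\<in>D. \<Sum>d'\<in>D. overlap n * T n d d')
      = (\<Sum>d\<in>D. \<Sum>d'\<in>D. \<Sum>n\<in>overlaps. overlap n * T n d d')"
    by (subst sum.swap, rule sum.cong[OF refl], rule sum.swap)
  also have "\<dots> = (\<Sum>d\<in>D. \<Sum>d'\<in>D. \<Sum>n\<in>overlaps. if n + (d - d') \<in> ?BZ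
          then overlap n * echar ((n + (d - d')) \<bullet> (Ai *v x)) else 0)"
    by (intro sum.cong refl) (simp add: T_def)
  also have "\<dots> = (\<Sum>d\<in>D. \<Sum>d'\<in>D. \<Sum>k\<in>overlaps. overlap (B *v k + d' - d) * echar (k \<bullet> x))"
  proof (rule sum.cong[OF refl], rule sum.cong[OF refl])
    fix d d' assume d: "d \<in> D" "d' \<in> D"
    \<comment> \<open>all terms of the recursion are nonnegative, so a nonzero term forces \<open>overlap k\<close> to be nonzero\<close>
    have inO: "k \<in> overlaps" if k: "k \<in> G" "overlap (B *v k + d' - d) \<noteq> 0" for k
    proof -
      have "overlap (B *v k + d' - d) \<le> (\<Sum>e'\<in>D. overlap (B *v k + e' - d))"
        using d finite_D nonneg by (intro member_le_sum) auto
      also have "\<dots> \<le> (\<Sum>e\<in>D. \<Sum>e'\<in>D. overlap (B *v k + e' - e))"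
        using d finite_D nonneg by (intro member_le_sum[of d D "\<lambda>e. \<Sum>e'\<in>D. overlap (B *v k + e' - e)"] sum_nonneg) auto
      also have "\<dots> = q * overlap k" by (rule overlap_refinement[symmetric])
      finally have "q * overlap k > 0" using k(2) nonneg[of "B *v k + d' - d"] by linarith
      then show ?thesis using k(1) by (auto simp: overlaps_def)
    qed
    have "(\<Sum>n\<in>overlaps. if n + (d - d') \<in> ?BZ then overlap n * echar ((n + (d - d')) \<bullet> (Ai *v x)) else 0)
      = (\<Sum>n\<in>{n\<in>overlaps. n + (d - d') \<in> ?BZ}. overlap n * echar ((n + (d - d')) \<bullet> (Ai *v x)))"
      using finite_overlaps by (simp add: sum.inter_filter)
    also have "\<dots> = (\<Sum>k\<in>{k\<in>overlaps. overlap (B *v k + d' - d) \<noteq> 0}. overlap (B *v k + d' - d) * echar (k \<bullet> x))"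
    proof (rule sum.reindex_bij_witness[of _ "\<lambda>k. B *v k + d' - d" "\<lambda>n. Bi *v (n + (d - d'))"])
      fix n assume n: "n \<in> {n\<in>overlaps. n + (d - d') \<in> ?BZ}"
      then obtain k where k: "k \<in> int_vecs" "n + (d - d') = B *v k" by auto
      have n_eq: "n = B *v k + d' - d" using k(2)[symmetric] by simp
      have "n + (d - d') \<in> G" using n d G_digits G_add by (auto simp: overlaps_def)
      then have "k \<in> G" using G_B_imp k by simp
      then have "k \<in> overlaps" using inO[of k] n n_eq by (auto simp: overlaps_def)
      then show "Bi *v (n + (d - d')) \<in> {k\<in>overlaps. overlap (B *v k + d' - d) \<noteq> 0}"
        using n n_eq k(2) by (auto simp: overlaps_def)
      show "B *v (Bi *v (n + (d - d'))) + d' - d = n" by simp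
      show "overlap (B *v (Bi *v (n + (d - d'))) + d' - d) * echar ((Bi *v (n + (d - d'))) \<bullet> x)
          = overlap n * echar ((n + (d - d')) \<bullet> (Ai *v x))"
        by (simp add: inner_Bi)
    next
      fix k assume k: "k \<in> {k\<in>overlaps. overlap (B *v k + d' - d) \<noteq> 0}"
      have e: "B *v k + d' - d + (d - d') = B *v k" by simp
      then show "Bi *v (B *v k + d' - d + (d - d')) = k" by (simp only: Bi_B)
      have "B *v k + (d' - d) \<in> G" using k d G_B G_digits by (intro G_add) (auto simp: overlaps_def)
      then show "B *v k + d' - d \<in> {n\<in>overlaps. n + (d - d') \<in> ?BZ}"
        using k e G_int_vecs by (auto simp: overlaps_def add_diff_eq)
    qed
    also have "\<dots> = (\<Sum>k\<in>overlaps. overlap (B *v k + d' - d) * echar (k \<bullet> x))"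
      using finite_overlaps by (intro sum.mono_neutral_left) auto
    finally show "(\<Sum>n\<in>overlaps. if n + (d - d') \<in> ?BZ then overlap n * echar ((n + (d - d')) \<bullet> (Ai *v x)) else 0)
       = (\<Sum>k\<in>overlaps. overlap (B *v k + d' - d) * echar (k \<bullet> x))" .
  qed
  also have "\<dots> = (\<Sum>k\<in>overlaps. \<Sum>d\<in>D. \<Sum>d'\<in>D. overlap (B *v k + d' - d) * echar (k \<bullet> x))"
    by (rule sym, subst sum.swap, rule sum.cong[OF refl], rule sum.swap)
  also have "\<dots> = (\<Sum>k\<in>overlaps. complex_of_real (\<Sum>d\<in>D. \<Sum>d'\<in>D. overlap (B *v k + d' - d)) * echar (k \<bullet> x))"
    by (simp add: sum_distrib_right)
  also have "\<dots> = (\<Sum>k\<in>overlaps. complex_of_real (q * overlap k) * echar (k \<bullet> x))"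
    by (simp only: overlap_refinement)
  also have "\<dots> / q = correlation x"
    using q_pos by (simp add: correlation_def expsum_def sum_divide_distrib)
  finally show ?thesis by simp
qed

lemma correlation_real: "correlation x = complex_of_real (Re (correlation x))"
proof -
  have "cnj (correlation x) = (\<Sum>n\<in>overlaps. overlap n * echar ((- n) \<bullet> x))"
    by (simp add: correlation_def expsum_def echar_minus)
  also have "\<dots> = correlation x"
    unfolding correlation_def expsum_def
    by (rule sum.reindex_bij_witness[of _ uminus uminus]) (auto simp: overlaps_def overlap_minus G_minus)
  finally show ?thesis by (simp add: complex_eq_iff)
qed

lemma correlation_periodic: "z \<in> int_vecs \<Longrightarrow> correlation (x + z) = correlation x"
  unfolding correlation_def expsum_def using G_int_vecs
  by (intro sum.cong refl arg_cong2[where f="(*)"])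
     (auto simp: inner_add_right overlaps_def subset_iff intro!: echar_add_Ints inner_int_vecs)

lemma Re_correlation_le: "Re (correlation x) \<le> (\<Sum>n\<in>overlaps. overlap n)"
proof -
  have "cmod (correlation x) \<le> (\<Sum>n\<in>overlaps. overlap n)"
    unfolding correlation_def expsum_def by (intro sum_norm_le) (simp add: norm_mult overlap_def)
  then show ?thesis using complex_Re_le_cmod[of "correlation x"] by linarith
qed

lemma correlation_on_P: "x \<in> P \<Longrightarrow> correlation x = (\<Sum>n\<in>overlaps. overlap n)"
proof -
  assume x: "x \<in> P"
  have "echar (n \<bullet> x) = 1" if "n \<in> overlaps" for n
    using that x by (simp add: overlaps_def G_iff echar_eq_1_iff)
  then show ?thesis by (simp add: correlation_def expsum_def)
qed

text \<open>The set where the real function \<open>correlation\<close> is minimal is the zero set of an exponential sum, and it is invariant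
  since \<open>correlation_transfer\<close> is a weighted mean. So the minimum is attained on \<open>P\<close>, where the maximum is
  attained as well.\<close>

theorem overlap_zero:
  assumes n: "n \<in> G" "n \<noteq> 0"
  shows "overlap n = 0"
proof (rule ccontr)
  assume nz: "overlap n \<noteq> 0"
  have cont: "continuous_on S correlation" for S
    unfolding correlation_def by (intro continuous_intros)
  have "continuous_on unit_cube (\<lambda>x. Re (correlation x))" by (intro continuous_intros cont)
  moreover have "unit_cube \<noteq> ({} :: (real^'n) set)" using fpart_in_cube by blast
  ultimately obtain x0 where x0: "\<And>x. x \<in> unit_cube \<Longrightarrow> Re (correlation x0) \<le> Re (correlation x)"
    using continuous_attains_inf[OF compact_unit_cube] by metis
  define \<mu> where "\<mu> = Re (correlation x0)"
  have min: "\<mu> \<le> Re (correlation x)" for x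
    using x0[OF fpart_in_cube[of x]] correlation_periodic[OF fpart_diff, of "fpart x" x] by (simp add: \<mu>_def)
  define I where "I = insert 0 overlaps"
  define c where "c = (\<lambda>n. complex_of_real (overlap n - (if n = 0 then \<mu> else 0)))"
  have finI: "finite I" using finite_overlaps by (simp add: I_def)
  have h: "expsum I c (\<lambda>n. n) x = correlation x - complex_of_real \<mu>" for x
  proof -
    have "expsum I c (\<lambda>n. n) x = (\<Sum>n\<in>I. overlap n * echar (n \<bullet> x))
        - (\<Sum>n\<in>I. if n = 0 then complex_of_real \<mu> else 0)"
      unfolding expsum_def sum_subtractf[symmetric]
      by (intro sum.cong refl) (auto simp: c_def left_diff_distrib)
    also have "(\<Sum>n\<in>I. overlap n * echar (n \<bullet> x)) = correlation x"
      unfolding correlation_def expsum_def I_def using finite_overlaps G_0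
      by (intro sum.mono_neutral_right) (auto simp: overlaps_def)
    also have "(\<Sum>n\<in>I. if n = 0 then complex_of_real \<mu> else 0) = complex_of_real \<mu>"
      using finI by (simp add: I_def)
    finally show ?thesis .
  qed
  have h0: "expsum I c (\<lambda>n. n) x = 0 \<longleftrightarrow> Re (correlation x) = \<mu>" for x
    unfolding h using correlation_real[of x] by (metis eq_iff_diff_eq_0 of_real_eq_iff)
  have nI: "n \<in> I" "c n \<noteq> 0" using n nz by (auto simp: I_def overlaps_def c_def)
  have "invariant_set {x. expsum I c (\<lambda>n. n) x = 0}"
    unfolding invariant_set_def h0
  proof (intro conjI ballI allI impI)
    show "{x. Re (correlation x) = \<mu>} \<noteq> {}" using \<mu>_def by blast
  next
    fix x z :: "real^'n" assume "x \<in> {x. Re (correlation x) = \<mu>}" "z \<in> int_vecs"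
    then show "x + z \<in> {x. Re (correlation x) = \<mu>}" by (simp add: correlation_periodic)
  next
    fix x assume "A *v x \<in> {x. Re (correlation x) = \<mu>}" and mx: "m x \<noteq> 0"
    then have Ax: "Re (correlation (A *v x)) = \<mu>" by simp
    let ?y = "\<lambda>l. Ai *v (A *v x + l)"
    have "(\<Sum>l\<in>L. (cmod (m (?y l)))\<^sup>2 * (Re (correlation (?y l)) - \<mu>))
        = (\<Sum>l\<in>L. (cmod (m (?y l)))\<^sup>2 * Re (correlation (?y l))) - (\<Sum>l\<in>L. (cmod (m (?y l)))\<^sup>2) * \<mu>"
      by (simp add: right_diff_distrib sum_subtractf sum_distrib_right)
    also have "(\<Sum>l\<in>L. (cmod (m (?y l)))\<^sup>2 * Re (correlation (?y l))) = Re (correlation (A *v x))"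
      by (subst (2) correlation_transfer) (simp add: Re_sum)
    finally have "(\<Sum>l\<in>L. (cmod (m (?y l)))\<^sup>2 * (Re (correlation (?y l)) - \<mu>)) = 0"
      by (simp add: sum_mask_square Ax)
    then have zero: "\<forall>l\<in>L. (cmod (m (?y l)))\<^sup>2 * (Re (correlation (?y l)) - \<mu>) = 0"
      using finite_L min by (subst (asm) sum_nonneg_eq_0_iff) auto
    \<comment> \<open>modulo integer vectors \<open>x\<close> is one of the preimages of \<open>A x\<close> in the sum over \<open>L\<close>\<close>
    obtain l where l: "l \<in> L" "Ai *v (0 + l) \<in> int_vecs" by (rule L_representative_exists[OF int_vecs_0])
    have yl: "?y l = x + Ai *v l" by (simp add: matrix_vector_right_distrib)
    have "m (?y l) \<noteq> 0" unfolding yl using l(2) mx by (simp add: mask_periodic)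
    then have "Re (correlation (?y l)) = \<mu>" using zero l(1) by auto
    then show "x \<in> {x. Re (correlation x) = \<mu>}" unfolding yl using l(2) by (simp add: correlation_periodic)
  qed
  then obtain x where x: "x \<in> P" "expsum I c (\<lambda>n. n) x = 0"
    using vanishing_sum_vanishes_on_P[where I=I and c=c, OF finI nI] by blast
  then have "\<mu> = (\<Sum>n\<in>overlaps. overlap n)" using h0 correlation_on_P[OF x(1)] by simp
  then have "Re (correlation y) = \<mu>" for y using min[of y] Re_correlation_le[of y] by simp
  then have "expsum I c (\<lambda>n. n) y = 0" for y using h0 by blast
  then have "c n = 0" using expsum_independent[where c=c and \<omega>="\<lambda>n. n", OF finI _ _ nI(1)] by simp
  then show False using nI(2) by simp
qed

lemma translates_negligible:
  assumes "\<gamma> \<in> G" "\<gamma>' \<in> G" "\<gamma> \<noteq> \<gamma>'"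
  shows "negligible ((+) \<gamma> ` X \<inter> (+) \<gamma>' ` X)"
proof -
  have "measure lebesgue ((+) \<gamma> ` X \<inter> (+) \<gamma>' ` X) = 0"
    unfolding overlap_translate using assms by (intro overlap_zero G_diff) auto
  moreover have "(+) \<gamma> ` X \<inter> (+) \<gamma>' ` X \<in> lmeasurable"
    by (intro lmeasurable_compact compact_Int compact_translate_X)
  ultimately show ?thesis by (simp add: negligible_iff_measure0)
qed

text \<open>Let \<open>Y\<close> be the union. For a fixed digit \<open>d0\<close> the contraction \<open>y \<mapsto> Bi *v (y + d0)\<close> maps \<open>Y\<close> into itself. As
  every point is within a fixed distance of \<open>Y\<close>, iteration shows that \<open>Y\<close> is dense, and it is closed.\<close>

lemma translates_cover: "(\<Union>\<gamma>\<in>G. (+) \<gamma> ` X) = UNIV"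
proof -
  define Y where "Y = (\<Union>\<gamma>\<in>G. (+) \<gamma> ` X)"
  have "closed G"
  proof -
    have "G = (\<Inter>x\<in>P. {n. n \<bullet> x \<in> \<int>})" by (auto simp: G_iff)
    moreover have "closed {n. n \<bullet> x \<in> \<int>}" for x :: "real^'n"
      using closed_vimage[OF closed_Ints, of "\<lambda>n. n \<bullet> x"] by (simp add: vimage_def continuous_intros)
    ultimately show ?thesis using closed_INT[of P "\<lambda>x. {n. n \<bullet> x \<in> \<int>}"] by simp
  qed
  then have "closed (\<Union>\<gamma>\<in>G. \<Union>x\<in>X. {\<gamma> + x})" using compact_X by (rule closed_compact_sums)
  moreover have "(\<Union>\<gamma>\<in>G. \<Union>x\<in>X. {\<gamma> + x}) = Y" by (auto simp: Y_def)
  ultimately have closedY: "closed Y" by simp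
  obtain d0 where d0: "d0 \<in> D" using D_nonempty by blast
  define \<tau> where "\<tau> = (\<lambda>y. Bi *v (y + d0))"
  have \<tau>Y: "\<tau> y \<in> Y" if yY: "y \<in> Y" for y
  proof -
    obtain \<gamma> x where x: "\<gamma> \<in> G" "x \<in> X" "y = \<gamma> + x" using yY by (auto simp: Y_def)
    have "\<gamma> + d0 \<in> int_vecs" using x(1) d0 G_int_vecs D_int by auto
    then obtain d z where d: "d \<in> D" "z \<in> int_vecs" "\<gamma> + d0 = d + B *v z" by (rule representative_exists)
    have "B *v z = \<gamma> + (d0 - d)" using d(3) by (simp add: algebra_simps)
    then have zG: "z \<in> G" using G_B_imp[OF d(2)] G_add[OF x(1) G_digits[OF d0 d(1)]] by simp
    have "d + x \<in> (\<Union>d\<in>D. (+) d ` X)" using d(1) x(2) by blast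
    then obtain x' where x': "x' \<in> X" "d + x = B *v x'" unfolding B_X[symmetric] by blast
    have "y + d0 = (d + x) + B *v z" using x(3) d(3) by (simp add: algebra_simps)
    also have "\<dots> = B *v (z + x')" by (simp add: x'(2) matrix_vector_right_distrib add.commute)
    finally have "\<tau> y = z + x'" by (simp add: \<tau>_def)
    then show ?thesis using zG x'(1) by (auto simp: Y_def)
  qed
  obtain x0 where x0: "x0 \<in> X" using X_nonempty by blast
  \<comment> \<open>the dual of the lattice \<open>P = M \<int>\<^sup>n\<close> contains the lattice generated by the inverse transpose of \<open>M\<close>\<close>
  obtain R where R: "\<And>w. \<exists>y\<in>Y. norm (w - y) \<le> R"
  proof -
    obtain M :: "real^'n^'n" where M: "invertible M" "P = (\<lambda>z. M *v z) ` int_vecs"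
      using is_lattice_P unfolding is_lattice_def by blast
    define N where "N = transpose (matrix_inv M)"
    have NG: "N *v z \<in> G" if z: "z \<in> int_vecs" for z
      unfolding G_iff M(2)
    proof clarify
      fix w :: "real^'n" assume w: "w \<in> int_vecs"
      have "(N *v z) \<bullet> (M *v w) = z \<bullet> (matrix_inv M *v (M *v w))"
        unfolding N_def by (rule inner_transpose[symmetric])
      also have "\<dots> = z \<bullet> w" by (simp add: matrix_vector_mul_assoc matrix_inv_left[OF M(1)])
      finally show "(N *v z) \<bullet> (M *v w) \<in> \<int>" using inner_int_vecs[OF z w] by simp
    qed
    have invN: "invertible N" unfolding N_def using M(1)
      by (metis invertible_det_nz det_transpose matrix_inv_left matrix_inv_right invertible_def)
    have "bounded ((\<lambda>z. N *v z) ` unit_cube)"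
      by (intro bounded_linear_image compact_imp_bounded compact_unit_cube) simp
    then obtain R where R: "\<And>c. c \<in> unit_cube \<Longrightarrow> norm (N *v c) \<le> R" by (auto simp: bounded_iff)
    have "\<exists>y\<in>Y. norm (w - y) \<le> R" for w
    proof -
      define t where "t = matrix_inv N *v (w - x0)"
      have Nt: "N *v t = w - x0" by (simp add: t_def matrix_vector_mul_assoc matrix_inv_right[OF invN])
      have "N *v (t - fpart t) + x0 \<in> Y" using NG[OF fpart_diff] x0 by (auto simp: Y_def)
      moreover have "w - (N *v (t - fpart t) + x0) = N *v fpart t"
        using Nt by (simp add: matrix_vector_mult_diff_distrib algebra_simps)
      then have "norm (w - (N *v (t - fpart t) + x0)) \<le> R" using R[OF fpart_in_cube] by simp
      ultimately show ?thesis by blast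
    qed
    then show ?thesis by (rule that)
  qed
  obtain C s where C: "C > 0" "0 < s" "s < 1" "\<And>k x. norm (((*v) Bi ^^ k) x) \<le> C * s ^ k * norm x"
    by (rule Bi_contracts) (rule that)
  define \<tau>' where "\<tau>' = (\<lambda>x. B *v x - d0)"
  have \<tau>\<tau>': "\<tau> (\<tau>' x) = x" for x by (simp add: \<tau>_def \<tau>'_def)
  have diff: "(\<tau> ^^ k) x - (\<tau> ^^ k) y = ((*v) Bi ^^ k) (x - y)" for k x y
  proof (induction k)
    case (Suc k)
    have "(\<tau> ^^ Suc k) x - (\<tau> ^^ Suc k) y = Bi *v ((\<tau> ^^ k) x - (\<tau> ^^ k) y)"
      by (simp add: \<tau>_def matrix_vector_right_distrib matrix_vector_mult_diff_distrib)
    then show ?case by (simp add: Suc.IH)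
  qed simp
  have back_forth: "(\<tau> ^^ k) ((\<tau>' ^^ k) x) = x" for k x
    by (induction k arbitrary: x) (simp_all add: \<tau>\<tau>' funpow_swap1)
  have itY: "(\<tau> ^^ k) y \<in> Y" if "y \<in> Y" for k y using that \<tau>Y by (induction k) auto
  have "w \<in> Y" for w
  proof -
    have "\<exists>y\<in>Y. dist y w < e" if e: "e > 0" for e
    proof -
      have "(\<lambda>k. C * s ^ k * R) \<longlonglongrightarrow> C * 0 * R" using C by (intro tendsto_intros LIMSEQ_power_zero) simp
      then have "eventually (\<lambda>k. C * s ^ k * R < e) sequentially"
        by (rule order_tendstoD) (use e in simp)
      then obtain k where k: "C * s ^ k * R < e" by (auto simp: eventually_sequentially)
      obtain y where y: "y \<in> Y" "norm ((\<tau>' ^^ k) w - y) \<le> R" using R by blast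
      have "w - (\<tau> ^^ k) y = ((*v) Bi ^^ k) ((\<tau>' ^^ k) w - y)"
        using diff[of k "(\<tau>' ^^ k) w" y] by (simp add: back_forth)
      then have "norm (w - (\<tau> ^^ k) y) \<le> C * s ^ k * norm ((\<tau>' ^^ k) w - y)" using C(4) by simp
      also have "\<dots> \<le> C * s ^ k * R" using y(2) C by (intro mult_left_mono) auto
      finally show ?thesis using k itY[OF y(1)] by (intro bexI[of _ "(\<tau> ^^ k) y"]) (auto simp: dist_norm norm_minus_commute)
    qed
    then have "w \<in> closure Y" by (simp add: closure_approachable)
    then show ?thesis using closedY by simp
  qed
  then show ?thesis by (auto simp: Y_def)
qed

lemma tiles: "tiles_by X (dual_lattice P)"
proof -
  have eq: "(\<lambda>x. x + \<gamma>) ` X = (+) \<gamma> ` X" for \<gamma> by (simp add: add.commute)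
  show ?thesis
    unfolding tiles_by_def eq G_def[symmetric] translates_cover using translates_negligible by simp
qed

end

theorem corollary6p29:
  fixes A :: "real^'n^'n" and D L :: "(real^'n) set"
  assumes "hadamard_triple A D L"
    and "complete_representatives (transpose A) D"
    and "no_proper_invariant_subspaces A"
  shows "(\<exists>\<Lambda>. smallest_admissible_lattice A D L \<Lambda>) \<and>
    (\<forall>\<Lambda>. smallest_admissible_lattice A D L \<Lambda> \<longrightarrow>
       tiles_by (attractor (transpose A) D) (dual_lattice \<Lambda>))"
proof -
  interpret irreducible_hadamard A D L by unfold_locales (fact assms)+
  show ?thesis using smallest_admissible_iff tiles by simp
qed

end
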